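(* Let $d\ge 1$ be an integer, let $1<p<\infty$ and let $f\in L^1_{\mathrm{loc}}(\mathbb{R}^d)$. Then $f\in\dot W^{1,p}(\mathbb{R}^d)$ if and only if $m_f\in L^p_{\mathrm{weak}}(\mathbb{R}^{d+1}_+,\nu_p)$, i.e. $\sup_{\kappa>0}\kappa^p\,\nu_p(\{m_f>\kappa\})<\infty$. In this case $$ C^{-1}\,\|\nabla f\|_{L^p(\mathbb{R}^d)}^p\ \le\ \sup_{\kappa>0}\kappa^p\,\nu_p(\{m_f>\kappa\})\ \le\ C\,\|\nabla f\|_{L^p(\mathbb{R}^d)}^p , $$ where $C\in(0,\infty)$ is a constant depending only on $d$ and $p$ (not on $f$). Moreover, in this case, $$ \lim_{\kappa\to 0^+}\kappa^p\,\nu_p(\{m_f>\kappa\}) = c_{d,p}\,\|\nabla f\|_{L^p(\mathbb{R}^d)}^p \qquad\text{with}\qquad c_{d,p}=\frac1p\left(\frac{1}{\sqrt\pi}\,\frac{\Gamma(\frac{d+2}{2})}{\Gamma(\frac{d+3}{2})}\right)^p . $$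
   Context: Functions are real-valued. The space $\dot W^{1,p}(\mathbb{R}^d)$ consists of all $f\in L^1_{\mathrm{loc}}(\mathbb{R}^d)$ whose distributional gradient satisfies $\nabla f\in L^p(\mathbb{R}^d)$; $|\nabla f|$ is the Euclidean norm and $\|\nabla f\|_{L^p(\mathbb{R}^d)}^p=\int_{\mathbb{R}^d}|\nabla f|^p\,dx$. Write $\mathbb{R}_+=(0,\infty)$, $\mathbb{R}^{d+1}_+=\mathbb{R}^d\times\mathbb{R}_+$ and, for $(a,r)\in\mathbb{R}^{d+1}_+$, $B_r(a)=\{x\in\mathbb{R}^d:\ |x-a|<r\}$. For $f\in L^1_{\mathrm{loc}}(\mathbb{R}^d)$ define $m_f:\mathbb{R}^{d+1}_+\to[0,\infty)$ by $$ m_f(a,r)=\frac{1}{|B_r(a)|}\int_{B_r(a)}\left|f(x)-\frac{1}{|B_r(a)|}\int_{B_r(a)}f(y)\,dy\right|dx . $$ The measure $\nu_p$ on $\mathbb{R}^{d+1}_+$ is $d\nu_p(a,r)=\dfrac{da\,dr}{r^{p+1}}$. The set $\{m_f>\kappa\}$ is $\{(a,r)\in\mathbb{R}^{d+1}_+:\ m_f(a,r)>\kappa\}$. *)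

theory Defs
  imports "HOL-Analysis.Analysis"
begin

definition locally_integrable :: "(real^'n \<Rightarrow> 'b::euclidean_space) \<Rightarrow> bool" where
  "locally_integrable f \<longleftrightarrow> (\<forall>K. compact K \<longrightarrow> set_integrable lebesgue K f)"

text \<open>The Frechet derivative in direction \<open>axis i 1\<close>; it is only applied to differentiable
  functions, where it is the classical \<open>i\<close>-th partial derivative.\<close>

definition partial_deriv :: "'n \<Rightarrow> (real^'n \<Rightarrow> real) \<Rightarrow> real^'n \<Rightarrow> real" where
  "partial_deriv i \<phi> x = frechet_derivative \<phi> (at x) (axis i 1)"

primrec Ck :: "nat \<Rightarrow> (real^'n \<Rightarrow> real) \<Rightarrow> bool" where
  "Ck 0 \<phi> \<longleftrightarrow> continuous_on UNIV \<phi>"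
| "Ck (Suc k) \<phi> \<longleftrightarrow> \<phi> differentiable_on UNIV \<and> (\<forall>i. Ck k (partial_deriv i \<phi>))"

definition test_function :: "(real^'n \<Rightarrow> real) \<Rightarrow> bool" where
  "test_function \<phi> \<longleftrightarrow> (\<forall>k. Ck k \<phi>) \<and> compact (closure {x. \<phi> x \<noteq> 0})"

definition has_weak_gradient :: "(real^'n \<Rightarrow> real) \<Rightarrow> (real^'n \<Rightarrow> real^'n) \<Rightarrow> bool" where
  "has_weak_gradient f g \<longleftrightarrow> locally_integrable g \<and>
     (\<forall>\<phi> i. test_function \<phi> \<longrightarrow>
        (LINT x|lebesgue. f x * partial_deriv i \<phi> x) = - (LINT x|lebesgue. g x $ i * \<phi> x))"

text \<open>The weak gradient is unique up to a null set; this picks a representative.\<close>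

definition weak_gradient :: "(real^'n \<Rightarrow> real) \<Rightarrow> real^'n \<Rightarrow> real^'n" where
  "weak_gradient f = (SOME g. has_weak_gradient f g)"

text \<open>Since \<open>L\<^sup>p\<close> functions are locally integrable, a distributional gradient in \<open>L\<^sup>p\<close> is a weak
  gradient in the above sense. Measurability of \<open>g\<close> is part of its local integrability.\<close>

definition homogeneous_sobolev :: "real \<Rightarrow> (real^'n \<Rightarrow> real) set" where
  "homogeneous_sobolev p = {f. locally_integrable f \<and>
     (\<exists>g. has_weak_gradient f g \<and> integrable lebesgue (\<lambda>x. norm (g x) powr p))}"

text \<open>The \<open>p\<close>-th power of the \<open>L\<^sup>p\<close> norm of the gradient, meaningful for
  \<open>f \<in> homogeneous_sobolev p\<close>.\<close>

definition gradient_Lp_pow :: "real \<Rightarrow> (real^'n \<Rightarrow> real) \<Rightarrow> real" where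
  "gradient_Lp_pow p f = (LINT x|lebesgue. norm (weak_gradient f x) powr p)"

definition ball_average :: "(real^'n \<Rightarrow> real) \<Rightarrow> real^'n \<Rightarrow> real \<Rightarrow> real" where
  "ball_average f a r = (LINT x:ball a r|lebesgue. f x) / measure lebesgue (ball a r)"

definition mean_oscillation :: "(real^'n \<Rightarrow> real) \<Rightarrow> (real^'n) \<times> real \<Rightarrow> real" where
  "mean_oscillation f = (\<lambda>(a, r). ball_average (\<lambda>x. \<bar>f x - ball_average f a r\<bar>) a r)"

definition nu :: "real \<Rightarrow> ((real^'n) \<times> real) measure" where
  "nu p = density (restrict_space lborel (UNIV \<times> {0<..})) (\<lambda>(a, r). ennreal (1 / r powr (p + 1)))"

definition weak_Lp_sup :: "'a measure \<Rightarrow> real \<Rightarrow> ('a \<Rightarrow> real) \<Rightarrow> ennreal" where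
  "weak_Lp_sup M p g =
     (SUP \<kappa>\<in>{0<..}. ennreal (\<kappa> powr p) * emeasure M {z \<in> space M. \<bar>g z\<bar> > \<kappa>})"

definition weak_Lp :: "'a measure \<Rightarrow> real \<Rightarrow> ('a \<Rightarrow> real) set" where
  "weak_Lp M p = {g \<in> borel_measurable M. weak_Lp_sup M p g < \<infinity>}"

definition limit_constant :: "nat \<Rightarrow> real \<Rightarrow> real" where
  "limit_constant d p =
     1 / p * (1 / sqrt pi * (Gamma ((real d + 2) / 2) / Gamma ((real d + 3) / 2))) powr p"

end

theory Submission
  imports Defs
begin

text \<open>
  Both directions rest on rescaling \<open>r = \<kappa> s\<close>, which turns \<open>\<kappa>\<^sup>p \<nu>\<^sub>p(m\<^sub>f > \<kappa>)\<close> into the integral of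
  \<open>s\<^sup>-\<^sup>p\<^sup>-\<^sup>1 |{a. m\<^sub>f(a, \<kappa> s) > \<kappa>}|\<close> over \<open>s > 0\<close>.

  If \<open>f\<close> has gradient \<open>g\<close>, then \<open>f(a + u) - f(a)\<close> is the integral of \<open>g(a + t u) \<bullet> u\<close> over \<open>t \<in> [0, 1]\<close>.
  Splitting \<open>g\<close> at the height \<open>\<kappa> / (4 r)\<close> bounds the measure of \<open>{a. m\<^sub>f(a, \<kappa> s) > \<kappa>}\<close> by a function of
  \<open>s\<close> that does not depend on \<open>\<kappa>\<close> and whose weighted integral is a multiple of the integral of \<open>|g|\<^sup>p\<close>;
  no maximal function is needed. The same function dominates the limit \<open>\<kappa> \<rightarrow> 0\<close>, in which
  \<open>m\<^sub>f(a, \<kappa> s) / \<kappa>\<close> converges in measure to \<open>s |g(a)|\<close> times the mean of \<open>|u\<^sub>1|\<close> over the unit ball, by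
  continuity of translations in the mean.

  Conversely, the difference quotient \<open>G\<^sub>r\<close> of ball averages at scale \<open>r\<close> satisfies
  \<open>r |G\<^sub>r(a)| \<le> C m\<^sub>f(a, 2 r)\<close>. Averaging the weak-type bound over a logarithmic range of \<open>\<kappa> = r / s\<close> yields
  arbitrarily small \<open>r\<close> for which \<open>G\<^sub>r\<close> is bounded in \<open>L\<^sup>p\<close>, and a weak limit of these is the gradient.
\<close>

text \<open>The lower bound comes out of the limit: the supremum dominates the limit at 0+, so the
  limit constant supplies \<open>1 / C\<close>, and the converse only has to produce some gradient
  with finite p-th moment. The obstacle there is that the hypothesis controls, for fixed
  \<open>\<kappa>\<close>, an integral over all radii, whereas difference quotients live at a single
  radius. By the layer-cake formula the p-th moment of G_r is p times the integral of s^(-p-1) |{s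
  |G_r| > 1}| over s at fixed r; the hypothesis bounds the same integrand along r =
  \<open>\<kappa>\<close> s. Averaging with dr / r exchanges the two, at the price of a in a ball
  and s in a window; a crude bound of G_r by a power of 1 / r makes the remaining s harmless, so the
  resulting L^p bound is independent of the ball. The exponent p > 1 enters twice: only then is the
  excess over a height integrable against s^(-p-1) ds, and only then do L^p bounds give uniform
  integrability. The analysis runs on Borel representatives, because joint measurability of maps
  like (a, t) -> f(a + t u) is immediate only for Borel f.\<close>

section \<open>Smooth test functions\<close>

lemma Ck_SucD: "Ck (Suc k) \<phi> \<Longrightarrow> Ck k \<phi>"
proof (induction k arbitrary: \<phi>)
  case 0
  then show ?case by (auto intro: differentiable_imp_continuous_on)
next
  case (Suc k)
  then show ?case by (metis Ck.simps(2))
qed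

lemma partial_deriv_eqI:
  assumes "(\<phi> has_derivative D) (at x)"
  shows "partial_deriv i \<phi> x = D (axis i 1)"
  unfolding partial_deriv_def using frechet_derivative_at[OF assms] by simp

lemma differentiable_UNIV_has_derivative:
  assumes "\<phi> differentiable_on UNIV"
  shows "(\<phi> has_derivative frechet_derivative \<phi> (at x)) (at x)"
  using assms by (auto simp: differentiable_on_def frechet_derivative_works[symmetric])

lemma Ck_const: "Ck k (\<lambda>x. c)"
proof (induction k arbitrary: c)
  case (Suc k)
  have "partial_deriv i (\<lambda>x. c) = (\<lambda>x. 0)" for i :: 'a
    by (rule ext, subst partial_deriv_eqI[OF has_derivative_const]) simp
  with Suc show ?case by simp
qed simp

lemma partial_deriv_mult:
  assumes "\<phi> differentiable_on UNIV" "\<psi> differentiable_on UNIV"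
  shows "partial_deriv i (\<lambda>x. \<phi> x * \<psi> x) = (\<lambda>x. \<phi> x * partial_deriv i \<psi> x + partial_deriv i \<phi> x * \<psi> x)"
  by (rule ext, subst partial_deriv_eqI[OF has_derivative_mult[OF differentiable_UNIV_has_derivative[OF assms(1)]
        differentiable_UNIV_has_derivative[OF assms(2)]]]) (simp add: partial_deriv_def)

lemma partial_deriv_add:
  assumes "\<phi> differentiable_on UNIV" "\<psi> differentiable_on UNIV"
  shows "partial_deriv i (\<lambda>x. \<phi> x + \<psi> x) = (\<lambda>x. partial_deriv i \<phi> x + partial_deriv i \<psi> x)"
  by (rule ext, subst partial_deriv_eqI[OF has_derivative_add[OF differentiable_UNIV_has_derivative[OF assms(1)]
        differentiable_UNIV_has_derivative[OF assms(2)]]]) (simp add: partial_deriv_def)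

lemma Ck_add: "Ck k \<phi> \<Longrightarrow> Ck k \<psi> \<Longrightarrow> Ck k (\<lambda>x. \<phi> x + \<psi> x)"
proof (induction k arbitrary: \<phi> \<psi>)
  case (Suc k)
  then show ?case by (simp add: partial_deriv_add differentiable_on_add)
qed (auto intro: continuous_on_add)

lemma Ck_mult: "Ck k \<phi> \<Longrightarrow> Ck k \<psi> \<Longrightarrow> Ck k (\<lambda>x. \<phi> x * \<psi> x)"
proof (induction k arbitrary: \<phi> \<psi>)
  case (Suc k)
  have "Ck k \<phi>" "Ck k \<psi>" using Suc.prems Ck_SucD by blast+
  with Suc show ?case by (auto simp: partial_deriv_mult differentiable_on_mult intro!: Ck_add)
qed (auto intro: continuous_on_mult)

lemma Ck_prod: "(\<And>i. i \<in> A \<Longrightarrow> Ck k (\<phi> i)) \<Longrightarrow> Ck k (\<lambda>x. \<Prod>i\<in>A. \<phi> i x)"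
  by (induction A rule: infinite_finite_induct) (auto intro!: Ck_mult Ck_const)

lemma partial_deriv_translate:
  assumes "\<phi> differentiable_on UNIV"
  shows "partial_deriv i (\<lambda>x. \<phi> (x + v)) = (\<lambda>x. partial_deriv i \<phi> (x + v))"
proof
  fix x
  have "((\<lambda>x. \<phi> (x + v)) has_derivative (\<lambda>h. frechet_derivative \<phi> (at (x+v)) h)) (at x)"
    by (rule has_derivative_compose[where f="\<lambda>x. x + v" and f'="\<lambda>h. h"])
      (auto intro!: derivative_eq_intros differentiable_UNIV_has_derivative assms)
  from partial_deriv_eqI[OF this] show "partial_deriv i (\<lambda>x. \<phi> (x + v)) x = partial_deriv i \<phi> (x + v)"
    by (simp add: partial_deriv_def)
qed

lemma Ck_translate: "Ck k \<phi> \<Longrightarrow> Ck k (\<lambda>x. \<phi> (x + v))"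
proof (induction k arbitrary: \<phi>)
  case 0
  then show ?case by (auto intro!: continuous_on_compose2[of UNIV \<phi>] continuous_intros)
next
  case (Suc k)
  have "(\<lambda>x. \<phi> (x + v)) differentiable_on UNIV"
    using Suc.prems by (auto simp: differentiable_on_def intro!: differentiable_chain_within[of "\<lambda>x. x + v" _ UNIV \<phi>, unfolded o_def]
       derivative_intros)
  with Suc show ?case by (simp add: partial_deriv_translate)
qed

text \<open>The family P(1/t) exp(-1/t), extended by 0, is closed under differentiation; carrying
  the polynomial along turns smoothness into an induction over all P at once.\<close>

definition exp_flat :: "real poly \<Rightarrow> real \<Rightarrow> real" where
  "exp_flat P t = (if t > 0 then poly P (inverse t) * exp (- inverse t) else 0)"

lemma poly_exp_tendsto_0: "((\<lambda>y::real. poly P y * exp (- y)) \<longlongrightarrow> 0) at_top"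
proof -
  have "((\<lambda>y::real. \<Sum>i\<le>degree P. coeff P i * (y ^ i / exp y)) \<longlongrightarrow> (\<Sum>i\<le>degree P. coeff P i * 0)) at_top"
    by (intro tendsto_sum tendsto_mult tendsto_const tendsto_power_div_exp_0)
  then show ?thesis by (simp add: poly_altdef exp_minus sum_divide_distrib divide_inverse[symmetric])
qed

text \<open>For t > 0 the chain rule gives t^(-2) (P - P')(1/t) exp(-1/t), whence the polynomial X^2
  (P - P'). At 0 the exponential decay beats every power of 1/t.\<close>

lemma exp_flat_has_derivative:
  "(exp_flat P has_real_derivative exp_flat (monom 1 2 * (P - pderiv P)) t) (at t)"
proof -
  consider "t > 0" | "t < 0" | "t = 0" by linarith
  then show ?thesis
  proof cases
    case 1
    have "((\<lambda>t. poly P (inverse t) * exp (- inverse t)) has_real_derivative exp_flat (monom 1 2 * (P - pderiv P)) t) (at t)"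
      using 1 by (auto intro!: derivative_eq_intros DERIV_chain2[OF poly_DERIV] simp: exp_flat_def poly_monom field_simps power2_eq_square)
    then show ?thesis
      by (rule has_field_derivative_transform_within_open[of _ _ _ "{0<..}"]) (use 1 in \<open>auto simp: exp_flat_def\<close>)
  next
    case 2
    have "((\<lambda>t. 0) has_real_derivative exp_flat (monom 1 2 * (P - pderiv P)) t) (at t)"
      using 2 by (auto simp: exp_flat_def)
    then show ?thesis
      by (rule has_field_derivative_transform_within_open[of _ _ _ "{..<0}"]) (use 2 in \<open>auto simp: exp_flat_def\<close>)
  next
    case 3
    \<comment> \<open>The right difference quotient at 0 is y P(y) exp(-y) at y = 1/h.\<close>
    have "((\<lambda>y. poly (monom 1 1 * P) y * exp (- y)) \<longlongrightarrow> 0) at_top" by (rule poly_exp_tendsto_0)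
    then have "((\<lambda>h::real. poly (monom 1 1 * P) (inverse h) * exp (- inverse h)) \<longlongrightarrow> 0) (at_right 0)"
      by (rule filterlim_compose[OF _ filterlim_inverse_at_top_right])
    then have "((\<lambda>h. exp_flat P h / h) \<longlongrightarrow> 0) (at_right 0)"
      by (rule Lim_transform_eventually)
        (auto simp: eventually_at_filter exp_flat_def poly_monom field_simps)
    moreover have "((\<lambda>h. exp_flat P h / h) \<longlongrightarrow> 0) (at_left 0)"
      by (rule tendsto_eventually) (auto simp: eventually_at_filter exp_flat_def)
    ultimately have "((\<lambda>h. exp_flat P h / h) \<longlongrightarrow> 0) (at 0)" by (rule filterlim_split_at[rotated])
    then show ?thesis using 3 by (simp add: DERIV_def exp_flat_def)
  qed
qed

text \<open>The argument is affine with a free slope, so that the same statement serves the lower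
  faces of a box (positive slope) and the upper ones (negative slope).\<close>

lemma Ck_exp_flat: "Ck k (\<lambda>x::real^'n. exp_flat P (c * x $ i + b))"
proof (induction k arbitrary: P)
  case 0
  have "isCont (exp_flat P) t" for t using exp_flat_has_derivative[of P t] by (rule DERIV_isCont)
  then have "continuous_on UNIV (exp_flat P)" by (simp add: continuous_on_eq_continuous_at)
  then show ?case by (auto intro!: continuous_on_compose2[of UNIV "exp_flat P"] continuous_intros)
next
  case (Suc k)
  let ?P = "monom 1 2 * (P - pderiv P)"
  have D: "((\<lambda>x::real^'n. exp_flat P (c * x $ i + b)) has_derivative (\<lambda>h. exp_flat ?P (c * x $ i + b) * (c * h $ i))) (at x)" for x
    by (rule has_derivative_compose[where f="\<lambda>x. c * x $ i + b" and f'="\<lambda>h. c * h $ i"])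
      (auto intro!: derivative_eq_intros bounded_linear.has_derivative[OF bounded_linear_vec_nth] exp_flat_has_derivative[unfolded has_field_derivative_def])
  have "partial_deriv j (\<lambda>x::real^'n. exp_flat P (c * x $ i + b)) = (\<lambda>x. exp_flat ?P (c * x $ i + b) * (c * axis j 1 $ i))" for j
    by (rule ext) (rule partial_deriv_eqI[OF D])
  moreover have "(\<lambda>x::real^'n. exp_flat P (c * x $ i + b)) differentiable_on UNIV"
    using D by (auto simp: differentiable_on_def differentiable_def intro: has_derivative_at_withinI)
  ultimately show ?case using Suc by (auto intro!: Ck_mult Ck_const)
qed

section \<open>Support, boundedness and closure properties of test functions\<close>

lemma test_functionD:
  assumes "test_function \<phi>"
  shows "Ck k \<phi>" "continuous_on UNIV \<phi>" "\<phi> differentiable_on UNIV" "\<phi> \<in> borel_measurable borel"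
    "(\<phi> has_derivative frechet_derivative \<phi> (at x)) (at x)" "isCont \<phi> x"
proof -
  show "Ck k \<phi>" for k using assms by (simp add: test_function_def)
  from this[of 1] this[of 0] show "continuous_on UNIV \<phi>" and *: "\<phi> differentiable_on UNIV" by auto
  then show "\<phi> \<in> borel_measurable borel" "(\<phi> has_derivative frechet_derivative \<phi> (at x)) (at x)" "isCont \<phi> x"
    by (auto intro: borel_measurable_continuous_onI differentiable_UNIV_has_derivative simp: continuous_on_eq_continuous_at)
qed

lemma test_functionI:
  assumes "\<And>k. Ck k \<phi>" "\<And>x. \<phi> x \<noteq> 0 \<Longrightarrow> x \<in> K" "compact K"
  shows "test_function \<phi>"
proof -
  have "closure {x. \<phi> x \<noteq> 0} \<subseteq> K" using assms by (intro closure_minimal) (auto intro: compact_imp_closed)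
  then show ?thesis unfolding test_function_def
    using assms by (metis closed_closure compact_Int_closed inf.absorb2)
qed

lemma test_function_support:
  assumes "test_function \<phi>" obtains R where "R > 0" "\<And>x. norm x \<ge> R \<Longrightarrow> \<phi> x = 0"
proof -
  have "bounded (closure {x. \<phi> x \<noteq> 0})" using assms by (simp add: test_function_def compact_imp_bounded)
  then have "bounded {x. \<phi> x \<noteq> 0}" by (rule bounded_subset[OF _ closure_subset])
  then obtain B where B: "B > 0" "\<forall>x\<in>{x. \<phi> x \<noteq> 0}. norm x < B" unfolding bounded_pos_less by blast
  have "\<phi> x = 0" if "norm x \<ge> B" for x using B(2) that by (cases "\<phi> x = 0") auto
  with B(1) show thesis by (rule that)
qed

lemma test_function_translate: "test_function \<phi> \<Longrightarrow> test_function (\<lambda>x. \<phi> (x + v))"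
proof -
  assume a: "test_function \<phi>"
  obtain R where R: "\<And>x. norm x \<ge> R \<Longrightarrow> \<phi> x = 0" using test_function_support[OF a] by metis
  show "test_function (\<lambda>x. \<phi> (x + v))"
  proof (rule test_functionI)
    show "Ck k (\<lambda>x. \<phi> (x + v))" for k by (rule Ck_translate[OF test_functionD(1)[OF a]])
    show "x \<in> cball (-v) R" if "\<phi> (x + v) \<noteq> 0" for x
      using that R[of "x + v"] by (auto simp: dist_norm norm_minus_commute) (metis add.commute add_uminus_conv_diff linorder_linear minus_diff_eq norm_minus_commute)
  qed simp
qed

text \<open>The strict inequality places x in the open complement of a closed ball, where the
  function vanishes identically.\<close>

lemma partial_deriv_outside:
  assumes R: "\<And>x. norm x \<ge> R \<Longrightarrow> \<phi> x = 0" and x: "norm x > R"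
  shows "partial_deriv i \<phi> x = 0"
proof -
  have x: "x \<in> - cball 0 R" using x by simp
  have "((\<lambda>x. 0) has_derivative (\<lambda>h. 0)) (at x)" by simp
  then have "(\<phi> has_derivative (\<lambda>h. 0)) (at x)"
    by (rule has_derivative_transform_within_open[OF _ _ x]) (auto simp: R open_Compl)
  from partial_deriv_eqI[OF this, of i] show ?thesis by simp
qed

lemma Ck_sum: "(\<And>i. i \<in> A \<Longrightarrow> Ck k (\<phi> i)) \<Longrightarrow> Ck k (\<lambda>x. \<Sum>i\<in>A. \<phi> i x)"
  by (induction A rule: infinite_finite_induct) (auto intro!: Ck_add Ck_const)

lemma test_function_partial:
  assumes a: "test_function \<phi>" shows "test_function (partial_deriv i \<phi>)"
proof -
  obtain R where R: "\<And>x. norm x \<ge> R \<Longrightarrow> \<phi> x = 0" using test_function_support[OF a] by metis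
  show ?thesis
  proof (rule test_functionI)
    show "Ck k (partial_deriv i \<phi>)" for k using test_functionD(1)[OF a, of "Suc k"] by simp
    show "x \<in> cball 0 R" if "partial_deriv i \<phi> x \<noteq> 0" for x
      using partial_deriv_outside[OF R, where x=x and i=i] that by (cases "norm x \<le> R") auto
  qed simp
qed

lemma test_function_bounded:
  assumes a: "test_function \<phi>" obtains B where "B > 0" "\<And>x. \<bar>\<phi> x\<bar> \<le> B"
proof -
  obtain R where R: "R>0" "\<And>x. norm x \<ge> R \<Longrightarrow> \<phi> x = 0" using test_function_support[OF a] by metis
  have "compact (\<phi> ` cball 0 R)" using test_functionD(2)[OF a]
    by (intro compact_continuous_image) (auto intro: continuous_on_subset)
  then have "bounded (\<phi> ` cball 0 R)" by (rule compact_imp_bounded)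
  then obtain B where "B > 0" "\<forall>x\<in>cball 0 R. \<bar>\<phi> x\<bar> \<le> B" by (auto simp: bounded_pos)
  then show thesis using R by (intro that[of B]) (metis abs_0 less_le linorder_linear mem_cball_0)+
qed

lemma frechet_derivative_partial:
  assumes "test_function \<phi>"
  shows "frechet_derivative \<phi> (at x) u = (\<Sum>i\<in>UNIV. u $ i * partial_deriv i \<phi> x)"
proof -
  have l: "linear (frechet_derivative \<phi> (at x))" using test_functionD(5)[OF assms] by (rule has_derivative_linear)
  have "u = (\<Sum>i\<in>UNIV. u $ i *\<^sub>R axis i 1)" by (metis basis_expansion scalar_mult_eq_scaleR)
  then have "frechet_derivative \<phi> (at x) u = frechet_derivative \<phi> (at x) (\<Sum>i\<in>UNIV. u $ i *\<^sub>R axis i 1)" by simp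
  then show ?thesis by (simp add: linear_sum[OF l] linear_cmul[OF l] partial_deriv_def)
qed

lemma test_function_directional:
  assumes a: "test_function \<phi>" shows "test_function (\<lambda>x. frechet_derivative \<phi> (at x) u)"
proof -
  obtain R where R: "\<And>x. norm x \<ge> R \<Longrightarrow> \<phi> x = 0" using test_function_support[OF a] by metis
  show ?thesis unfolding frechet_derivative_partial[OF a]
  proof (rule test_functionI)
    show "Ck k (\<lambda>x. \<Sum>i\<in>UNIV. u $ i * partial_deriv i \<phi> x)" for k
      using test_functionD(1)[OF a, of "Suc k"] by (intro Ck_sum Ck_mult Ck_const) simp
    show "x \<in> cball 0 R" if "(\<Sum>i\<in>UNIV. u $ i * partial_deriv i \<phi> x) \<noteq> 0" for x
      using partial_deriv_outside[OF R, where x=x] that by (cases "norm x \<le> R") auto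
  qed simp
qed

text \<open>Products over the coordinates of ramps exp(-1/((n+1) t)), with t the signed distance to
  a face, tend to the indicator of the open box as n grows. The common bound by the closed box is
  the majorant for dominated convergence.\<close>

lemma box_bump:
  fixes l u :: "real^'n"
  obtains \<phi> :: "nat \<Rightarrow> real^'n \<Rightarrow> real" where "\<And>n. test_function (\<phi> n)" "\<And>n x. 0 \<le> \<phi> n x" "\<And>n x. \<phi> n x \<le> indicator (cbox l u) x"
    "\<And>x. (\<lambda>n. \<phi> n x) \<longlonglongrightarrow> indicator (box l u) x"
proof -
  define h where "h n t = exp_flat 1 (real (Suc n) * t)" for n t
  have h01: "0 \<le> h n t" "h n t \<le> 1" for n t
    using inverse_nonnegative_iff_nonnegative[of "(1 + real n) * t"] by (auto simp: h_def exp_flat_def)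
  have h0: "h n t = 0" if "t \<le> 0" for n t using that by (auto simp: h_def exp_flat_def zero_less_mult_iff)
  have hlim: "(\<lambda>n. h n t) \<longlonglongrightarrow> (if t > 0 then 1 else 0)" for t
  proof (cases "t > 0")
    case True
    have "(\<lambda>n. exp (- (inverse (real (Suc n)) * inverse t))) \<longlonglongrightarrow> exp (- (0 * inverse t))"
      by (intro tendsto_intros LIMSEQ_inverse_real_of_nat)
    then show ?thesis using True by (simp add: h_def exp_flat_def zero_less_mult_iff)
  qed (use h0 in simp)
  define \<phi> where "\<phi> n x = (\<Prod>i\<in>UNIV. h n (x $ i - l $ i) * h n (u $ i - x $ i))" for n and x :: "real^'n"
  show thesis
  proof
    show p0: "0 \<le> \<phi> n x" for n x unfolding \<phi>_def by (intro prod_nonneg) (simp add: h01)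
    have z: "\<phi> n x = 0" if "x \<notin> box l u" for n x
    proof -
      from that obtain i where "x $ i - l $ i \<le> 0 \<or> u $ i - x $ i \<le> 0" unfolding mem_box_cart by (meson diff_le_0_iff_le not_le)
      then have "h n (x $ i - l $ i) * h n (u $ i - x $ i) = 0" using h0 by auto
      then show ?thesis unfolding \<phi>_def by (intro prod_zero) auto
    qed
    show "\<phi> n x \<le> indicator (cbox l u) x" for n x
    proof -
      have "\<phi> n x \<le> 1" unfolding \<phi>_def by (intro prod_le_1) (simp add: h01 mult_le_one)
      then show ?thesis using z[of x n] box_subset_cbox[of l u] by (cases "x \<in> cbox l u") force+
    qed
    show "test_function (\<phi> n)" for n
    proof (rule test_functionI)
      show "Ck k (\<phi> n)" for k
      proof -
        have "Ck k (\<lambda>x::real^'n. h n (x $ i - l $ i))" "Ck k (\<lambda>x::real^'n. h n (u $ i - x $ i))" for i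
          using Ck_exp_flat[of k 1 "real (Suc n)" i "- real (Suc n) * l $ i"]
            Ck_exp_flat[of k 1 "- real (Suc n)" i "real (Suc n) * u $ i"] by (simp_all add: h_def algebra_simps)
        then show ?thesis unfolding \<phi>_def by (intro Ck_prod Ck_mult)
      qed
      show "x \<in> cbox l u" if "\<phi> n x \<noteq> 0" for x using that z[of x n] box_subset_cbox[of l u] by auto
    qed simp
    show "(\<lambda>n. \<phi> n x) \<longlonglongrightarrow> indicator (box l u) x" for x
    proof (cases "x \<in> box l u")
      case True
      have "(\<lambda>n. \<phi> n x) \<longlonglongrightarrow> (\<Prod>i\<in>UNIV. (if x $ i - l $ i > 0 then 1 else 0) * (if u $ i - x $ i > 0 then 1 else 0))"
        unfolding \<phi>_def by (intro tendsto_prod tendsto_mult hlim)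
      then show ?thesis using True by (simp add: mem_box_cart)
    qed (simp add: z)
  qed
qed

section \<open>The fundamental lemma of the calculus of variations\<close>

text \<open>Borel counterpart of \<open>locally_integrable\<close>: compositions with shifts stay
  jointly measurable, as Fubini's theorem requires. Balls about 0 exhaust all bounded sets.\<close>

definition borel_loc_int :: "(real^'n \<Rightarrow> 'b::euclidean_space) \<Rightarrow> bool" where
  "borel_loc_int f \<longleftrightarrow> f \<in> borel_measurable borel \<and> (\<forall>R. set_integrable lborel (cball 0 R) f)"

lemma borel_loc_int_measurable: "borel_loc_int f \<Longrightarrow> f \<in> borel_measurable borel"
  by (simp add: borel_loc_int_def)

lemma borel_loc_int_bounded:
  assumes "borel_loc_int f" "bounded S" "S \<in> sets borel" shows "set_integrable lborel S f"
proof -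
  obtain R where "S \<subseteq> cball 0 R" using bounded_subset_ballD[OF assms(2), of 0] ball_subset_cball by blast
  then show ?thesis using assms by (auto simp: borel_loc_int_def intro: set_integrable_subset)
qed

lemma borel_loc_int_mult_bounded:
  fixes f :: "real^'n \<Rightarrow> real"
  assumes f: "borel_loc_int f" and [measurable]: "\<phi> \<in> borel_measurable borel"
    and B: "\<And>x. \<bar>\<phi> x\<bar> \<le> B" and R: "\<And>x. norm x > R \<Longrightarrow> \<phi> x = 0"
  shows "integrable lborel (\<lambda>x. f x * \<phi> x)"
proof -
  have [measurable]: "f \<in> borel_measurable borel" using f by (rule borel_loc_int_measurable)
  have "integrable lborel (\<lambda>x. B * (indicator (cball 0 R) x *\<^sub>R f x))"
    using f by (simp add: borel_loc_int_def set_integrable_def)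
  then show ?thesis
  proof (rule Bochner_Integration.integrable_bound)
    show "AE x in lborel. norm (f x * \<phi> x) \<le> norm (B * (indicator (cball 0 R) x *\<^sub>R f x))"
    proof (rule AE_I2)
      fix x
      have "\<bar>f x\<bar> * \<bar>\<phi> x\<bar> \<le> \<bar>f x\<bar> * \<bar>B\<bar>" using B[of x] by (intro mult_left_mono) auto
      then show "norm (f x * \<phi> x) \<le> norm (B * (indicator (cball 0 R) x *\<^sub>R f x))"
        using R[of x] by (cases "norm x \<le> R") (auto simp: abs_mult mult.commute)
    qed
  qed simp
qed

lemma borel_loc_int_test_function:
  fixes f :: "real^'n \<Rightarrow> real"
  assumes "borel_loc_int f" "test_function \<phi>"
  shows "integrable lborel (\<lambda>x. f x * \<phi> x)"
proof -
  obtain B where "\<And>x. \<bar>\<phi> x\<bar> \<le> B" using test_function_bounded[OF assms(2)] by metis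
  moreover obtain R where "\<And>x. norm x \<ge> R \<Longrightarrow> \<phi> x = 0" using test_function_support[OF assms(2)] by metis
  ultimately show ?thesis using assms test_functionD(4) by (intro borel_loc_int_mult_bounded[of f \<phi> B R]) auto
qed

text \<open>Approximating boxes by bumps makes all integrals of u over boxes vanish, so the measures
  with densities u+ and u- agree on boxes, which generate the Borel sets. Hence u+ = u- almost
  everywhere.\<close>

lemma fundamental_lemma:
  fixes u :: "real^'n \<Rightarrow> real"
  assumes u: "borel_loc_int u" and 0: "\<And>\<phi>. test_function \<phi> \<Longrightarrow> (LINT x|lborel. u x * \<phi> x) = 0"
  shows "AE x in lborel. u x = 0"
proof -
  have [measurable]: "u \<in> borel_measurable borel" using u by (rule borel_loc_int_measurable)
  have int: "integrable lborel (\<lambda>x. u x * indicator S x)" if "bounded S" "S \<in> sets borel" for S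
    using borel_loc_int_bounded[OF u that] by (simp add: set_integrable_def mult.commute)
  have box0: "(LINT x|lborel. u x * indicator (box l v) x) = 0" for l v
  proof -
    obtain \<phi> where \<phi>: "\<And>n. test_function (\<phi> n)" "\<And>n x. 0 \<le> \<phi> n x" "\<And>n x. \<phi> n x \<le> indicator (cbox l v) x"
      "\<And>x. (\<lambda>n. \<phi> n x) \<longlonglongrightarrow> indicator (box l v) x" using box_bump[of l v] by blast
    have [measurable]: "\<phi> n \<in> borel_measurable borel" for n using \<phi>(1) by (rule test_functionD(4))
    have "(\<lambda>n. LINT x|lborel. u x * \<phi> n x) \<longlonglongrightarrow> (LINT x|lborel. u x * indicator (box l v) x)"
    proof (rule integral_dominated_convergence[where w="\<lambda>x. \<bar>u x * indicator (cbox l v) x\<bar>"])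
      show "AE x in lborel. (\<lambda>n. u x * \<phi> n x) \<longlonglongrightarrow> u x * indicator (box l v) x"
        by (intro AE_I2 tendsto_mult tendsto_const \<phi>(4))
      show "AE x in lborel. norm (u x * \<phi> n x) \<le> \<bar>u x * indicator (cbox l v) x\<bar>" for n
        using \<phi>(2,3) by (intro AE_I2) (simp add: abs_mult mult_left_mono)
      show "integrable lborel (\<lambda>x. \<bar>u x * indicator (cbox l v) x\<bar>)"
        by (intro integrable_abs int) auto
    qed auto
    then show ?thesis using 0[OF \<phi>(1)] by (simp add: LIMSEQ_const_iff)
  qed
  \<comment> \<open>\<open>ennreal\<close> cuts negative values off at 0, so the two integrands are
    the positive and the negative part of u.\<close>
  have pm: "(\<integral>\<^sup>+x\<in>box l v. ennreal (u x) \<partial>lborel) = (\<integral>\<^sup>+x\<in>box l v. ennreal (- u x) \<partial>lborel) \<and>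
    (\<integral>\<^sup>+x\<in>box l v. ennreal (u x) \<partial>lborel) \<noteq> \<infinity>" for l v
  proof -
    let ?w = "\<lambda>x. u x * indicator (box l v) x"
    have i: "integrable lborel ?w" by (rule int) auto
    have p: "(\<integral>\<^sup>+x\<in>box l v. ennreal (u x) \<partial>lborel) = (\<integral>\<^sup>+x. ennreal (?w x) \<partial>lborel)"
      and m: "(\<integral>\<^sup>+x\<in>box l v. ennreal (- u x) \<partial>lborel) = (\<integral>\<^sup>+x. ennreal (- ?w x) \<partial>lborel)"
      by (auto intro!: nn_integral_cong split: split_indicator)
    have f: "(\<integral>\<^sup>+x. ennreal (?w x) \<partial>lborel) \<noteq> \<infinity>" "(\<integral>\<^sup>+x. ennreal (- ?w x) \<partial>lborel) \<noteq> \<infinity>"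
      using i unfolding real_integrable_def by auto
    have "enn2real (\<integral>\<^sup>+x. ennreal (?w x) \<partial>lborel) = enn2real (\<integral>\<^sup>+x. ennreal (- ?w x) \<partial>lborel)"
      using box0[of l v] real_lebesgue_integral_def[OF i] by simp
    then show ?thesis unfolding p m using f
      by (auto simp: less_top[symmetric] dest: arg_cong[of _ _ ennreal])
  qed
  have "density lborel (\<lambda>x. ennreal (u x)) = density lborel (\<lambda>x. ennreal (- u x))"
  proof (rule measure_eqI_generator_eq)
    let ?E = "range (\<lambda>(a, b). box a b::(real^'n) set)"
    show "Int_stable ?E" by (auto simp: Int_stable_def box_Int_box)
    show "?E \<subseteq> Pow UNIV" "sets (density lborel (\<lambda>x. ennreal (u x))) = sigma_sets UNIV ?E"
      "sets (density lborel (\<lambda>x. ennreal (- u x))) = sigma_sets UNIV ?E"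
      by (simp_all add: borel_eq_box)
    let ?A = "\<lambda>n::nat. box (- (real n *\<^sub>R One)) (real n *\<^sub>R One) :: (real^'n) set"
    show "range ?A \<subseteq> ?E" "(\<Union>i. ?A i) = UNIV" unfolding UN_box_eq_UNIV by auto
    show "emeasure (density lborel (\<lambda>x. ennreal (u x))) (?A i) \<noteq> \<infinity>" for i
      using conjunct2[OF pm, of "- (real i *\<^sub>R One)" "real i *\<^sub>R One"] by (simp add: emeasure_density)
    show "emeasure (density lborel (\<lambda>x. ennreal (u x))) X = emeasure (density lborel (\<lambda>x. ennreal (- u x))) X" if "X \<in> ?E" for X
      using pm that by (auto simp: emeasure_density)
  qed
  then have "AE x in lborel. ennreal (u x) = ennreal (- u x)"
    by (intro sigma_finite_measure.density_unique[OF sigma_finite_lborel]) auto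
  then show ?thesis
  proof eventually_elim
    case (elim x) then show ?case
      by (cases "u x" "0::real" rule: linorder_cases) (auto simp: ennreal_neg)
  qed
qed

section \<open>Weak gradients and difference representation\<close>

lemma pred_mem_cball [measurable (raw)]:
  fixes f c :: "'a \<Rightarrow> 'b::{second_countable_topology, metric_space}"
  assumes [measurable]: "f \<in> borel_measurable M" "c \<in> borel_measurable M" "r \<in> borel_measurable M"
  shows "Measurable.pred M (\<lambda>x. f x \<in> cball (c x) (r x))"
  unfolding mem_cball by measurable

lemma pred_mem_ball [measurable (raw)]:
  fixes f c :: "'a \<Rightarrow> 'b::{second_countable_topology, metric_space}"
  assumes [measurable]: "f \<in> borel_measurable M" "c \<in> borel_measurable M" "r \<in> borel_measurable M"
  shows "Measurable.pred M (\<lambda>x. f x \<in> ball (c x) (r x))"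
  unfolding mem_ball by measurable

lemma lborel_integral_translate:
  fixes F :: "'a::euclidean_space \<Rightarrow> 'b::{banach, second_countable_topology}"
  assumes [measurable]: "F \<in> borel_measurable borel"
  shows "(LINT x|lborel. F (x + c)) = (LINT x|lborel. F x)"
  by (subst (2) lborel_distr_plus[of c, symmetric], subst integral_distr) (auto simp: add.commute)

lemma lborel_nn_integral_translate:
  fixes F :: "'a::euclidean_space \<Rightarrow> ennreal"
  assumes [measurable]: "F \<in> borel_measurable borel"
  shows "(\<integral>\<^sup>+x. F (x + c) \<partial>lborel) = (\<integral>\<^sup>+x. F x \<partial>lborel)"
  by (subst (2) lborel_distr_plus[of c, symmetric], subst nn_integral_distr) (auto simp: add.commute)

lemma borel_loc_int_nn:
  assumes "borel_loc_int f" "bounded S" "S \<in> sets borel"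
  shows "(\<integral>\<^sup>+x\<in>S. norm (f x) \<partial>lborel) < \<infinity>"
proof -
  have "integrable lborel (\<lambda>x. indicator S x *\<^sub>R f x)"
    using borel_loc_int_bounded[OF assms] by (simp add: set_integrable_def)
  then have "(\<integral>\<^sup>+x. norm (indicator S x *\<^sub>R f x) \<partial>lborel) < \<infinity>" by (simp add: integrable_iff_bounded)
  also have "(\<integral>\<^sup>+x. norm (indicator S x *\<^sub>R f x) \<partial>lborel) = (\<integral>\<^sup>+x\<in>S. norm (f x) \<partial>lborel)"
    by (intro nn_integral_cong) (auto split: split_indicator)
  finally show ?thesis .
qed

lemma borel_loc_intI:
  assumes [measurable]: "f \<in> borel_measurable borel" and "\<And>R. (\<integral>\<^sup>+x\<in>cball 0 R. norm (f x) \<partial>lborel) < \<infinity>"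
  shows "borel_loc_int f"
  unfolding borel_loc_int_def set_integrable_def
proof (intro conjI allI integrableI_bounded)
  fix R
  have "(\<integral>\<^sup>+x. norm (indicator (cball 0 R) x *\<^sub>R f x) \<partial>lborel) = (\<integral>\<^sup>+x\<in>cball 0 R. norm (f x) \<partial>lborel)"
    by (intro nn_integral_cong) (auto split: split_indicator)
  then show "(\<integral>\<^sup>+x. norm (indicator (cball 0 R) x *\<^sub>R f x) \<partial>lborel) < \<infinity>" using assms(2) by simp
qed measurable

text \<open>Common justification of later uses of Fubini's theorem: at fixed y the shift by
  \<open>L y\<close> is undone by translation invariance, and what remains is an integral of |h|
  over the ball of radius R + \<open>\<rho>\<close>. The shift will be t u along a segment, u in a
  ball average, or 0.\<close>

lemma integrable_shift_pair:
  fixes h :: "real^'n \<Rightarrow> real" and \<psi> :: "real^'n \<Rightarrow> 'c::euclidean_space \<Rightarrow> real" and L :: "'c \<Rightarrow> real^'n"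
  assumes h: "borel_loc_int h" and [measurable]: "(\<lambda>(a, y). \<psi> a y) \<in> borel_measurable (borel \<Otimes>\<^sub>M borel)"
    "L \<in> borel_measurable borel" "S \<in> sets borel"
    and S: "emeasure lborel S < \<infinity>" and L: "\<And>y. y \<in> S \<Longrightarrow> norm (L y) \<le> \<rho>"
    and B: "\<And>a y. \<bar>\<psi> a y\<bar> \<le> B" and 0: "\<And>a y. norm a > R \<or> y \<notin> S \<Longrightarrow> \<psi> a y = 0"
  shows "integrable (lborel \<Otimes>\<^sub>M lborel) (\<lambda>(a, y). h (a + L y) * \<psi> a y)"
proof (rule integrableI_bounded)
  have [measurable]: "h \<in> borel_measurable borel" using h by (rule borel_loc_int_measurable)
  show "(\<lambda>(a, y). h (a + L y) * \<psi> a y) \<in> borel_measurable (lborel \<Otimes>\<^sub>M lborel)" by measurable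
  have B0: "0 \<le> B" using B[of undefined undefined] by linarith
  have "(\<integral>\<^sup>+z. norm (case z of (a, y) \<Rightarrow> h (a + L y) * \<psi> a y) \<partial>(lborel \<Otimes>\<^sub>M lborel))
      = (\<integral>\<^sup>+y. \<integral>\<^sup>+a. norm (h (a + L y) * \<psi> a y) \<partial>lborel \<partial>lborel)"
    by (subst lborel_pair.nn_integral_snd[symmetric]) (auto simp: case_prod_beta)
  also have "\<dots> \<le> (\<integral>\<^sup>+y. \<integral>\<^sup>+a. ennreal B * indicator S y * (ennreal (norm (h (a + L y))) * indicator (cball 0 (R + \<rho>)) (a + L y)) \<partial>lborel \<partial>lborel)"
  proof (intro nn_integral_mono)
    fix y a
    show "ennreal (norm (h (a + L y) * \<psi> a y)) \<le> ennreal B * indicator S y * (ennreal (norm (h (a + L y))) * indicator (cball 0 (R + \<rho>)) (a + L y))"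
    proof (cases "\<psi> a y = 0")
      case False
      then have y: "y \<in> S" "norm a \<le> R" using 0[of a y] by force+
      then have "norm (a + L y) \<le> R + \<rho>" using L by (meson norm_triangle_le add_mono)
      moreover have "\<bar>h (a + L y)\<bar> * \<bar>\<psi> a y\<bar> \<le> B * \<bar>h (a + L y)\<bar>"
        using mult_right_mono[OF B[of a y] abs_ge_zero[of "h (a + L y)"]] by (simp add: mult.commute)
      ultimately show ?thesis using y B0 by (simp add: abs_mult ennreal_mult[symmetric])
    qed simp
  qed
  also have "\<dots> = (\<integral>\<^sup>+y. ennreal B * indicator S y * (\<integral>\<^sup>+a. ennreal (norm (h (a + L y))) * indicator (cball 0 (R + \<rho>)) (a + L y) \<partial>lborel) \<partial>lborel)"
    by (intro nn_integral_cong nn_integral_cmult) measurable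
  also have "\<dots> = (\<integral>\<^sup>+y. ennreal B * indicator S y * (\<integral>\<^sup>+a\<in>cball 0 (R + \<rho>). norm (h a) \<partial>lborel) \<partial>lborel)"
    by (subst lborel_nn_integral_translate[where F="\<lambda>x. ennreal (norm (h x)) * indicator (cball 0 (R + \<rho>)) x"]) auto
  also have "\<dots> = ennreal B * emeasure lborel S * (\<integral>\<^sup>+a\<in>cball 0 (R + \<rho>). norm (h a) \<partial>lborel)"
    by (simp add: nn_integral_multc nn_integral_cmult)
  also have "\<dots> < \<infinity>" using borel_loc_int_nn[OF h, of "cball 0 (R + \<rho>)"] S by (simp add: ennreal_mult_less_top)
  finally show "(\<integral>\<^sup>+z. norm (case z of (a, y) \<Rightarrow> h (a + L y) * \<psi> a y) \<partial>(lborel \<Otimes>\<^sub>M lborel)) < \<infinity>" .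
qed

lemma integrable_segment_pair:
  fixes h :: "real^'n \<Rightarrow> real" and \<psi> :: "real^'n \<Rightarrow> real \<Rightarrow> real"
  assumes h: "borel_loc_int h" and \<psi>: "(\<lambda>(a, t). \<psi> a t) \<in> borel_measurable (borel \<Otimes>\<^sub>M borel)"
    and B: "\<And>a t. \<bar>\<psi> a t\<bar> \<le> B" and 0: "\<And>a t. norm a > R \<or> t \<notin> {0..1} \<Longrightarrow> \<psi> a t = 0"
  shows "integrable (lborel \<Otimes>\<^sub>M lborel) (\<lambda>(a, t). h (a + t *\<^sub>R u) * \<psi> a t)"
  by (rule integrable_shift_pair[OF h \<psi>, where S="{0..1}" and \<rho>="norm u" and B=B and R=R])
    (use B 0 in \<open>auto simp: mult_left_le_one_le\<close>)

text \<open>Borel version of \<open>has_weak_gradient\<close>; the two are linked through almost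
  everywhere equal representatives in \<open>weak_gradient_borel_iff\<close>.\<close>

definition borel_weak_gradient :: "(real^'n \<Rightarrow> real) \<Rightarrow> (real^'n \<Rightarrow> real^'n) \<Rightarrow> bool" where
  "borel_weak_gradient f g \<longleftrightarrow> borel_loc_int f \<and> borel_loc_int g \<and>
     (\<forall>\<phi> i. test_function \<phi> \<longrightarrow> (LINT x|lborel. f x * partial_deriv i \<phi> x) = - (LINT x|lborel. g x $ i * \<phi> x))"

lemma borel_loc_int_bounded_linear:
  assumes "borel_loc_int g" "bounded_linear L"
  shows "borel_loc_int (\<lambda>x. L (g x))"
proof -
  have "(\<lambda>x. indicator S x *\<^sub>R L (g x)) = (\<lambda>x. L (indicator S x *\<^sub>R g x))" for S
    using assms(2) by (simp add: linear_simps(5))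
  then show ?thesis using assms unfolding borel_loc_int_def set_integrable_def
    by (auto intro: integrable_bounded_linear borel_measurable_continuous_on linear_continuous_on)
qed

lemma borel_weak_gradient_directional:
  assumes w: "borel_weak_gradient f g" and \<phi>: "test_function \<phi>"
  shows "(LINT x|lborel. f x * frechet_derivative \<phi> (at x) u) = - (LINT x|lborel. (g x \<bullet> u) * \<phi> x)"
proof -
  have f: "borel_loc_int f" and g: "borel_loc_int g" using w by (auto simp: borel_weak_gradient_def)
  have gi: "borel_loc_int (\<lambda>x. g x $ i)" for i
    by (rule borel_loc_int_bounded_linear[OF g bounded_linear_vec_nth])
  have "(LINT x|lborel. f x * frechet_derivative \<phi> (at x) u) = (LINT x|lborel. (\<Sum>i\<in>UNIV. u $ i * (f x * partial_deriv i \<phi> x)))"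
    by (simp add: frechet_derivative_partial[OF \<phi>] sum_distrib_left mult_ac)
  also have "\<dots> = (\<Sum>i\<in>UNIV. u $ i * (LINT x|lborel. f x * partial_deriv i \<phi> x))"
    by (subst Bochner_Integration.integral_sum)
      (auto intro!: borel_loc_int_test_function f test_function_partial \<phi>)
  also have "\<dots> = (\<Sum>i\<in>UNIV. u $ i * (- (LINT x|lborel. g x $ i * \<phi> x)))"
    using w \<phi> by (simp add: borel_weak_gradient_def)
  also have "\<dots> = - (LINT x|lborel. (\<Sum>i\<in>UNIV. u $ i * (g x $ i * \<phi> x)))"
    by (subst Bochner_Integration.integral_sum)
      (auto intro!: borel_loc_int_test_function gi \<phi> simp: sum_negf)
  also have "\<dots> = - (LINT x|lborel. (g x \<bullet> u) * \<phi> x)"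
    by (simp add: inner_vec_def sum_distrib_right sum_distrib_left mult_ac)
  finally show ?thesis .
qed

text \<open>The minus in a - t u matches the translate that lands on the test function once the
  shift a + t u is moved off the gradient.\<close>

lemma test_function_FTC:
  assumes \<phi>: "test_function \<phi>"
  shows "(LINT t|lborel. frechet_derivative \<phi> (at (a - t *\<^sub>R u)) u * indicator {0..1} t) = \<phi> a - \<phi> (a - u)"
proof -
  have "(LINT t|lborel. frechet_derivative \<phi> (at (a - t *\<^sub>R u)) u * indicator {0..1} t)
     = - \<phi> (a - 1 *\<^sub>R u) - (- \<phi> (a - 0 *\<^sub>R u))"
  proof (rule integral_FTC_Icc_real)
    fix t :: real
    have l: "linear (frechet_derivative \<phi> (at (a - t *\<^sub>R u)))" using test_functionD(5)[OF \<phi>] by (rule has_derivative_linear)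
    have "((\<lambda>t. \<phi> (a - t *\<^sub>R u)) has_derivative (\<lambda>h. frechet_derivative \<phi> (at (a - t *\<^sub>R u)) (- h *\<^sub>R u))) (at t)"
      by (rule has_derivative_compose[where f="\<lambda>t. a - t *\<^sub>R u" and f'="\<lambda>h. - h *\<^sub>R u"])
        (auto intro!: derivative_eq_intros test_functionD(5)[OF \<phi>])
    then have "((\<lambda>t. - \<phi> (a - t *\<^sub>R u)) has_derivative (\<lambda>h. h * frechet_derivative \<phi> (at (a - t *\<^sub>R u)) u)) (at t)"
      by (auto dest: has_derivative_minus simp: linear_cmul[OF l] linear_neg[OF l])
    then show "DERIV (\<lambda>t. - \<phi> (a - t *\<^sub>R u)) t :> frechet_derivative \<phi> (at (a - t *\<^sub>R u)) u"
      by (simp add: has_field_derivative_def mult_commute_abs)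
    have "continuous_on UNIV (\<lambda>t. frechet_derivative \<phi> (at (a - t *\<^sub>R u)) u)"
      by (intro continuous_on_compose2[OF test_functionD(2)[OF test_function_directional[OF \<phi>, of u]]] continuous_intros) auto
    then show "isCont (\<lambda>t. frechet_derivative \<phi> (at (a - t *\<^sub>R u)) u) t"
      by (simp add: continuous_on_eq_continuous_at)
  qed simp
  then show ?thesis by simp
qed

text \<open>Both sides are tested against \<open>\<phi>\<close>: shifts are moved to
  \<open>\<phi>\<close>, the weak gradient becomes a directional derivative of
  \<open>\<phi>\<close>, and the fundamental theorem of calculus is applied to \<open>\<phi>\<close>
  alone. The exceptional null set depends on u.\<close>

lemma borel_weak_gradient_segment:
  assumes w: "borel_weak_gradient f g"
  shows "AE a in lborel. f (a + u) - f a = (LINT t|lborel. indicator {0..1} t * (g (a + t *\<^sub>R u) \<bullet> u))"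
proof -
  have f: "borel_loc_int f" and g: "borel_loc_int g" using w by (auto simp: borel_weak_gradient_def)
  define h where "h = (\<lambda>x. g x \<bullet> u)"
  have h: "borel_loc_int h" unfolding h_def by (rule borel_loc_int_bounded_linear[OF g bounded_linear_inner_left])
  have [measurable]: "f \<in> borel_measurable borel" "h \<in> borel_measurable borel"
    using f h by (auto intro: borel_loc_int_measurable)
  \<comment> \<open>W is the right-hand side as a function of a. The pairing facts
    \<open>intW\<close> are used twice: with indicators of balls for its local integrability, and
    with test functions for the identity.\<close>
  define W where "W = (\<lambda>a. LINT t|lborel. h (a + t *\<^sub>R u) * indicator {0..1} t)"
  have [measurable]: "W \<in> borel_measurable borel" unfolding W_def by measurable
  have intW: "integrable lborel (\<lambda>a. W a * \<phi> a)" "(LINT a|lborel. W a * \<phi> a) =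
     (LINT t|lborel. (LINT a|lborel. h (a + t *\<^sub>R u) * \<phi> a) * indicator {0..1} t)"
    if [measurable]: "\<phi> \<in> borel_measurable borel" and B: "\<And>x. \<bar>\<phi> x\<bar> \<le> B" and R: "\<And>x. norm x > R \<Longrightarrow> \<phi> x = 0" for \<phi> and B R :: real
  proof -
    have i: "integrable (lborel \<Otimes>\<^sub>M lborel) (\<lambda>(a, t). h (a + t *\<^sub>R u) * (\<phi> a * indicator {0..1} t))"
      by (rule integrable_segment_pair[OF h, where B=B and R=R])
       (use B in \<open>auto simp: R split: split_indicator intro: order_trans[OF abs_ge_zero]\<close>)
    have eq: "(LINT t|lborel. h (a + t *\<^sub>R u) * (\<phi> a * indicator {0..1} t)) = W a * \<phi> a" for a
      unfolding W_def by (subst integral_mult_left_zero[symmetric]) (simp add: mult_ac)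
    show "integrable lborel (\<lambda>a. W a * \<phi> a)" using lborel_pair.integrable_fst[OF i] by (simp add: eq)
    show "(LINT a|lborel. W a * \<phi> a) = (LINT t|lborel. (LINT a|lborel. h (a + t *\<^sub>R u) * \<phi> a) * indicator {0..1} t)"
    proof -
      have "(LINT a|lborel. W a * \<phi> a) = (LINT t|lborel. LINT a|lborel. h (a + t *\<^sub>R u) * (\<phi> a * indicator {0..1} t))"
        using lborel_pair.Fubini_integral[OF i] by (simp only: eq)
      also have "\<dots> = (LINT t|lborel. (LINT a|lborel. h (a + t *\<^sub>R u) * \<phi> a) * indicator {0..1} t)"
        by (simp add: mult.assoc[symmetric])
      finally show ?thesis .
    qed
  qed
  have W: "borel_loc_int W"
    unfolding borel_loc_int_def set_integrable_def
  proof (intro conjI allI)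
    show "integrable lborel (\<lambda>x. indicator (cball 0 R) x *\<^sub>R W x)" for R
      using intW(1)[of "indicator (cball 0 R)" 1 R] by (simp add: mult.commute split: split_indicator)
  qed simp
  have f': "borel_loc_int (\<lambda>a. f (a + u))"
  proof (rule borel_loc_intI)
    fix R
    have "(\<integral>\<^sup>+x\<in>cball 0 R. norm (f (x + u)) \<partial>lborel) = (\<integral>\<^sup>+x. norm (f (x + u)) * indicator (cball u R) (x + u) \<partial>lborel)"
      by (intro nn_integral_cong) (auto simp: dist_norm split: split_indicator)
    also have "\<dots> = (\<integral>\<^sup>+x\<in>cball u R. norm (f x) \<partial>lborel)"
      by (subst lborel_nn_integral_translate[where F="\<lambda>x. ennreal (norm (f x)) * indicator (cball u R) x", symmetric]) (auto intro!: nn_integral_cong split: split_indicator)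
    also have "\<dots> < \<infinity>" by (rule borel_loc_int_nn[OF f]) auto
    finally show "(\<integral>\<^sup>+x\<in>cball 0 R. norm (f (x + u)) \<partial>lborel) < \<infinity>" .
  qed simp
  have "AE a in lborel. f (a + u) - f a - W a = 0"
  proof (rule fundamental_lemma)
    show "borel_loc_int (\<lambda>a. f (a + u) - f a - W a)"
      using f f' W by (auto simp: borel_loc_int_def set_integrable_def right_diff_distrib)
    fix \<phi> :: "real^'a \<Rightarrow> real" assume \<phi>: "test_function \<phi>"
    have [measurable]: "\<phi> \<in> borel_measurable borel" by (rule test_functionD(4)[OF \<phi>])
    let ?D = "\<lambda>x. frechet_derivative \<phi> (at x) u"
    have D: "test_function ?D" by (rule test_function_directional[OF \<phi>])
    have [measurable]: "?D \<in> borel_measurable borel" by (rule test_functionD(4)[OF D])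
    obtain B where B: "\<And>x. \<bar>\<phi> x\<bar> \<le> B" using test_function_bounded[OF \<phi>] by metis
    obtain R where R: "\<And>x. norm x \<ge> R \<Longrightarrow> \<phi> x = 0" using test_function_support[OF \<phi>] by metis
    obtain B' where B': "\<And>x. \<bar>?D x\<bar> \<le> B'" using test_function_bounded[OF D] by metis
    obtain R' where R': "\<And>x. norm x \<ge> R' \<Longrightarrow> ?D x = 0" using test_function_support[OF D] by metis
    have \<phi>t: "test_function (\<lambda>x. \<phi> (x - v))" for v using test_function_translate[OF \<phi>, of "- v"] by simp
    have Dt: "frechet_derivative (\<lambda>x. \<phi> (x - v)) (at x) u = ?D (x - v)" for x v
      using frechet_derivative_partial[OF \<phi>t] frechet_derivative_partial[OF \<phi>]
        partial_deriv_translate[OF test_functionD(3)[OF \<phi>], of _ "- v"] by simp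
    have sh: "(LINT a|lborel. h (a + t *\<^sub>R u) * \<phi> a) = - (LINT a|lborel. f a * ?D (a - t *\<^sub>R u))" for t
    proof -
      have "(LINT a|lborel. h (a + t *\<^sub>R u) * \<phi> a) = (LINT a|lborel. h a * \<phi> (a - t *\<^sub>R u))"
        by (subst lborel_integral_translate[where F="\<lambda>a. h a * \<phi> (a - t *\<^sub>R u)" and c="t *\<^sub>R u", symmetric]) simp_all
      also have "\<dots> = - (LINT a|lborel. f a * ?D (a - t *\<^sub>R u))"
        using borel_weak_gradient_directional[OF w \<phi>t[of "t *\<^sub>R u"], of u] by (simp add: Dt h_def)
      finally show ?thesis .
    qed
    \<comment> \<open>Shift 0: only the test function moves along the segment, which enlarges its
      support by at most \<open>norm u\<close>.\<close>
    have i: "integrable (lborel \<Otimes>\<^sub>M lborel) (\<lambda>(a, t). f (a + t *\<^sub>R 0) * (?D (a - t *\<^sub>R u) * indicator {0..1} t))"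
    proof (rule integrable_segment_pair[OF f, where B=B' and R="R' + norm u"])
      show "\<bar>?D (a - t *\<^sub>R u) * indicator {0..1} t\<bar> \<le> B'" for a t
        using B'[of "a - t *\<^sub>R u"] by (auto split: split_indicator intro: order_trans[OF abs_ge_zero])
      show "?D (a - t *\<^sub>R u) * indicator {0..1} t = 0" if "R' + norm u < norm a \<or> t \<notin> {0..1}" for a t
      proof (cases "t \<in> {0..1}")
        case True
        then have "norm (t *\<^sub>R u) \<le> norm u" by (simp add: mult_left_le_one_le)
        then have "norm (a - t *\<^sub>R u) \<ge> R'" using that True norm_triangle_ineq2[of a "t *\<^sub>R u"] by auto
        then show ?thesis by (simp add: R')
      qed simp
    qed simp
    have "(LINT a|lborel. W a * \<phi> a) = (LINT t|lborel. (LINT a|lborel. h (a + t *\<^sub>R u) * \<phi> a) * indicator {0..1} t)"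
      by (rule intW(2)[OF _ B, where ?R=R]) (auto simp: R)
    also have "\<dots> = - (LINT t|lborel. (LINT a|lborel. f a * (?D (a - t *\<^sub>R u) * indicator {0..1} t)))"
      by (simp add: sh mult.assoc[symmetric])
    also have "\<dots> = - (LINT a|lborel. (LINT t|lborel. f a * (?D (a - t *\<^sub>R u) * indicator {0..1} t)))"
      using lborel_pair.Fubini_integral[OF i] by simp
    also have "\<dots> = - (LINT a|lborel. f a * (\<phi> a - \<phi> (a - u)))"
      by (simp add: test_function_FTC[OF \<phi>])
    also have "\<dots> = (LINT a|lborel. f a * \<phi> (a - u)) - (LINT a|lborel. f a * \<phi> a)"
      using borel_loc_int_test_function[OF f \<phi>] borel_loc_int_test_function[OF f \<phi>t] by (simp add: right_diff_distrib)
    also have "(LINT a|lborel. f a * \<phi> (a - u)) = (LINT a|lborel. f (a + u) * \<phi> a)"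
      by (subst lborel_integral_translate[where F="\<lambda>a. f a * \<phi> (a - u)" and c=u, symmetric]) simp_all
    finally show "(LINT a|lborel. (f (a + u) - f a - W a) * \<phi> a) = 0"
      using borel_loc_int_test_function[OF f \<phi>] borel_loc_int_test_function[OF f' \<phi>] borel_loc_int_test_function[OF W \<phi>]
      by (simp add: left_diff_distrib)
  qed
  then show ?thesis by eventually_elim (simp add: W_def h_def mult.commute)
qed

section \<open>Continuity of translations in mean\<close>

lemma ennreal_tendsto_0I:
  fixes f :: "nat \<Rightarrow> ennreal"
  assumes "\<And>e::real. e > 0 \<Longrightarrow> eventually (\<lambda>n. f n \<le> ennreal e) sequentially"
  shows "f \<longlonglongrightarrow> 0"
proof (rule order_tendstoI)
  fix a :: ennreal assume "0 < a"
  then obtain b where b: "0 < b" "b < a" using dense by blast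
  then obtain e where e: "b = ennreal e" by (cases b) auto
  with b have "e > 0" by simp
  from assms[OF this] show "eventually (\<lambda>n. f n < a) sequentially"
    by eventually_elim (use b e in \<open>metis order.strict_trans1\<close>)
qed simp

text \<open>Density argument along the construction of integrable functions: indicators, sums,
  limits. For an open set the translated indicator converges pointwise on the set itself, and outer
  regularity passes from open to measurable sets.\<close>

lemma L1_translation_sequentially:
  fixes g :: "'a::euclidean_space \<Rightarrow> 'b::{banach, second_countable_topology}"
  assumes "integrable lborel g" "X \<longlonglongrightarrow> 0"
  shows "(\<lambda>n. \<integral>\<^sup>+a. norm (g (a + X n) - g a) \<partial>lborel) \<longlonglongrightarrow> 0"
proof -
  define P where "P g \<longleftrightarrow> (\<lambda>n. \<integral>\<^sup>+a. norm (g (a + X n) - g a) \<partial>lborel) \<longlonglongrightarrow> 0" for g :: "'a \<Rightarrow> 'b"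
  \<comment> \<open>The property is stable under L1 approximation: the error of g' is paid at a and
    at the shifted point, and translation invariance makes both payments equal.\<close>
  have approx: "P g" if [measurable]: "g \<in> borel_measurable borel"
    and ap: "\<And>e::real. e > 0 \<Longrightarrow> \<exists>g'. g' \<in> borel_measurable borel \<and> P g' \<and> (\<integral>\<^sup>+a. norm (g a - g' a) \<partial>lborel) \<le> e" for g
    unfolding P_def
  proof (rule ennreal_tendsto_0I)
    fix e :: real assume "e > 0"
    then obtain g' where [measurable]: "g' \<in> borel_measurable borel" and g': "P g'" "(\<integral>\<^sup>+a. norm (g a - g' a) \<partial>lborel) \<le> e / 3"
      using ap[of "e / 3"] by auto
    have "ennreal (e / 3) > 0" using \<open>e > 0\<close> by simp
    with g'(1) have "eventually (\<lambda>n. (\<integral>\<^sup>+a. norm (g' (a + X n) - g' a) \<partial>lborel) < ennreal (e / 3)) sequentially"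
      unfolding P_def by (rule order_tendstoD(2))
    then show "eventually (\<lambda>n. (\<integral>\<^sup>+a. norm (g (a + X n) - g a) \<partial>lborel) \<le> ennreal e) sequentially"
    proof eventually_elim
      case (elim n)
      have "(\<integral>\<^sup>+a. norm (g (a + X n) - g a) \<partial>lborel) \<le> (\<integral>\<^sup>+a. ennreal (norm (g (a + X n) - g' (a + X n))) +
           (ennreal (norm (g' (a + X n) - g' a)) + ennreal (norm (g a - g' a))) \<partial>lborel)"
      proof (rule nn_integral_mono)
        fix a
        have "norm (g (a + X n) - g a) \<le> norm (g (a + X n) - g' (a + X n)) + (norm (g' (a + X n) - g' a) + norm (g a - g' a))"
        proof -
          have "g (a + X n) - g a = (g (a + X n) - g' (a + X n)) + ((g' (a + X n) - g' a) + (g' a - g a))" by simp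
          then show ?thesis
            by (metis norm_triangle_mono norm_minus_commute order_refl)
        qed
        then show "ennreal (norm (g (a + X n) - g a)) \<le> ennreal (norm (g (a + X n) - g' (a + X n))) +
           (ennreal (norm (g' (a + X n) - g' a)) + ennreal (norm (g a - g' a)))"
          by (simp flip: ennreal_plus)
      qed
      also have "\<dots> = (\<integral>\<^sup>+a. norm (g (a + X n) - g' (a + X n)) \<partial>lborel) +
          ((\<integral>\<^sup>+a. norm (g' (a + X n) - g' a) \<partial>lborel) + (\<integral>\<^sup>+a. norm (g a - g' a) \<partial>lborel))"
        by (simp add: nn_integral_add)
      also have "(\<integral>\<^sup>+a. norm (g (a + X n) - g' (a + X n)) \<partial>lborel) = (\<integral>\<^sup>+a. norm (g a - g' a) \<partial>lborel)"
        by (rule lborel_nn_integral_translate[where F="\<lambda>a. ennreal (norm (g a - g' a))"]) simp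
      also have "(\<integral>\<^sup>+a. norm (g a - g' a) \<partial>lborel) +
          ((\<integral>\<^sup>+a. norm (g' (a + X n) - g' a) \<partial>lborel) + (\<integral>\<^sup>+a. norm (g a - g' a) \<partial>lborel)) \<le> ennreal (e / 3) + (ennreal (e / 3) + ennreal (e / 3))"
        using g'(2) elim by (intro add_mono) auto
      also have "\<dots> = ennreal e" using \<open>e > 0\<close> by (simp flip: ennreal_plus)
      finally show ?case .
    qed
  qed
  have opn: "P (\<lambda>x. indicator U x *\<^sub>R c)" if U: "open U" "emeasure lborel U < \<infinity>" for U c
  proof -
    have [measurable]: "U \<in> sets borel" using U by simp
    \<comment> \<open>Only points of U are examined: openness keeps x + Y i in U eventually, and the
      indicator of U dominates. Points that leave U and points that enter it are exchanged by the
      shift - X n.\<close>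
    have half: "(\<lambda>n. \<integral>\<^sup>+a. norm (indicator U a - indicator U a * indicator U (a + Y n) :: real) \<partial>lborel) \<longlonglongrightarrow> 0"
      if Y: "Y \<longlonglongrightarrow> 0" for Y
    proof (rule nn_integral_dominated_convergence_norm[where w="indicator U"])
      show "(\<integral>\<^sup>+x. ennreal (indicator U x) \<partial>lborel) < \<infinity>" using U by (simp add: ennreal_indicator)
      show "AE x in lborel. norm (indicator U x * indicator U (x + Y j) :: real) \<le> indicator U x" for j
        by (auto simp: indicator_def)
      show "AE x in lborel. (\<lambda>i. indicator U x * indicator U (x + Y i)) \<longlonglongrightarrow> (indicator U x :: real)"
      proof (rule AE_I2)
        fix x
        show "(\<lambda>i. indicator U x * indicator U (x + Y i)) \<longlonglongrightarrow> (indicator U x :: real)"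
        proof (cases "x \<in> U")
          case True
          have "(\<lambda>i. x + Y i) \<longlonglongrightarrow> x" using tendsto_add[OF tendsto_const Y, of x] by simp
          then have "eventually (\<lambda>i. x + Y i \<in> U) sequentially" using U(1) True by (rule topological_tendstoD)
          then show ?thesis by (intro tendsto_eventually) (auto simp: True elim: eventually_mono)
        qed simp
      qed
    qed measurable
    have "(\<lambda>n. ennreal (norm c) * ((\<integral>\<^sup>+a. norm (indicator U a - indicator U a * indicator U (a + X n) :: real) \<partial>lborel) +
        (\<integral>\<^sup>+a. norm (indicator U a - indicator U a * indicator U (a + - X n) :: real) \<partial>lborel))) \<longlonglongrightarrow> ennreal (norm c) * (0 + 0)"
      using tendsto_minus[OF assms(2)] by (intro ennreal_tendsto_cmult tendsto_add half assms(2)) simp_all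
    moreover have "(\<integral>\<^sup>+a. norm (indicator U (a + X n) *\<^sub>R c - indicator U a *\<^sub>R c) \<partial>lborel) =
       ennreal (norm c) * ((\<integral>\<^sup>+a. norm (indicator U a - indicator U a * indicator U (a + X n) :: real) \<partial>lborel) +
        (\<integral>\<^sup>+a. norm (indicator U a - indicator U a * indicator U (a + - X n) :: real) \<partial>lborel))" for n
    proof -
      have "(\<integral>\<^sup>+a. norm (indicator U a - indicator U a * indicator U (a + - X n) :: real) \<partial>lborel)
        = (\<integral>\<^sup>+a. norm (indicator U (a + X n) - indicator U (a + X n) * indicator U (a + X n + - X n) :: real) \<partial>lborel)"
        by (rule lborel_nn_integral_translate[symmetric, where F="\<lambda>a. norm (indicator U a - indicator U a * indicator U (a + - X n) :: real)"]) measurable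
      then have "ennreal (norm c) * ((\<integral>\<^sup>+a. norm (indicator U a - indicator U a * indicator U (a + X n) :: real) \<partial>lborel) +
        (\<integral>\<^sup>+a. norm (indicator U a - indicator U a * indicator U (a + - X n) :: real) \<partial>lborel)) =
        ennreal (norm c) * (\<integral>\<^sup>+a. ennreal (norm (indicator U a - indicator U a * indicator U (a + X n) :: real)) +
          ennreal (norm (indicator U (a + X n) - indicator U (a + X n) * indicator U a :: real)) \<partial>lborel)"
        by (subst nn_integral_add) auto
      also have "\<dots> = (\<integral>\<^sup>+a. ennreal (norm c) * (ennreal (norm (indicator U a - indicator U a * indicator U (a + X n) :: real)) +
          ennreal (norm (indicator U (a + X n) - indicator U (a + X n) * indicator U a :: real))) \<partial>lborel)"
        by (subst nn_integral_cmult) auto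
      also have "\<dots> = (\<integral>\<^sup>+a. norm (indicator U (a + X n) *\<^sub>R c - indicator U a *\<^sub>R c) \<partial>lborel)"
        by (intro nn_integral_cong) (auto split: split_indicator)
      finally show ?thesis ..
    qed
    ultimately show ?thesis unfolding P_def by simp
  qed
  have "P g" using assms(1)
  proof (induction rule: integrable_induct)
    case (base A c)
    then have A[measurable]: "A \<in> sets borel" by simp
    have "\<exists>g'. g' \<in> borel_measurable borel \<and> P g' \<and> (\<integral>\<^sup>+a. norm (indicator A a *\<^sub>R c - g' a) \<partial>lborel) \<le> e"
      if "e > 0" for e :: real
    proof -
      \<comment> \<open>The 1 in the denominator covers c = 0.\<close>
      define e' where "e' = e / (norm c + 1)"
      have e': "e' > 0" "norm c * e' \<le> e" using \<open>e > 0\<close> add_pos_nonneg[of 1 "norm c"]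
        by (auto simp: e'_def divide_le_eq add.commute[of _ 1] mult.commute[of e])
      obtain U where U: "open U" "A \<subseteq> U" "emeasure lborel (U - A) < ennreal e'" using outer_regular_lborel[OF A e'(1)] .
      have [measurable]: "U \<in> sets borel" using U by simp
      have "emeasure lborel U \<le> emeasure lborel A + emeasure lborel (U - A)"
        using U(2) emeasure_subadditive[of A lborel "U - A"] by (simp add: Un_absorb1)
      also have "\<dots> < \<infinity>" using base(2) U(3) by (simp add: less_top) (metis ennreal_less_top order.strict_trans)
      finally have "P (\<lambda>x. indicator U x *\<^sub>R c)" by (rule opn[OF U(1)])
      moreover have "(\<integral>\<^sup>+a. norm (indicator A a *\<^sub>R c - indicator U a *\<^sub>R c) \<partial>lborel) = (\<integral>\<^sup>+a. norm c * indicator (U - A) a \<partial>lborel)"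
        using U(2) by (intro nn_integral_cong) (auto split: split_indicator)
      moreover have "(\<integral>\<^sup>+a. norm c * indicator (U - A) a \<partial>lborel) = norm c * emeasure lborel (U - A)"
        by (subst nn_integral_cmult_indicator[symmetric]) (auto simp: ennreal_mult ennreal_indicator intro!: nn_integral_cong)
      moreover have "norm c * emeasure lborel (U - A) \<le> norm c * ennreal e'" using U(3) by (intro mult_left_mono) auto
      moreover have "\<dots> \<le> ennreal e" using e' by (simp add: ennreal_leI flip: ennreal_mult)
      ultimately show ?thesis
        by (intro exI[of _ "\<lambda>x. indicator U x *\<^sub>R c"]) auto
    qed
    then show ?case by (intro approx) measurable
  next
    case (add f g)
    then have [measurable]: "f \<in> borel_measurable borel" "g \<in> borel_measurable borel" by auto
    have "(\<lambda>n. (\<integral>\<^sup>+a. norm (f (a + X n) - f a) \<partial>lborel) + (\<integral>\<^sup>+a. norm (g (a + X n) - g a) \<partial>lborel)) \<longlonglongrightarrow> 0 + 0"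
      using add by (intro tendsto_add) (auto simp: P_def)
    then have "(\<lambda>n. (\<integral>\<^sup>+a. norm (f (a + X n) - f a) \<partial>lborel) + (\<integral>\<^sup>+a. norm (g (a + X n) - g a) \<partial>lborel)) \<longlonglongrightarrow> 0" by simp
    note lim0 = this
    have le: "(\<integral>\<^sup>+a. norm (f (a + X n) + g (a + X n) - (f a + g a)) \<partial>lborel) \<le> (\<integral>\<^sup>+a. norm (f (a + X n) - f a) \<partial>lborel) + (\<integral>\<^sup>+a. norm (g (a + X n) - g a) \<partial>lborel)" for n
    proof -
      have "(\<integral>\<^sup>+a. norm (f (a + X n) + g (a + X n) - (f a + g a)) \<partial>lborel) \<le> (\<integral>\<^sup>+a. ennreal (norm (f (a + X n) - f a)) + ennreal (norm (g (a + X n) - g a)) \<partial>lborel)"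
        by (intro nn_integral_mono) (simp flip: ennreal_plus add: norm_diff_triangle_ineq)
      then show ?thesis by (simp add: nn_integral_add)
    qed
    show ?case unfolding P_def
      by (rule tendsto_sandwich[OF _ _ tendsto_const lim0]) (auto intro!: always_eventually le)
  next
    case (lim f s)
    have [measurable]: "f \<in> borel_measurable borel" "\<And>i. s i \<in> borel_measurable borel" using lim by auto
    have "\<exists>g'. g' \<in> borel_measurable borel \<and> P g' \<and> (\<integral>\<^sup>+a. norm (f a - g' a) \<partial>lborel) \<le> e"
      if "e > 0" for e :: real
    proof -
      have "(\<lambda>i. \<integral>\<^sup>+x. norm (f x - s i x) \<partial>lborel) \<longlonglongrightarrow> 0"
      proof (rule nn_integral_dominated_convergence_norm[where w="\<lambda>x. 2 * norm (f x)"])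
        show "(\<integral>\<^sup>+x. ennreal (2 * norm (f x)) \<partial>lborel) < \<infinity>"
          using lim(4) by (simp add: ennreal_mult nn_integral_cmult ennreal_mult_less_top integrable_iff_bounded)
      qed (use lim in auto)
      then have "eventually (\<lambda>i. (\<integral>\<^sup>+x. norm (f x - s i x) \<partial>lborel) < ennreal e) sequentially"
        using \<open>e > 0\<close> by (intro order_tendstoD) auto
      then obtain i where "(\<integral>\<^sup>+x. norm (f x - s i x) \<partial>lborel) < ennreal e" by (auto simp: eventually_sequentially)
      then show ?thesis
        using lim by (intro exI[of _ "s i"]) auto
    qed
    then show ?case by (intro approx) measurable
  qed
  then show ?thesis by (simp add: P_def)
qed

lemma L1_translation:
  fixes g :: "'a::euclidean_space \<Rightarrow> 'b::{banach, second_countable_topology}"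
  assumes "integrable lborel g" and e: "e > 0"
  obtains d where "d > 0" "\<And>u. norm u < d \<Longrightarrow> (\<integral>\<^sup>+a. norm (g (a + u) - g a) \<partial>lborel) < ennreal e"
proof -
  let ?w = "\<lambda>u. \<integral>\<^sup>+a. norm (g (a + u) - g a) \<partial>lborel"
  have "(?w \<longlongrightarrow> 0) (at 0)"
    unfolding tendsto_at_iff_sequentially using L1_translation_sequentially[OF assms(1)] by (auto simp: o_def)
  then have "eventually (\<lambda>u. ?w u < ennreal e) (at 0)" using e by (intro order_tendstoD) auto
  then obtain d where "d > 0" "\<And>u. u \<noteq> 0 \<Longrightarrow> dist u 0 < d \<Longrightarrow> ?w u < ennreal e" by (auto simp: eventually_at)
  moreover have "?w 0 < ennreal e" using e by simp
  ultimately show thesis by (intro that[of d]) (metis dist_0_norm dist_commute)+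
qed

section \<open>Weak limits of bounded sequences in Lp\<close>

lemma powr_midpoint_le:
  fixes a b p :: real
  assumes "1 \<le> p"
  shows "\<bar>(a + b) / 2\<bar> powr p \<le> (\<bar>a\<bar> powr p + \<bar>b\<bar> powr p) / 2"
proof (cases "a = 0 \<or> b = 0")
  case False
  have "\<bar>(a + b) / 2\<bar> powr p \<le> ((1 - 1/2) *\<^sub>R \<bar>a\<bar> + (1/2) *\<^sub>R \<bar>b\<bar>) powr p"
    using assms by (intro powr_mono2) auto
  also have "\<dots> \<le> (1 - 1/2) * \<bar>a\<bar> powr p + (1/2) * \<bar>b\<bar> powr p"
    by (rule convex_onD[OF powr_convex[OF assms]]) (use False in auto)
  finally show ?thesis by simp
next
  case True
  have *: "(\<bar>c\<bar> / 2) powr p \<le> \<bar>c\<bar> powr p / 2" for c :: real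
  proof -
    have "(2::real) powr 1 \<le> 2 powr p" using assms by (intro powr_mono) auto
    then have "\<bar>c\<bar> powr p / 2 powr p \<le> \<bar>c\<bar> powr p / 2" by (intro divide_left_mono) auto
    then show ?thesis by (simp add: powr_divide)
  qed
  show ?thesis using True *[of a] *[of b] by auto
qed

text \<open>Quantitative strict convexity of \<open>t \<mapsto> sqrt (1 + t\<^sup>2)\<close>: two points whose midpoint gains little
  are close, up to the size of the points. The free parameter \<open>l\<close> replaces Hoelder's inequality.\<close>

lemma sqrt_gap_ineq:
  fixes a b l :: real
  assumes "l > 0"
  defines "s \<equiv> \<lambda>t::real. sqrt (1 + t\<^sup>2)"
  shows "sqrt \<bar>a - b\<bar> \<le> (s a + s b - 2 * s ((a + b) / 2)) / l ^ 3 + l * (s a + s b)"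
proof -
  \<comment> \<open>Here s a is the length of the vector (1, a), and m that of (1, a) + (1, b); so
    \<open>gap\<close> is the deficit in the triangle inequality.\<close>
  define m where "m = 2 * s ((a + b) / 2)"
  define T where "T = s a + s b"
  define gap where "gap = T - m"
  have pos: "s a \<ge> 1" "s b \<ge> 1" "m \<ge> 2" by (simp_all add: s_def m_def)
  have sq: "(s a)\<^sup>2 = 1 + a\<^sup>2" "(s b)\<^sup>2 = 1 + b\<^sup>2" by (simp_all add: s_def)
  have m2: "m\<^sup>2 = 4 + (a + b)\<^sup>2" by (simp add: m_def s_def power_mult_distrib real_sqrt_pow2 add_nonneg_nonneg power_divide)
  \<comment> \<open>Lagrange's identity for the vectors (1, a) and (1, b).\<close>
  have prod: "(s a * s b)\<^sup>2 - (1 + a * b)\<^sup>2 = (a - b)\<^sup>2"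
    unfolding power_mult_distrib sq by (simp add: algebra_simps power2_eq_square)
  have Tm: "T\<^sup>2 - m\<^sup>2 = 2 * (s a * s b - (1 + a * b))"
    unfolding T_def m2 power2_sum sq by (simp add: algebra_simps power2_eq_square)
  have "1 + a * b \<le> s a * s b"
  proof (rule power2_le_imp_le)
    show "(1 + a * b)\<^sup>2 \<le> (s a * s b)\<^sup>2" using prod by (smt (verit) zero_le_power2)
    show "0 \<le> s a * s b" using pos by simp
  qed
  then have "m\<^sup>2 \<le> T\<^sup>2" using Tm by (simp add: algebra_simps)
  then have g: "m \<le> T" using pos by (intro power2_le_imp_le[of m T]) (auto simp: T_def)
  have "(a - b)\<^sup>2 = (s a * s b - (1 + a * b)) * (s a * s b + (1 + a * b))"
    unfolding prod[symmetric] by (simp add: algebra_simps power2_eq_square)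
  also have "\<dots> \<le> (s a * s b - (1 + a * b)) * (2 * (s a * s b))"
    using \<open>1 + a * b \<le> s a * s b\<close> by (intro mult_left_mono) auto
  also have "\<dots> = (T\<^sup>2 - m\<^sup>2) * (s a * s b)" unfolding Tm by (simp only: ac_simps)
  also have "\<dots> = gap * (T + m) * (s a * s b)" by (simp add: gap_def algebra_simps power2_eq_square)
  also have "\<dots> \<le> gap * (T + T) * (T\<^sup>2 / 4)"
  proof (intro mult_mono)
    have "0 \<le> (s a - s b)\<^sup>2" by simp
    then show "s a * s b \<le> T\<^sup>2 / 4" by (simp add: T_def power2_eq_square algebra_simps)
  qed (use g pos in \<open>auto simp: gap_def T_def\<close>)
  also have "gap * (T + T) * (T\<^sup>2 / 4) = gap * T ^ 3 / 2" by (simp add: power2_eq_square power3_eq_cube)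
  also have "\<dots> \<le> gap * T ^ 3" using mult_nonneg_nonneg[of gap "T ^ 3"] g pos by (simp add: gap_def T_def)
  finally have main: "(a - b)\<^sup>2 \<le> gap * T ^ 3" .
  have T: "T > 0" and gap0: "gap \<ge> 0" using pos g by (auto simp: T_def gap_def)
  \<comment> \<open>By \<open>main\<close>, sqrt |a - b| is at most gap^(1/4) T^(3/4); splitting at
    gap = l^4 T bounds this geometric mean by one of the two summands.\<close>
  have "sqrt \<bar>a - b\<bar> \<le> gap / l ^ 3 + l * T"
  proof (cases "gap \<le> l ^ 4 * T")
    case True
    have "gap * T ^ 3 \<le> (l ^ 4 * T) * T ^ 3" by (intro mult_right_mono True) (use T in auto)
    with main have "(a - b)\<^sup>2 \<le> (l ^ 4 * T) * T ^ 3" by (rule order_trans)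
    also have "\<dots> = ((l * T)\<^sup>2)\<^sup>2" by (simp add: power_mult_distrib power2_eq_square power3_eq_cube power4_eq_xxxx)
    finally have "\<bar>a - b\<bar> \<le> \<bar>(l * T)\<^sup>2\<bar>" by (rule abs_le_square_iff[THEN iffD2])
    then have "sqrt \<bar>a - b\<bar> \<le> l * T" using assms T by (intro real_le_lsqrt) auto
    then show ?thesis using gap0 assms by (smt (verit) divide_nonneg_pos zero_less_power)
  next
    case False
    then have "T \<le> gap / l ^ 4" using assms by (simp add: field_simps)
    then have "T ^ 3 \<le> (gap / l ^ 4) ^ 3" using T by (intro power_mono) auto
    then have "gap * T ^ 3 \<le> gap * (gap / l ^ 4) ^ 3" by (intro mult_left_mono gap0)
    with main have "(a - b)\<^sup>2 \<le> gap * (gap / l ^ 4) ^ 3" by (rule order_trans)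
    also have "\<dots> = ((gap / l ^ 3)\<^sup>2)\<^sup>2" using assms by (simp add: field_simps power2_eq_square power3_eq_cube power4_eq_xxxx)
    finally have "\<bar>a - b\<bar> \<le> \<bar>(gap / l ^ 3)\<^sup>2\<bar>" by (rule abs_le_square_iff[THEN iffD2])
    then have "sqrt \<bar>a - b\<bar> \<le> gap / l ^ 3" using assms gap0 by (intro real_le_lsqrt) auto
    then show ?thesis using assms T by (smt (verit) mult_pos_pos)
  qed
  then show ?thesis by (simp add: gap_def T_def m_def)
qed

lemma abs_le_1_plus_powr: "1 \<le> p \<Longrightarrow> \<bar>t\<bar> \<le> 1 + \<bar>t\<bar> powr p" for t p :: real
proof (cases "\<bar>t\<bar> \<le> 1")
  case False
  assume "1 \<le> p"
  with False have "\<bar>t\<bar> powr 1 \<le> \<bar>t\<bar> powr p" by (intro powr_mono) auto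
  then show ?thesis using False by simp
qed (simp add: add_increasing2)

text \<open>On the set of finite measure where \<open>\<phi>\<close> is nonzero, |h| <= 1 + |h|^p
  takes the role of Hoelder's inequality.\<close>

lemma integrable_Lp_times_bounded:
  fixes h \<phi> :: "'a \<Rightarrow> real"
  assumes [measurable]: "h \<in> borel_measurable M" "\<phi> \<in> borel_measurable M" and p: "1 \<le> p"
    and h: "(\<integral>\<^sup>+x. \<bar>h x\<bar> powr p \<partial>M) \<le> ennreal C" and B: "\<And>x. \<bar>\<phi> x\<bar> \<le> B"
    and S: "emeasure M {x\<in>space M. \<phi> x \<noteq> 0} < \<infinity>"
  shows "integrable M (\<lambda>x. h x * \<phi> x)"
proof (rule integrableI_bounded)
  have B0: "0 \<le> B" using B[of undefined] by linarith
  have "(\<integral>\<^sup>+x. norm (h x * \<phi> x) \<partial>M) \<le> (\<integral>\<^sup>+x. ennreal B * (indicator {x\<in>space M. \<phi> x \<noteq> 0} x + ennreal (\<bar>h x\<bar> powr p)) \<partial>M)"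
  proof (rule nn_integral_mono)
    fix x assume x: "x \<in> space M"
    show "ennreal (norm (h x * \<phi> x)) \<le> ennreal B * (indicator {x\<in>space M. \<phi> x \<noteq> 0} x + ennreal (\<bar>h x\<bar> powr p))"
    proof (cases "\<phi> x = 0")
      case False
      have "\<bar>h x\<bar> * \<bar>\<phi> x\<bar> \<le> (1 + \<bar>h x\<bar> powr p) * B"
        using abs_le_1_plus_powr[OF p, of "h x"] B[of x] by (intro mult_mono) auto
      then have "ennreal (norm (h x * \<phi> x)) \<le> ennreal (B * (1 + \<bar>h x\<bar> powr p))"
        by (intro ennreal_leI) (simp add: abs_mult mult.commute)
      also have "\<dots> = ennreal B * (1 + ennreal (\<bar>h x\<bar> powr p))" using B0 by (simp add: ennreal_mult ennreal_plus)
      finally show ?thesis using x False by simp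
    qed simp
  qed
  also have "\<dots> = ennreal B * (emeasure M {x\<in>space M. \<phi> x \<noteq> 0} + (\<integral>\<^sup>+x. \<bar>h x\<bar> powr p \<partial>M))"
    by (simp add: nn_integral_cmult nn_integral_add)
  also have "\<dots> < \<infinity>" using S order.strict_trans1[OF h] by (simp add: ennreal_mult_less_top)
  finally show "(\<integral>\<^sup>+x. norm (h x * \<phi> x) \<partial>M) < \<infinity>" .
qed simp

definition clamp_abs :: "real \<Rightarrow> real \<Rightarrow> real" where "clamp_abs R t = max (- R) (min R t)"

lemma clamp_abs_measurable [measurable]: "clamp_abs R \<in> borel_measurable borel"
  unfolding clamp_abs_def by measurable

text \<open>For p > 1 the factor R^(1-p) tends to 0 as R grows, so the integrated error is small
  uniformly over families bounded in L^p: this is their uniform integrability.\<close>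

lemma clamp_abs_diff_le:
  assumes "R > 0" "p \<ge> 1"
  shows "\<bar>t - clamp_abs R t\<bar> \<le> R powr (1 - p) * \<bar>t\<bar> powr p"
proof (cases "\<bar>t\<bar> \<le> R")
  case True
  then show ?thesis by (auto simp: clamp_abs_def)
next
  case False
  have "\<bar>t - clamp_abs R t\<bar> \<le> \<bar>t\<bar>" using False assms by (auto simp: clamp_abs_def)
  also have "\<dots> = \<bar>t\<bar> powr (1 - p) * \<bar>t\<bar> powr p" using False assms by (simp flip: powr_add)
  also have "\<dots> \<le> R powr (1 - p) * \<bar>t\<bar> powr p" using False assms by (intro mult_right_mono powr_mono2') auto
  finally show ?thesis .
qed

text \<open>Clamping at a large height R changes each pairing by less than e / 3, for the whole
  sequence and for its limit; the clamped functions converge by dominated convergence on the support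
  of \<open>\<phi>\<close>.\<close>

lemma Lp_bounded_AE_convergence:
  fixes b :: "nat \<Rightarrow> 'a \<Rightarrow> real"
  assumes [measurable]: "\<And>n. b n \<in> borel_measurable M" "g \<in> borel_measurable M" "\<phi> \<in> borel_measurable M" and p: "1 < p"
    and C: "C \<ge> 0" "\<And>n. (\<integral>\<^sup>+x. \<bar>b n x\<bar> powr p \<partial>M) \<le> ennreal C" "(\<integral>\<^sup>+x. \<bar>g x\<bar> powr p \<partial>M) \<le> ennreal C"
    and ae: "AE x in M. (\<lambda>n. b n x) \<longlonglongrightarrow> g x" and B: "\<And>x. \<bar>\<phi> x\<bar> \<le> B"
    and S: "emeasure M {x\<in>space M. \<phi> x \<noteq> 0} < \<infinity>"
  shows "(\<lambda>n. LINT x|M. b n x * \<phi> x) \<longlonglongrightarrow> (LINT x|M. g x * \<phi> x)"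
proof (rule LIMSEQ_I)
  fix e :: real assume "e > 0"
  have B0: "0 \<le> B" using B[of undefined] by linarith
  have "((\<lambda>R. B * (R powr (1 - p) * C)) \<longlongrightarrow> B * (0 * C)) at_top"
    using p by (intro tendsto_mult tendsto_const tendsto_neg_powr filterlim_ident) auto
  then have "eventually (\<lambda>R. B * (R powr (1 - p) * C) < e / 3) at_top" using \<open>e > 0\<close> by (intro order_tendstoD) auto
  then have "eventually (\<lambda>R. B * (R powr (1 - p) * C) < e / 3 \<and> R > 0) at_top"
    using eventually_gt_at_top[of "0::real"] by eventually_elim simp
  then have "\<exists>R. B * (R powr (1 - p) * C) < e / 3 \<and> R > 0" by (rule eventually_happens'[rotated]) simp
  then obtain R where R: "R > 0" "B * (R powr (1 - p) * C) < e / 3" by blast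
  have cl: "integrable M (\<lambda>x. clamp_abs R (h x) * \<phi> x) \<and> \<bar>(LINT x|M. h x * \<phi> x) - (LINT x|M. clamp_abs R (h x) * \<phi> x)\<bar> < e / 3"
    if [measurable]: "h \<in> borel_measurable M" and h: "(\<integral>\<^sup>+x. \<bar>h x\<bar> powr p \<partial>M) \<le> ennreal C" for h
  proof -
    have i: "integrable M (\<lambda>x. h x * \<phi> x)" by (rule integrable_Lp_times_bounded[OF _ _ _ h B S]) (use p in auto)
    have "(\<integral>\<^sup>+x. \<bar>clamp_abs R (h x)\<bar> powr p \<partial>M) \<le> (\<integral>\<^sup>+x. \<bar>h x\<bar> powr p \<partial>M)"
      using p R by (intro nn_integral_mono ennreal_leI powr_mono2) (auto simp: clamp_abs_def)
    then have c: "integrable M (\<lambda>x. clamp_abs R (h x) * \<phi> x)"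
      using order_trans[OF _ h] p by (intro integrable_Lp_times_bounded[where p=p and C=C, OF _ _ _ _ B S]) auto
    have hi: "integrable M (\<lambda>x. \<bar>h x\<bar> powr p)"
      using h by (intro integrableI_bounded) (auto simp: order.strict_trans1[OF h])
    have "(LINT x|M. \<bar>h x\<bar> powr p) \<le> C"
      using h C(1) nn_integral_eq_integral[OF hi] by (simp add: ennreal_le_iff)
    have "\<bar>(LINT x|M. h x * \<phi> x) - (LINT x|M. clamp_abs R (h x) * \<phi> x)\<bar> = \<bar>LINT x|M. (h x - clamp_abs R (h x)) * \<phi> x\<bar>"
      using i c by (simp add: left_diff_distrib)
    also have "\<dots> \<le> (LINT x|M. \<bar>(h x - clamp_abs R (h x)) * \<phi> x\<bar>)" by (rule integral_abs_bound)
    also have "\<dots> \<le> (LINT x|M. B * (R powr (1 - p) * \<bar>h x\<bar> powr p))"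
    proof (rule integral_mono)
      show "integrable M (\<lambda>x. \<bar>(h x - clamp_abs R (h x)) * \<phi> x\<bar>)" using i c by (simp add: left_diff_distrib)
      show "\<bar>(h x - clamp_abs R (h x)) * \<phi> x\<bar> \<le> B * (R powr (1 - p) * \<bar>h x\<bar> powr p)" for x
        unfolding abs_mult mult.commute[of B] using B[of x] clamp_abs_diff_le[OF R(1), of p "h x"] p
        by (intro mult_mono) auto
    qed (use hi in auto)
    also have "\<dots> \<le> B * (R powr (1 - p) * C)" using \<open>(LINT x|M. \<bar>h x\<bar> powr p) \<le> C\<close> B0 by (simp add: mult_left_mono)
    also have "\<dots> < e / 3" by (rule R)
    finally show ?thesis using c by simp
  qed
  have "(\<lambda>n. LINT x|M. clamp_abs R (b n x) * \<phi> x) \<longlonglongrightarrow> (LINT x|M. clamp_abs R (g x) * \<phi> x)"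
  proof (rule integral_dominated_convergence[where w="\<lambda>x. R * B * indicator {x\<in>space M. \<phi> x \<noteq> 0} x"])
    show "AE x in M. (\<lambda>n. clamp_abs R (b n x) * \<phi> x) \<longlonglongrightarrow> clamp_abs R (g x) * \<phi> x"
      using ae unfolding clamp_abs_def by eventually_elim (auto intro!: tendsto_intros)
    show "AE x in M. norm (clamp_abs R (b n x) * \<phi> x) \<le> R * B * indicator {x\<in>space M. \<phi> x \<noteq> 0} x" for n
    proof (rule AE_I2)
      fix x assume "x \<in> space M"
      have "\<bar>clamp_abs R (b n x)\<bar> * \<bar>\<phi> x\<bar> \<le> R * B" using R B[of x] by (intro mult_mono) (auto simp: clamp_abs_def)
      then show "norm (clamp_abs R (b n x) * \<phi> x) \<le> R * B * indicator {x\<in>space M. \<phi> x \<noteq> 0} x"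
        using \<open>x \<in> space M\<close> by (cases "\<phi> x = 0") (auto simp: abs_mult)
    qed
  qed (use S in \<open>auto intro!: integrable_mult_right\<close>)
  from LIMSEQ_D[OF this, of "e / 3"] \<open>e > 0\<close> obtain N where N: "\<And>n. n \<ge> N \<Longrightarrow>
      \<bar>(LINT x|M. clamp_abs R (b n x) * \<phi> x) - (LINT x|M. clamp_abs R (g x) * \<phi> x)\<bar> < e / 3" by auto
  show "\<exists>N. \<forall>n\<ge>N. norm ((LINT x|M. b n x * \<phi> x) - (LINT x|M. g x * \<phi> x)) < e"
  proof (intro exI allI impI)
    fix n assume "n \<ge> N"
    then show "norm ((LINT x|M. b n x * \<phi> x) - (LINT x|M. g x * \<phi> x)) < e"
      using N[of n] cl[OF _ C(2), of n] cl[OF _ C(3)] by (simp add: abs_if split: if_splits)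
  qed
qed

text \<open>Instead of weak compactness: near-minimisers of the strictly convex functional \<open>J\<close> over the decreasing
  convex sets \<open>K n\<close>, which retain all bounds on the pairings valid from index \<open>n\<close> on, converge almost everywhere.\<close>

lemma Lp_weak_limit:
  fixes G :: "nat \<Rightarrow> 'a \<Rightarrow> real"
  assumes M: "sigma_finite_measure M" and p: "1 < p" and C: "C \<ge> 0"
    and G[measurable]: "\<And>n. G n \<in> borel_measurable M" and GC: "\<And>n. (\<integral>\<^sup>+x. \<bar>G n x\<bar> powr p \<partial>M) \<le> ennreal C"
  obtains g where "g \<in> borel_measurable M" "(\<integral>\<^sup>+x. \<bar>g x\<bar> powr p \<partial>M) \<le> ennreal C"
    "\<And>\<phi> l B. \<phi> \<in> borel_measurable M \<Longrightarrow> (\<And>x. \<bar>\<phi> x\<bar> \<le> B) \<Longrightarrow> emeasure M {x\<in>space M. \<phi> x \<noteq> 0} < \<infinity> \<Longrightarrow>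
       (\<lambda>n. LINT x|M. G n x * \<phi> x) \<longlonglongrightarrow> l \<Longrightarrow> (LINT x|M. g x * \<phi> x) = l"
proof -
  define test where "test \<phi> \<longleftrightarrow> \<phi> \<in> borel_measurable M \<and> (\<exists>B. \<forall>x. \<bar>\<phi> x\<bar> \<le> B) \<and> emeasure M {x\<in>space M. \<phi> x \<noteq> 0} < \<infinity>" for \<phi> :: "'a \<Rightarrow> real"
  \<comment> \<open>The constraints are two-sided bounds on pairings that hold for all later G m;
    they survive midpoints, which is the form of convexity that the argument uses.\<close>
  define K where "K n = {h \<in> borel_measurable M. (\<integral>\<^sup>+x. \<bar>h x\<bar> powr p \<partial>M) \<le> ennreal C \<and>
    (\<forall>\<phi> lo up. test \<phi> \<longrightarrow> (\<forall>m\<ge>n. lo \<le> (LINT x|M. G m x * \<phi> x) \<and> (LINT x|M. G m x * \<phi> x) \<le> up) \<longrightarrow>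
       lo \<le> (LINT x|M. h x * \<phi> x) \<and> (LINT x|M. h x * \<phi> x) \<le> up)}" for n
  have K_bounds: "lo \<le> (LINT x|M. h x * \<phi> x) \<and> (LINT x|M. h x * \<phi> x) \<le> up"
    if "h \<in> K n" "test \<phi>" "\<forall>m\<ge>n. lo \<le> (LINT x|M. G m x * \<phi> x) \<and> (LINT x|M. G m x * \<phi> x) \<le> up" for h n \<phi> lo up
    using that unfolding K_def by blast
  have GK: "G n \<in> K n" for n using GC by (auto simp: K_def)
  have K_mono: "K n \<subseteq> K m" if "m \<le> n" for m n
    unfolding K_def using that by (blast intro: order_trans)
  have K_mid: "(\<lambda>x. (a x + b x) / 2) \<in> K n" if a: "a \<in> K n" and b: "b \<in> K n" for a b n
    unfolding K_def mem_Collect_eq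
  proof (intro conjI allI impI)
    have [measurable]: "a \<in> borel_measurable M" "b \<in> borel_measurable M" using a b by (auto simp: K_def)
    have aC: "(\<integral>\<^sup>+x. \<bar>a x\<bar> powr p \<partial>M) \<le> ennreal C" and bC: "(\<integral>\<^sup>+x. \<bar>b x\<bar> powr p \<partial>M) \<le> ennreal C"
      using a b by (auto simp: K_def)
    show "(\<lambda>x. (a x + b x) / 2) \<in> borel_measurable M" by measurable
    have "(\<integral>\<^sup>+x. \<bar>(a x + b x) / 2\<bar> powr p \<partial>M) \<le> (\<integral>\<^sup>+x. ennreal (1/2) * (ennreal (\<bar>a x\<bar> powr p) + ennreal (\<bar>b x\<bar> powr p)) \<partial>M)"
    proof (rule nn_integral_mono)
      fix x
      have "ennreal (\<bar>(a x + b x) / 2\<bar> powr p) \<le> ennreal ((1/2) * (\<bar>a x\<bar> powr p + \<bar>b x\<bar> powr p))"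
        using powr_midpoint_le[of p "a x" "b x"] p by (intro ennreal_leI) simp
      also have "\<dots> = ennreal (1/2) * (ennreal (\<bar>a x\<bar> powr p) + ennreal (\<bar>b x\<bar> powr p))"
        by (subst ennreal_mult) (auto simp: ennreal_plus)
      finally show "ennreal (\<bar>(a x + b x) / 2\<bar> powr p) \<le> ennreal (1/2) * (ennreal (\<bar>a x\<bar> powr p) + ennreal (\<bar>b x\<bar> powr p))" .
    qed
    also have "\<dots> = ennreal (1/2) * ((\<integral>\<^sup>+x. \<bar>a x\<bar> powr p \<partial>M) + (\<integral>\<^sup>+x. \<bar>b x\<bar> powr p \<partial>M))"
      by (simp add: nn_integral_cmult nn_integral_add)
    also have "\<dots> \<le> ennreal (1/2) * (ennreal C + ennreal C)" using aC bC by (intro mult_left_mono add_mono) auto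
    also have "\<dots> = ennreal ((1/2) * (C + C))" using C by (simp only: ennreal_mult ennreal_plus)
    also have "\<dots> = ennreal C" by simp
    finally show "(\<integral>\<^sup>+x. \<bar>(a x + b x) / 2\<bar> powr p \<partial>M) \<le> ennreal C" .
    fix \<phi> lo up assume t: "test \<phi>" and lu: "\<forall>m\<ge>n. lo \<le> (LINT x|M. G m x * \<phi> x) \<and> (LINT x|M. G m x * \<phi> x) \<le> up"
    obtain B where B: "\<phi> \<in> borel_measurable M" "\<And>x. \<bar>\<phi> x\<bar> \<le> B" "emeasure M {x\<in>space M. \<phi> x \<noteq> 0} < \<infinity>" using t by (auto simp: test_def)
    have "integrable M (\<lambda>x. a x * \<phi> x)" "integrable M (\<lambda>x. b x * \<phi> x)"
      using p B by (auto intro!: integrable_Lp_times_bounded[OF _ _ _ aC] integrable_Lp_times_bounded[OF _ _ _ bC])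
    then have eq: "(LINT x|M. (a x + b x) / 2 * \<phi> x) = ((LINT x|M. a x * \<phi> x) + (LINT x|M. b x * \<phi> x)) / 2"
      by (simp add: distrib_right add_divide_distrib)
    have al: "lo \<le> (LINT x|M. a x * \<phi> x)" "(LINT x|M. a x * \<phi> x) \<le> up"
      and bl: "lo \<le> (LINT x|M. b x * \<phi> x)" "(LINT x|M. b x * \<phi> x) \<le> up"
      using K_bounds[OF a t lu] K_bounds[OF b t lu] by auto
    from al(1) bl(1) show "lo \<le> (LINT x|M. (a x + b x) / 2 * \<phi> x)" unfolding eq by simp
    from al(2) bl(2) show "(LINT x|M. (a x + b x) / 2 * \<phi> x) \<le> up" unfolding eq by simp
  qed
  obtain w0 where w0[measurable]: "w0 \<in> borel_measurable M" and w0i: "(\<integral>\<^sup>+x. w0 x \<partial>M) \<noteq> \<infinity>" and w0p: "\<And>x. x \<in> space M \<Longrightarrow> 0 < w0 x"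
    using sigma_finite_measure.Ex_finite_integrable_function[OF M] by auto
  \<comment> \<open>Capping at 1 gives a finite measure N below M, and positivity of w keeps the
    null sets of M.\<close>
  define w where "w x = min 1 (w0 x)" for x
  have [measurable]: "w \<in> borel_measurable M" unfolding w_def by measurable
  define N where "N = density M w"
  have [measurable_cong]: "sets N = sets M" by (simp add: N_def)
  have "(\<integral>\<^sup>+x. w x \<partial>M) \<le> (\<integral>\<^sup>+x. w0 x \<partial>M)" by (intro nn_integral_mono) (simp add: w_def)
  then have wi: "(\<integral>\<^sup>+x. w x \<partial>M) < \<infinity>" using w0i by (simp add: less_top order.strict_trans1)
  interpret N: finite_measure N
    by (rule finite_measureI) (use wi in \<open>simp add: N_def emeasure_density less_top[symmetric] cong: nn_integral_cong\<close>)
  have NM: "(\<integral>\<^sup>+x. h x \<partial>N) \<le> (\<integral>\<^sup>+x. h x \<partial>M)" if [measurable]: "h \<in> borel_measurable M" for h :: "'a \<Rightarrow> ennreal"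
  proof -
    have "w x * h x \<le> 1 * h x" for x by (intro mult_right_mono) (auto simp: w_def)
    then show ?thesis unfolding N_def by (subst nn_integral_density) (auto intro!: nn_integral_mono)
  qed
  define s :: "real \<Rightarrow> real" where "s t = sqrt (1 + t\<^sup>2)" for t
  have [measurable]: "s \<in> borel_measurable borel" unfolding s_def by measurable
  have s_bound: "0 \<le> s t" "s t \<le> 2 + \<bar>t\<bar> powr p" for t
  proof -
    have "s t \<le> 1 + \<bar>t\<bar>" unfolding s_def by (rule real_le_lsqrt) (auto simp: power2_eq_square algebra_simps)
    then show "s t \<le> 2 + \<bar>t\<bar> powr p" using abs_le_1_plus_powr[of p t] p by linarith
  qed (simp add: s_def)
  \<comment> \<open>Uniform bound for J on every K n, from sqrt(1 + t^2) <= 2 + |t|^p and N below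
    M.\<close>
  define D where "D = 2 * measure N (space N) + C"
  define J where "J h = (LINT x|N. s (h x))" for h
  have sN: "integrable N (\<lambda>x. s (h x)) \<and> J h \<le> D" if h: "h \<in> K n" for h n
  proof -
    have [measurable]: "h \<in> borel_measurable M" and hC: "(\<integral>\<^sup>+x. \<bar>h x\<bar> powr p \<partial>M) \<le> ennreal C" using h by (auto simp: K_def)
    have "(\<integral>\<^sup>+x. s (h x) \<partial>N) \<le> (\<integral>\<^sup>+x. 2 + ennreal (\<bar>h x\<bar> powr p) \<partial>N)"
      using s_bound(2) by (intro nn_integral_mono) (metis ennreal_leI ennreal_plus ennreal_numeral powr_ge_zero zero_le_numeral)
    also have "\<dots> = 2 * emeasure N (space N) + (\<integral>\<^sup>+x. \<bar>h x\<bar> powr p \<partial>N)" by (subst nn_integral_add) auto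
    also have "\<dots> \<le> 2 * emeasure N (space N) + ennreal C" by (intro add_left_mono order_trans[OF NM hC]) measurable
    also have "\<dots> = ennreal D" using C by (simp add: D_def N.emeasure_eq_measure ennreal_plus ennreal_mult)
    finally have le: "(\<integral>\<^sup>+x. s (h x) \<partial>N) \<le> ennreal D" .
    then have i: "integrable N (\<lambda>x. s (h x))" using s_bound(1) by (intro integrableI_bounded) (auto simp: order.strict_trans1)
    moreover have "0 \<le> D" using C by (simp add: D_def)
    ultimately show ?thesis using le nn_integral_eq_integral[OF i] s_bound(1) by (simp add: J_def)
  qed
  have J0: "0 \<le> J h" for h using s_bound(1) by (simp add: J_def)
  \<comment> \<open>The infima increase because the sets K n decrease, and D bounds them; their
    limit is the target value for J.\<close>
  define I where "I n = Inf (J ` K n)" for n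
  have bdd: "bdd_below (J ` K n)" for n by (intro bdd_belowI[of _ 0]) (auto simp: J0)
  have I_le: "I n \<le> J h" if "h \<in> K n" for h n unfolding I_def using bdd that by (intro cInf_lower) auto
  have "incseq I"
    unfolding incseq_def I_def
  proof (intro allI impI cInf_superset_mono bdd image_mono K_mono)
    show "J ` K n \<noteq> {}" for n using GK[of n] by auto
  qed
  moreover have "I n \<le> D" for n using I_le[OF GK] sN[OF GK] by (meson order_trans)
  ultimately obtain Iinf where Iinf: "I \<longlonglongrightarrow> Iinf" "\<And>n. I n \<le> Iinf" using incseq_convergent[of I D] by blast
  \<comment> \<open>The tolerance is the fourth power of l = (1/2)^k in \<open>step\<close>: a gap
    of order l^4, divided by l^3, still leaves the summable l.\<close>
  have "\<exists>h n. n \<ge> k \<and> h \<in> K n \<and> J h < Iinf + (1/16) ^ k \<and> Iinf - (1/16) ^ k < I n" for k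
  proof -
    have "eventually (\<lambda>n. Iinf - (1/16) ^ k < I n) sequentially" using Iinf(1) by (rule order_tendstoD) simp
    then obtain n1 where n1: "\<And>n. n \<ge> n1 \<Longrightarrow> Iinf - (1/16) ^ k < I n" by (auto simp: eventually_sequentially)
    define n where "n = max k n1"
    have n: "n \<ge> k" "Iinf - (1/16) ^ k < I n" using n1[of n] by (auto simp: n_def)
    have "I n < Iinf + (1/16) ^ k" using Iinf(2)[of n] by (smt (verit) zero_less_power zero_less_divide_1_iff)
    then obtain h where "h \<in> K n" "J h < Iinf + (1/16) ^ k"
      unfolding I_def using GK[of n] bdd by (subst (asm) cInf_less_iff) auto
    with n show ?thesis by blast
  qed
  then obtain b \<nu> where b: "\<And>k. \<nu> k \<ge> k" "\<And>k. b k \<in> K (\<nu> k)" "\<And>k. J (b k) < Iinf + (1/16) ^ k" "\<And>k. Iinf - (1/16) ^ k < I (\<nu> k)"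
    by metis
  have bM[measurable]: "b k \<in> borel_measurable M" for k using b(2)[of k] by (simp add: K_def)
  have bC: "(\<integral>\<^sup>+x. \<bar>b k x\<bar> powr p \<partial>M) \<le> ennreal C" for k using b(2)[of k] by (simp add: K_def)
  have step: "(\<integral>\<^sup>+x. sqrt \<bar>b (Suc k) x - b k x\<bar> \<partial>N) \<le> ennreal ((4 + 2 * D) * (1/2) ^ k)" for k
  proof -
    \<comment> \<open>\<open>\<nu>\<close> need not be monotone; the smaller index gives a set
      containing both functions and hence their midpoint.\<close>
    define n where "n = min (\<nu> k) (\<nu> (Suc k))"
    have bn: "b k \<in> K n" "b (Suc k) \<in> K n" 
      using b(2)[of k] b(2)[of "Suc k"] K_mono[of n "\<nu> k"] K_mono[of n "\<nu> (Suc k)"] by (auto simp: n_def)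
    let ?mid = "\<lambda>x. (b (Suc k) x + b k x) / 2"
    have mid: "?mid \<in> K n" using K_mid bn by blast
    have i: "integrable N (\<lambda>x. s (b k x))" "integrable N (\<lambda>x. s (b (Suc k) x))" "integrable N (\<lambda>x. s (?mid x))"
      using sN bn mid by blast+
    have pk: "(1/16::real) ^ Suc k \<le> (1/16) ^ k" by simp
    have "Iinf - (1/16) ^ k < I (\<nu> (Suc k))" using b(4)[of "Suc k"] pk by linarith
    then have "Iinf - (1/16) ^ k \<le> I n" using b(4)[of k] by (simp add: n_def min_def)
    then have midJ: "Iinf - (1/16) ^ k \<le> J ?mid" using I_le[OF mid] by linarith
    define l :: real where "l = (1/2) ^ k"
    have l: "l > 0" "l ^ 4 = (1/16) ^ k"
    proof -
      have "l ^ 4 = ((1/2) ^ 4) ^ k" unfolding l_def by (simp only: power_mult[symmetric] mult.commute)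
      also have "(1/2::real) ^ 4 = 1/16" by (simp add: power_divide)
      finally show "l ^ 4 = (1/16) ^ k" .
    qed (simp add: l_def)
    define gap where "gap = J (b (Suc k)) + J (b k) - 2 * J ?mid"
    \<comment> \<open>The two values of J exceed Iinf by at most l^4 each, and twice the midpoint
      value falls short of 2 Iinf by at most 2 l^4.\<close>
    have "gap \<le> 4 * l ^ 4" using midJ b(3)[of k] b(3)[of "Suc k"] pk unfolding gap_def l by linarith
    have "(\<integral>\<^sup>+x. sqrt \<bar>b (Suc k) x - b k x\<bar> \<partial>N) \<le>
       (\<integral>\<^sup>+x. ennreal ((s (b (Suc k) x) + s (b k x) - 2 * s (?mid x)) / l ^ 3 + l * (s (b (Suc k) x) + s (b k x))) \<partial>N)"
      using sqrt_gap_ineq[OF l(1)] by (intro nn_integral_mono ennreal_leI) (simp add: s_def)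
    also have "\<dots> = ennreal (LINT x|N. (s (b (Suc k) x) + s (b k x) - 2 * s (?mid x)) / l ^ 3 + l * (s (b (Suc k) x) + s (b k x)))"
    proof (rule nn_integral_eq_integral)
      show "AE x in N. 0 \<le> (s (b (Suc k) x) + s (b k x) - 2 * s (?mid x)) / l ^ 3 + l * (s (b (Suc k) x) + s (b k x))"
        using sqrt_gap_ineq[OF l(1)] by (intro AE_I2) (smt (verit) s_def real_sqrt_ge_zero)
    qed (use i in auto)
    also have "(LINT x|N. (s (b (Suc k) x) + s (b k x) - 2 * s (?mid x)) / l ^ 3 + l * (s (b (Suc k) x) + s (b k x)))
       = gap / l ^ 3 + l * (J (b (Suc k)) + J (b k))"
      using i by (simp add: J_def gap_def)
    also have "ennreal \<dots> \<le> ennreal ((4 + 2 * D) * (1/2) ^ k)"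
    proof (rule ennreal_leI)
      have "gap / l ^ 3 \<le> 4 * l" using \<open>gap \<le> 4 * l ^ 4\<close> l(1) by (simp add: divide_le_eq power3_eq_cube power4_eq_xxxx)
      moreover have "l * (J (b (Suc k)) + J (b k)) \<le> l * (D + D)" using sN bn l(1) by (intro mult_left_mono add_mono) auto
      ultimately show "gap / l ^ 3 + l * (J (b (Suc k)) + J (b k)) \<le> (4 + 2 * D) * (1/2) ^ k"
        by (simp add: l_def[symmetric] algebra_simps)
    qed
    finally show ?thesis .
  qed
  have "AE x in N. (\<Sum>k. ennreal (sqrt \<bar>b (Suc k) x - b k x\<bar>)) \<noteq> \<infinity>"
  proof (rule nn_integral_PInf_AE)
    have "(\<integral>\<^sup>+x. (\<Sum>k. ennreal (sqrt \<bar>b (Suc k) x - b k x\<bar>)) \<partial>N) = (\<Sum>k. \<integral>\<^sup>+x. sqrt \<bar>b (Suc k) x - b k x\<bar> \<partial>N)"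
      by (rule nn_integral_suminf) measurable
    also have "\<dots> \<le> (\<Sum>k. ennreal ((4 + 2 * D) * (1/2) ^ k))" by (intro suminf_le step) auto
    also have "\<dots> < \<infinity>"
    proof -
      have "summable (\<lambda>k. (4 + 2 * D) * (1/2::real) ^ k)" by (intro summable_mult summable_geometric) simp
      moreover have "0 \<le> D" using C by (simp add: D_def)
      ultimately have "(\<Sum>k. ennreal ((4 + 2 * D) * (1/2) ^ k)) = ennreal (\<Sum>k. (4 + 2 * D) * (1/2) ^ k)"
        by (intro suminf_ennreal2) auto
      then show ?thesis by simp
    qed
    finally show "(\<integral>\<^sup>+x. (\<Sum>k. ennreal (sqrt \<bar>b (Suc k) x - b k x\<bar>)) \<partial>N) \<noteq> \<infinity>" by simp
  qed measurable
  then have "AE x in N. convergent (\<lambda>k. b k x)"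
  proof eventually_elim
    case (elim x)
    \<comment> \<open>Summable square roots are eventually below 1, where they dominate the
      increments themselves; so the increments are summable too.\<close>
    then have "summable (\<lambda>k. sqrt \<bar>b (Suc k) x - b k x\<bar>)" by (intro summable_suminf_not_top) auto
    moreover from summable_LIMSEQ_zero[OF this] have "eventually (\<lambda>k. sqrt \<bar>b (Suc k) x - b k x\<bar> < 1) sequentially"
      by (rule order_tendstoD) simp
    then have "eventually (\<lambda>k. norm (b (Suc k) x - b k x) \<le> sqrt \<bar>b (Suc k) x - b k x\<bar>) sequentially"
    proof eventually_elim
      case (elim k)
      have "\<bar>t\<bar> \<le> sqrt \<bar>t\<bar>" if "sqrt \<bar>t\<bar> < 1" for t :: real
        using mult_left_mono[of "sqrt \<bar>t\<bar>" 1 "sqrt \<bar>t\<bar>"] that by simp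
      with elim show ?case by simp
    qed
    ultimately have "summable (\<lambda>k. b (Suc k) x - b k x)" by (rule summable_comparison_test_ev[rotated])
    then have "convergent (\<lambda>n. \<Sum>k<n. b (Suc k) x - b k x)" by (simp add: summable_iff_convergent)
    then have "convergent (\<lambda>n. b n x - b 0 x)" by (simp only: sum_lessThan_telescope[of "\<lambda>k. b k x"])
    from convergent_add[OF this convergent_const[of "b 0 x"]] show ?case by simp
  qed
  then have conv: "AE x in M. convergent (\<lambda>k. b k x)"
    unfolding N_def by (subst (asm) AE_density) (use w0p in \<open>auto simp: w_def elim!: eventually_mono\<close>)
  define g where "g x = lim (\<lambda>k. b k x)" for x
  have g[measurable]: "g \<in> borel_measurable M" unfolding g_def by measurable
  have ae: "AE x in M. (\<lambda>k. b k x) \<longlonglongrightarrow> g x"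
    using conv by eventually_elim (simp add: g_def convergent_LIMSEQ_iff)
  have gC: "(\<integral>\<^sup>+x. \<bar>g x\<bar> powr p \<partial>M) \<le> ennreal C"
  proof -
    have "(\<integral>\<^sup>+x. \<bar>g x\<bar> powr p \<partial>M) = (\<integral>\<^sup>+x. liminf (\<lambda>k. ennreal (\<bar>b k x\<bar> powr p)) \<partial>M)"
    proof (rule nn_integral_cong_AE)
      show "AE x in M. ennreal (\<bar>g x\<bar> powr p) = liminf (\<lambda>k. ennreal (\<bar>b k x\<bar> powr p))"
        using ae
      proof eventually_elim
        case (elim x)
        have "(\<lambda>k. ennreal (\<bar>b k x\<bar> powr p)) \<longlonglongrightarrow> ennreal (\<bar>g x\<bar> powr p)"
          using p by (intro tendsto_ennrealI tendsto_powr' tendsto_rabs tendsto_const elim) auto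
        then show ?case by (rule lim_imp_Liminf[OF trivial_limit_sequentially, symmetric])
      qed
    qed
    also have "\<dots> \<le> liminf (\<lambda>k. \<integral>\<^sup>+x. ennreal (\<bar>b k x\<bar> powr p) \<partial>M)" by (rule nn_integral_liminf) measurable
    also have "\<dots> \<le> limsup (\<lambda>k. \<integral>\<^sup>+x. ennreal (\<bar>b k x\<bar> powr p) \<partial>M)" by (rule Liminf_le_Limsup) simp
    also have "\<dots> \<le> ennreal C" by (rule Limsup_bounded) (use bC in auto)
    finally show ?thesis .
  qed
  show thesis
  proof (rule that[OF g gC])
    fix \<phi> l B assume \<phi>: "\<phi> \<in> borel_measurable M" "\<And>x. \<bar>\<phi> x\<bar> \<le> B" "emeasure M {x\<in>space M. \<phi> x \<noteq> 0} < \<infinity>"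
      and l: "(\<lambda>n. LINT x|M. G n x * \<phi> x) \<longlonglongrightarrow> l"
    have t: "test \<phi>" using \<phi> by (auto simp: test_def)
    have "(\<lambda>k. LINT x|M. b k x * \<phi> x) \<longlonglongrightarrow> (LINT x|M. g x * \<phi> x)"
      by (rule Lp_bounded_AE_convergence[OF bM g \<phi>(1) p C bC gC ae \<phi>(2,3)])
    moreover have "(\<lambda>k. LINT x|M. b k x * \<phi> x) \<longlonglongrightarrow> l"
    proof (rule LIMSEQ_I)
      fix r :: real assume "r > 0"
      then obtain n0 where n0: "\<And>n. n \<ge> n0 \<Longrightarrow> norm ((LINT x|M. G n x * \<phi> x) - l) < r / 2"
        using LIMSEQ_D[OF l, of "r / 2"] by auto
      show "\<exists>n0. \<forall>k\<ge>n0. norm ((LINT x|M. b k x * \<phi> x) - l) < r"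
      proof (intro exI allI impI)
        fix k assume "k \<ge> n0"
        \<comment> \<open>From index \<open>\<nu> k\<close> on the pairings of G m lie in this
          interval, and membership in \<open>K (\<nu> k)\<close> passes the interval on to b
          k.\<close>
        have "\<forall>m\<ge>\<nu> k. l - r / 2 \<le> (LINT x|M. G m x * \<phi> x) \<and> (LINT x|M. G m x * \<phi> x) \<le> l + r / 2"
        proof (intro allI impI)
          fix m assume "m \<ge> \<nu> k"
          then have "m \<ge> n0" using b(1)[of k] \<open>k \<ge> n0\<close> by linarith
          from n0[OF this] have "\<bar>(LINT x|M. G m x * \<phi> x) - l\<bar> < r / 2" by simp
          then show "l - r / 2 \<le> (LINT x|M. G m x * \<phi> x) \<and> (LINT x|M. G m x * \<phi> x) \<le> l + r / 2"
            by linarith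
        qed
        then have "l - r / 2 \<le> (LINT x|M. b k x * \<phi> x) \<and> (LINT x|M. b k x * \<phi> x) \<le> l + r / 2"
          by (rule K_bounds[OF b(2) t])
        then show "norm ((LINT x|M. b k x * \<phi> x) - l) < r" using \<open>r > 0\<close> unfolding real_norm_def by linarith
      qed
    qed
    ultimately show "(LINT x|M. g x * \<phi> x) = l" by (rule LIMSEQ_unique)
  qed
qed

section \<open>Mean oscillation of linear functions\<close>

lemma nn_integral_lborel_scale:
  fixes F :: "'a::euclidean_space \<Rightarrow> ennreal"
  assumes [measurable]: "F \<in> borel_measurable borel" and c: "c > 0"
  shows "(\<integral>\<^sup>+x. F x \<partial>lborel) = ennreal (c ^ DIM('a)) * (\<integral>\<^sup>+x. F (c *\<^sub>R x) \<partial>lborel)"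
  using c by (subst lborel_affine[of c 0]) (simp_all add: nn_integral_density nn_integral_distr nn_integral_cmult)

text \<open>The library results on linear images require a well-ordered index type. Here the invariance follows
  from Tonelli's theorem, tested against the unit ball, which is itself invariant.\<close>

lemma nn_integral_orthogonal_transformation:
  fixes f :: "'a::euclidean_space \<Rightarrow> 'a" and G :: "'a \<Rightarrow> ennreal"
  assumes f: "orthogonal_transformation f" and [measurable]: "G \<in> borel_measurable borel"
  shows "(\<integral>\<^sup>+x. G (f x) \<partial>lborel) = (\<integral>\<^sup>+x. G x \<partial>lborel)"
proof -
  interpret linear f using f by (rule orthogonal_transformation_linear)
  have [measurable]: "f \<in> borel_measurable borel"
    by (intro borel_measurable_continuous_onI linear_continuous_on linear_linear[THEN iffD2]) (rule linear_axioms)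
  let ?V = "emeasure lborel (ball (0::'a) 1)"
  have ball1: "emeasure lborel (ball w 1) = ?V" for w :: 'a by (simp add: emeasure_ball)
  \<comment> \<open>By surjectivity x = f w, so a shift in the range is a shift by w in the
    domain.\<close>
  have tr: "(\<integral>\<^sup>+z. G (x + f z) \<partial>lborel) = (\<integral>\<^sup>+z. G (f z) \<partial>lborel)" for x
  proof -
    obtain w where w: "x = f w" using orthogonal_transformation_surj[OF f] by (meson surjD)
    have "(\<integral>\<^sup>+z. G (x + f z) \<partial>lborel) = (\<integral>\<^sup>+z. G (f (z + w)) \<partial>lborel)" by (simp add: w add add.commute)
    then show ?thesis by (simp add: lborel_nn_integral_translate[where F="\<lambda>z. G (f z)"])
  qed
  have "?V * (\<integral>\<^sup>+z. G (f z) \<partial>lborel) = (\<integral>\<^sup>+x. indicator (ball 0 1) x * (\<integral>\<^sup>+z. G (x + f z) \<partial>lborel) \<partial>lborel)"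
    by (simp add: tr nn_integral_multc)
  also have "\<dots> = (\<integral>\<^sup>+x. \<integral>\<^sup>+z. indicator (ball 0 1) x * G (x + f z) \<partial>lborel \<partial>lborel)"
    by (intro nn_integral_cong nn_integral_cmult[symmetric]) measurable
  also have "\<dots> = (\<integral>\<^sup>+z. \<integral>\<^sup>+x. indicator (ball 0 1) x * G (x + f z) \<partial>lborel \<partial>lborel)"
    by (rule lborel_pair.Fubini'[symmetric]) measurable
  also have "\<dots> = (\<integral>\<^sup>+z. \<integral>\<^sup>+x. indicator (ball 0 1) (x - f z) * G x \<partial>lborel \<partial>lborel)"
  proof (rule nn_integral_cong)
    fix z show "(\<integral>\<^sup>+x. indicator (ball 0 1) x * G (x + f z) \<partial>lborel) = (\<integral>\<^sup>+x. indicator (ball 0 1) (x - f z) * G x \<partial>lborel)"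
      using lborel_nn_integral_translate[where c="f z" and F="\<lambda>x. indicator (ball 0 1) (x - f z) * G x"] by simp
  qed
  also have "\<dots> = (\<integral>\<^sup>+x. \<integral>\<^sup>+z. indicator (ball 0 1) (x - f z) * G x \<partial>lborel \<partial>lborel)"
    by (rule lborel_pair.Fubini') measurable
  also have "\<dots> = (\<integral>\<^sup>+x. ?V * G x \<partial>lborel)"
  proof (rule nn_integral_cong)
    fix x
    obtain w where w: "x = f w" using orthogonal_transformation_surj[OF f] by (meson surjD)
    have "indicator (ball 0 1) (x - f z) = (indicator (ball w 1) z :: ennreal)" for z
      unfolding w diff[symmetric] by (auto simp: indicator_def dist_norm orthogonal_transformation_norm[OF f])
    then show "(\<integral>\<^sup>+z. indicator (ball 0 1) (x - f z) * G x \<partial>lborel) = ?V * G x"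
      by (simp add: nn_integral_multc ball1[of w])
  qed
  also have "\<dots> = ?V * (\<integral>\<^sup>+x. G x \<partial>lborel)" by (simp add: nn_integral_cmult)
  finally have eq: "?V * (\<integral>\<^sup>+z. G (f z) \<partial>lborel) = ?V * (\<integral>\<^sup>+x. G x \<partial>lborel)" .
  have "0 < unit_ball_vol (real DIM('a))" by simp
  then have "?V \<noteq> 0" "?V \<noteq> top" by (simp_all add: emeasure_ball ennreal_eq_0_iff not_le del: unit_ball_vol_pos)
  with eq show ?thesis by (simp add: ennreal_mult_cancel_left)
qed

text \<open>At height y the unit ball has a slice of radius sqrt(1 - y^2); n stands for the
  dimension of the slice. Evenness and the substitution t = y^2 lead to Beta(1, n/2 + 1).\<close>

lemma abs_times_sqrt_power_integral:
  "(\<integral>\<^sup>+y. ennreal (\<bar>y\<bar> * sqrt (1 - y\<^sup>2) ^ n) * indicator {-1..1} y \<partial>lborel) = ennreal (2 / (real n + 2))"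
proof -
  let ?I = "\<integral>\<^sup>+y. ennreal (y * sqrt (1 - y\<^sup>2) ^ n) * indicator {0..1} y \<partial>lborel"
  have neg: "(\<integral>\<^sup>+y. ennreal (- (y * sqrt (1 - y\<^sup>2) ^ n)) * indicator {-1..0} y \<partial>lborel) = ?I"
    by (subst nn_integral_real_affine[of _ "-1" 0]) (auto simp: indicator_def intro!: nn_integral_cong)
  have "(\<integral>\<^sup>+y. ennreal (\<bar>y\<bar> * sqrt (1 - y\<^sup>2) ^ n) * indicator {-1..1} y \<partial>lborel) =
     (\<integral>\<^sup>+y. ennreal (y * sqrt (1 - y\<^sup>2) ^ n) * indicator {0..1} y + ennreal (- (y * sqrt (1 - y\<^sup>2) ^ n)) * indicator {-1..0} y \<partial>lborel)"
    by (intro nn_integral_cong_AE AE_I[of _ _ "{0}"]) (auto simp: indicator_def)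
  also have "\<dots> = ?I + ?I" by (subst nn_integral_add) (auto simp: neg)
  also have "\<dots> = 2 * ?I" by (simp add: mult_2)
  also have "\<dots> = (\<integral>\<^sup>+y. ennreal (sqrt (1 - y\<^sup>2) ^ n * (2 * y) * indicator {0..1} y) \<partial>lborel)"
    by (subst nn_integral_cmult[symmetric]) (auto intro!: nn_integral_cong simp: indicator_def mult_ac simp flip: ennreal_numeral ennreal_mult')
  also have "\<dots> = (\<integral>\<^sup>+t. ennreal (sqrt (1 - t) ^ n * indicator {0\<^sup>2..1\<^sup>2} t) \<partial>lborel)"
    by (rule nn_integral_substitution[symmetric, where g="\<lambda>x. x ^ 2" and g'="\<lambda>x. 2 * x"])
      (auto intro!: derivative_eq_intros continuous_intros simp: set_borel_measurable_def)
  also have "\<dots> = (\<integral>\<^sup>+t. ennreal (t powr (1 - 1) * (1 - t) powr (real n / 2 + 1 - 1)) * indicator {0..1} t \<partial>lborel)"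
    by (intro nn_integral_cong_AE AE_I[of _ _ "{0, 1}"])
      (auto simp: indicator_def powr_half_sqrt[symmetric] powr_powr powr_realpow[symmetric] emeasure_lborel_countable)
  also have "\<dots> = ennreal (Beta 1 (real n / 2 + 1))"
    using nn_integral_has_integral_lebesgue[OF _ has_integral_Beta_real[of 1 "real n / 2 + 1"]]
    by (simp add: mult_ac ennreal_mult' ennreal_indicator)
  also have "Beta 1 (real n / 2 + 1) = 2 / (real n + 2)"
  proof -
    have "Gamma (real n / 2 + 1 + 1) = (real n / 2 + 1) * Gamma (real n / 2 + 1)"
      by (rule Gamma_plus1) (auto elim!: nonpos_Ints_cases simp: add_pos_nonneg)
    then have g: "Gamma (1 + (real n / 2 + 1)) = (real n / 2 + 1) * Gamma (real n / 2 + 1)" by (simp only: add.commute)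
    have "Gamma (real n / 2 + 1) > 0" by (rule Gamma_real_pos) simp
    then have "Gamma (real n / 2 + 1) \<noteq> 0" by (rule less_imp_neq[THEN not_sym])
    then have "Beta 1 (real n / 2 + 1) = 1 / (real n / 2 + 1)" unfolding Beta_def g by simp
    then show ?thesis by (simp add: field_simps)
  qed
  finally show ?thesis .
qed

text \<open>Tonelli's theorem, slicing the unit ball orthogonally to the coordinate i into balls
  over the coordinates in A.\<close>

lemma abs_coord_PiM_ball_integral:
  assumes "finite A" "i \<notin> A"
  shows "(\<integral>\<^sup>+f. ennreal \<bar>f i\<bar> * indicator {f. sqrt (\<Sum>j\<in>insert i A. (f j)\<^sup>2) \<le> 1} f \<partial>Pi\<^sub>M (insert i A) (\<lambda>_. lborel)) =
     ennreal (unit_ball_vol (card A) * (2 / (real (card A) + 2)))"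
proof -
  interpret product_sigma_finite "\<lambda>_. lborel :: real measure" by standard
  have "(\<integral>\<^sup>+f. ennreal \<bar>f i\<bar> * indicator {f. sqrt (\<Sum>j\<in>insert i A. (f j)\<^sup>2) \<le> 1} f \<partial>Pi\<^sub>M (insert i A) (\<lambda>_. lborel)) =
    (\<integral>\<^sup>+y. \<integral>\<^sup>+x. ennreal \<bar>(x(i := y)) i\<bar> * indicator {f. sqrt (\<Sum>j\<in>insert i A. (f j)\<^sup>2) \<le> 1} (x(i := y)) \<partial>Pi\<^sub>M A (\<lambda>_. lborel) \<partial>lborel)"
    using assms by (intro product_nn_integral_insert_rev) auto
  also have "\<dots> = (\<integral>\<^sup>+y. \<integral>\<^sup>+x. ennreal \<bar>y\<bar> * indicator {-1..1} y * indicator ({f. sqrt (\<Sum>j\<in>A. (f j)\<^sup>2) \<le> sqrt (1 - y\<^sup>2)} \<inter> space (Pi\<^sub>M A (\<lambda>_. lborel))) x \<partial>Pi\<^sub>M A (\<lambda>_. lborel) \<partial>lborel)"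
  proof (intro nn_integral_cong)
    fix y and x :: "'a \<Rightarrow> real" assume x: "x \<in> space (Pi\<^sub>M A (\<lambda>_. lborel :: real measure))"
    have "(\<Sum>j\<in>A. ((x(i := y)) j)\<^sup>2) = (\<Sum>j\<in>A. (x j)\<^sup>2)" using assms by (intro sum.cong) auto
    then have eq: "(\<Sum>j\<in>insert i A. ((x(i := y)) j)\<^sup>2) = y\<^sup>2 + (\<Sum>j\<in>A. (x j)\<^sup>2)" using assms by simp
    have "y \<in> {-1..1}" if "y\<^sup>2 + (\<Sum>j\<in>A. (x j)\<^sup>2) \<le> 1"
    proof -
      have "y\<^sup>2 \<le> 1" using that sum_nonneg[of A "\<lambda>j. (x j)\<^sup>2"] by auto
      then show ?thesis by (simp add: abs_square_le_1 abs_le_iff)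
    qed
    then show "ennreal \<bar>(x(i := y)) i\<bar> * indicator {f. sqrt (\<Sum>j\<in>insert i A. (f j)\<^sup>2) \<le> 1} (x(i := y)) =
      ennreal \<bar>y\<bar> * indicator {-1..1} y * indicator ({f. sqrt (\<Sum>j\<in>A. (f j)\<^sup>2) \<le> sqrt (1 - y\<^sup>2)} \<inter> space (Pi\<^sub>M A (\<lambda>_. lborel))) x"
      using x unfolding indicator_def mem_Collect_eq eq by (auto simp: algebra_simps)
  qed
  also have "\<dots> = (\<integral>\<^sup>+y. ennreal \<bar>y\<bar> * indicator {-1..1} y * emeasure (Pi\<^sub>M A (\<lambda>_. lborel)) ({f. sqrt (\<Sum>j\<in>A. (f j)\<^sup>2) \<le> sqrt (1 - y\<^sup>2)} \<inter> space (Pi\<^sub>M A (\<lambda>_. lborel))) \<partial>lborel)"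
    by (intro nn_integral_cong nn_integral_cmult_indicator) auto
  also have "\<dots> = (\<integral>\<^sup>+y. ennreal (unit_ball_vol (card A)) * (ennreal (\<bar>y\<bar> * sqrt (1 - y\<^sup>2) ^ card A) * indicator {-1..1} y) \<partial>lborel)"
  proof (rule nn_integral_cong_AE)
    \<comment> \<open>At the poles the slice has radius 0; discarding them leaves positive radii for
      the volume formula.\<close>
    have "AE y in lborel. y \<notin> {-1,1::real}" by (intro AE_not_in countable_imp_null_set_lborel) auto
    then show "AE y in lborel. ennreal \<bar>y\<bar> * indicator {-1..1} y * emeasure (Pi\<^sub>M A (\<lambda>_. lborel)) ({f. sqrt (\<Sum>j\<in>A. (f j)\<^sup>2) \<le> sqrt (1 - y\<^sup>2)} \<inter> space (Pi\<^sub>M A (\<lambda>_. lborel)))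
       = ennreal (unit_ball_vol (card A)) * (ennreal (\<bar>y\<bar> * sqrt (1 - y\<^sup>2) ^ card A) * indicator {-1..1} y)"
    proof eventually_elim
      case (elim y)
      show ?case
      proof (cases "y \<in> {-1<..<1}")
        case True
        then have "y\<^sup>2 < 1" by (simp add: abs_square_less_1 abs_less_iff)
        then show ?thesis
          using assms by (subst emeasure_cball_aux) (auto simp: ennreal_mult mult_ac indicator_def)
      qed (use elim in auto)
    qed
  qed
  also have "\<dots> = ennreal (unit_ball_vol (card A)) * ennreal (2 / (real (card A) + 2))"
    by (subst nn_integral_cmult) (simp_all add: abs_times_sqrt_power_integral)
  finally show ?thesis by (subst ennreal_mult) auto
qed

text \<open>The mean of \<open>|u \<bullet> e|\<close> over the unit ball for a unit vector \<open>e\<close>.\<close>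

definition linear_osc :: "nat \<Rightarrow> real" where
  "linear_osc d = 1 / sqrt pi * (Gamma ((real d + 2) / 2) / Gamma ((real d + 3) / 2))"

lemma linear_osc_pos: "linear_osc d > 0"
  unfolding linear_osc_def by (intro mult_pos_pos divide_pos_pos Gamma_real_pos) auto

text \<open>Dimension d - 1 belongs to the slices. The functional equation Gamma((d+3)/2) = (d+1)/2
  Gamma((d+1)/2) identifies the slice integral with the closed form in
  \<open>linear_osc\<close>.\<close>

lemma linear_osc_unit_ball_vol:
  assumes "d \<ge> 1"
  shows "unit_ball_vol (real (d - 1)) * (2 / (real (d - 1) + 2)) = linear_osc d * unit_ball_vol (real d)"
proof -
  let ?a = "(real d + 1) / 2"
  have a: "real (d - 1) / 2 + 1 = ?a" "real (d - 1) + 2 = real d + 1" using assms by (auto simp: of_nat_diff field_simps)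
  have "Gamma (?a + 1) = ?a * Gamma ?a" by (rule Gamma_plus1) (auto elim!: nonpos_Ints_cases)
  moreover have "(real d + 3) / 2 = ?a + 1" by (simp add: field_simps)
  ultimately have g: "Gamma ((real d + 3) / 2) = ?a * Gamma ?a" by (simp only:)
  have pos: "Gamma ?a > 0" "Gamma (real d / 2 + 1) > 0" by (auto intro!: Gamma_real_pos)
  have "pi powr (real d / 2) = pi powr (real (d - 1) / 2 + 1 / 2)" using assms by (simp add: of_nat_diff field_simps)
  then have p: "pi powr (real d / 2) = pi powr (real (d - 1) / 2) * sqrt pi" by (simp only: powr_add powr_half_sqrt pi_ge_zero)
  have h: "(real d + 2) / 2 = real d / 2 + 1" by (simp add: field_simps)
  \<comment> \<open>What remains is rational algebra: P, A and B stand for the power of pi and the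
    two Gamma values, q for d + 1 and s for sqrt pi.\<close>
  have "P / A * (2 / q) = 1 / s * (B / (q / 2 * A)) * (P * s / B)" if "A > 0" "B > 0" "q > 0" "s > 0" for A B P q s :: real
    using that by (simp add: field_simps)
  from this[OF pos, of "real d + 1" "sqrt pi" "pi powr (real (d - 1) / 2)"]
  show ?thesis unfolding unit_ball_vol_def linear_osc_def a g p h by simp
qed

lemma abs_coord_unit_ball_integral:
  assumes b: "b \<in> (Basis :: 'a::euclidean_space set)"
  shows "(\<integral>\<^sup>+u. ennreal \<bar>u \<bullet> b\<bar> * indicator (ball (0::'a) 1) u \<partial>lborel) = ennreal (linear_osc DIM('a) * unit_ball_vol DIM('a))"
proof -
  have "(\<integral>\<^sup>+u. ennreal \<bar>u \<bullet> b\<bar> * indicator (ball (0::'a) 1) u \<partial>lborel) = (\<integral>\<^sup>+u. ennreal \<bar>u \<bullet> b\<bar> * indicator (cball (0::'a) 1) u \<partial>lborel)"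
  proof (rule nn_integral_cong_AE)
    have "emeasure lborel (cball (0::'a) 1 - ball 0 1) = 0"
      by (subst emeasure_Diff) (auto simp: emeasure_ball emeasure_cball)
    then have "AE u in lborel. u \<notin> cball (0::'a) 1 - ball 0 1" by (intro AE_not_in) (simp add: null_sets_def)
    then show "AE u in lborel. ennreal \<bar>u \<bullet> b\<bar> * indicator (ball (0::'a) 1) u = ennreal \<bar>u \<bullet> b\<bar> * indicator (cball (0::'a) 1) u"
      by eventually_elim (auto simp: indicator_def)
  qed
  also have "\<dots> = (\<integral>\<^sup>+f. ennreal \<bar>(\<Sum>j\<in>Basis. f j *\<^sub>R j) \<bullet> b\<bar> * indicator (cball (0::'a) 1) (\<Sum>j\<in>Basis. f j *\<^sub>R j) \<partial>Pi\<^sub>M Basis (\<lambda>_. lborel))"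
    by (subst lborel_eq, subst nn_integral_distr) auto
  also have "\<dots> = (\<integral>\<^sup>+f. ennreal \<bar>f b\<bar> * indicator {f. sqrt (\<Sum>j\<in>insert b (Basis - {b}). (f j)\<^sup>2) \<le> 1} f \<partial>Pi\<^sub>M (insert b (Basis - {b})) (\<lambda>_. lborel))"
  proof -
    have "dist 0 (\<Sum>j\<in>Basis. f j *\<^sub>R j :: 'a) = sqrt (\<Sum>j\<in>Basis. (f j)\<^sup>2)" for f
      by (subst euclidean_dist_l2) (auto simp: L2_set_def)
    then show ?thesis using b by (simp add: insert_absorb indicator_def del: dist_0_norm)
  qed
  also have "\<dots> = ennreal (unit_ball_vol (card (Basis - {b})) * (2 / (real (card (Basis - {b})) + 2)))"
    by (rule abs_coord_PiM_ball_integral) auto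
  also have "card (Basis - {b}) = DIM('a) - 1" using b by (simp add: card_Diff_singleton)
  finally show ?thesis using linear_osc_unit_ball_vol[of "DIM('a)"] DIM_positive[where 'a='a] by simp
qed

text \<open>Rotating a multiple of a coordinate axis onto v and rescaling the radius to 1 reduces
  the claim to \<open>abs_coord_unit_ball_integral\<close>.\<close>

lemma abs_inner_ball_integral:
  fixes v :: "real^'n"
  assumes r: "r > 0"
  shows "(\<integral>\<^sup>+u. ennreal \<bar>v \<bullet> u\<bar> * indicator (ball 0 r) u \<partial>lborel) =
     ennreal (r * (linear_osc CARD('n) * norm v)) * emeasure lborel (ball (0::real^'n) r)"
proof -
  obtain k :: 'n where True by simp
  let ?e = "axis k 1 :: real^'n"
  have e: "?e \<in> Basis" by (simp add: axis_in_Basis_iff)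
  obtain f where f: "orthogonal_transformation f" "f (norm v *\<^sub>R ?e) = v"
    by (rule orthogonal_transformation_exists[of "norm v *\<^sub>R ?e" v]) auto
  have fv: "v \<bullet> f u = norm v * (u \<bullet> ?e)" for u
    using f unfolding orthogonal_transformation_def by (metis inner_commute inner_scaleR_left)
  have fb: "indicator (ball 0 r) (f u) = (indicator (ball 0 r) u :: ennreal)" for u
    by (simp add: indicator_def orthogonal_transformation_norm[OF f(1)])
  have "(\<integral>\<^sup>+u. ennreal \<bar>v \<bullet> u\<bar> * indicator (ball 0 r) u \<partial>lborel) = (\<integral>\<^sup>+u. ennreal \<bar>v \<bullet> f u\<bar> * indicator (ball 0 r) (f u) \<partial>lborel)"
    by (rule nn_integral_orthogonal_transformation[OF f(1), symmetric]) measurable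
  also have "\<dots> = ennreal (norm v) * (\<integral>\<^sup>+u. ennreal \<bar>u \<bullet> ?e\<bar> * indicator (ball 0 r) u \<partial>lborel)"
    unfolding fv fb by (subst nn_integral_cmult[symmetric]) (auto simp: abs_mult ennreal_mult mult_ac)
  also have "(\<integral>\<^sup>+u. ennreal \<bar>u \<bullet> ?e\<bar> * indicator (ball 0 r) u \<partial>lborel) =
     ennreal (r ^ CARD('n)) * (\<integral>\<^sup>+u. ennreal \<bar>(r *\<^sub>R u) \<bullet> ?e\<bar> * indicator (ball 0 r) (r *\<^sub>R u) \<partial>lborel)"
    by (subst nn_integral_lborel_scale[OF _ r]) simp_all
  also have "(\<integral>\<^sup>+u. ennreal \<bar>(r *\<^sub>R u) \<bullet> ?e\<bar> * indicator (ball 0 r) (r *\<^sub>R u) \<partial>lborel) = (\<integral>\<^sup>+u. ennreal r * (ennreal \<bar>u \<bullet> ?e\<bar> * indicator (ball 0 1) u) \<partial>lborel)"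
    using r by (intro nn_integral_cong) (auto simp: abs_mult ennreal_mult indicator_def mult_ac)
  also have "\<dots> = ennreal r * ennreal (linear_osc CARD('n) * unit_ball_vol CARD('n))"
    by (subst nn_integral_cmult) (simp_all add: abs_coord_unit_ball_integral[OF e])
  finally show ?thesis
    using r linear_osc_pos[of "CARD('n)"] by (simp add: emeasure_ball ennreal_mult[symmetric] mult_ac)
qed

section \<open>Mean oscillation and weak gradients\<close>

lemma integral_lborel_reflect:
  fixes F :: "'a::euclidean_space \<Rightarrow> 'b::{banach, second_countable_topology}"
  assumes [measurable]: "F \<in> borel_measurable borel"
  shows "(LINT x|lborel. F (- x)) = (LINT x|lborel. F x)"
  using lborel_affine[of "-1" "0::'a"] integral_distr[of "\<lambda>x. - x" lborel borel F] by (simp add: density_1)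

lemma emeasure_ball_translate: "emeasure lborel (ball (a::'a::euclidean_space) r) = emeasure lborel (ball (0::'a) r)"
  by (cases "r \<ge> 0") (simp_all add: emeasure_ball ball_empty)

lemma measure_ball_pos: "r > 0 \<Longrightarrow> measure lborel (ball (a::'a::euclidean_space) r) > 0"
  by (simp add: content_ball)

lemma measure_ball_translate: "measure lborel (ball (a::'a::euclidean_space) r) = measure lborel (ball (0::'a) r)"
  by (simp add: measure_def emeasure_ball_translate[of a])

lemma ball_average_borel:
  fixes f :: "real^'n \<Rightarrow> real"
  assumes [measurable]: "f \<in> borel_measurable borel"
  shows "ball_average f a r = (LINT u|lborel. indicator (ball 0 r) u * f (a + u)) / measure lborel (ball (0::real^'n) r)"
proof -
  have "(LINT x:ball a r|lebesgue. f x) = (LINT x|lborel. indicator (ball a r) x * f x)"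
    unfolding set_lebesgue_integral_def by (simp add: integral_completion)
  also have "\<dots> = (LINT u|lborel. indicator (ball a r) (u + a) * f (u + a))"
    by (rule lborel_integral_translate[symmetric]) measurable
  also have "\<dots> = (LINT u|lborel. indicator (ball 0 r) u * f (a + u))"
    by (intro Bochner_Integration.integral_cong) (auto simp: indicator_def dist_norm add.commute)
  finally show ?thesis by (simp add: ball_average_def measure_ball_translate[of a] measure_completion)
qed

lemma mean_oscillation_borel:
  fixes f :: "real^'n \<Rightarrow> real"
  assumes [measurable]: "f \<in> borel_measurable borel"
  shows "mean_oscillation f (a, r) = (LINT u|lborel. indicator (ball 0 r) u * \<bar>f (a + u) - ball_average f a r\<bar>) / measure lborel (ball (0::real^'n) r)"
  unfolding mean_oscillation_def by (simp add: ball_average_borel[of "\<lambda>x. \<bar>f x - c\<bar>" for c])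

lemma measure_ball_measurable [measurable (raw)]:
  assumes [measurable]: "r \<in> borel_measurable M"
  shows "(\<lambda>z. measure lborel (ball (0::'a::euclidean_space) (r z))) \<in> borel_measurable M"
proof -
  have "measure lborel (ball (0::'a) (r z)) = (if r z \<ge> 0 then unit_ball_vol DIM('a) * r z ^ DIM('a) else 0)" for z
    by (simp add: content_ball ball_empty)
  then show ?thesis by simp
qed

lemma ball_average_measurable [measurable (raw)]:
  fixes f :: "real^'n \<Rightarrow> real"
  assumes [measurable]: "f \<in> borel_measurable borel" "a \<in> borel_measurable M" "r \<in> borel_measurable M"
  shows "(\<lambda>z. ball_average f (a z) (r z)) \<in> borel_measurable M"
proof -
  have "(\<lambda>z::(real^'n) \<times> real. ball_average f (fst z) (snd z)) \<in> borel_measurable (borel \<Otimes>\<^sub>M borel)"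
    unfolding ball_average_borel[OF assms(1)] by measurable
  from measurable_compose[OF _ this, of "\<lambda>z. (a z, r z)" M] show ?thesis by simp
qed

lemma mean_oscillation_measurable [measurable (raw)]:
  fixes f :: "real^'n \<Rightarrow> real"
  assumes [measurable]: "f \<in> borel_measurable borel" "a \<in> borel_measurable M" "r \<in> borel_measurable M"
  shows "(\<lambda>z. mean_oscillation f (a z, r z)) \<in> borel_measurable M"
proof -
  have "(\<lambda>z::(real^'n) \<times> real. mean_oscillation f (fst z, snd z)) \<in> borel_measurable (borel \<Otimes>\<^sub>M borel)"
    unfolding mean_oscillation_borel[OF assms(1)] by measurable
  from measurable_compose[OF _ this, of "\<lambda>z. (a z, r z)" M] show ?thesis by simp
qed

lemma borel_loc_int_translate:
  assumes f: "borel_loc_int f"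
  shows "borel_loc_int (\<lambda>x. f (a + x))"
proof (rule borel_loc_intI)
  have [measurable]: "f \<in> borel_measurable borel" using f by (rule borel_loc_int_measurable)
  show "(\<lambda>x. f (a + x)) \<in> borel_measurable borel" by measurable
  fix R
  have "(\<integral>\<^sup>+x\<in>cball 0 R. norm (f (a + x)) \<partial>lborel) = (\<integral>\<^sup>+x. norm (f (x + a)) * indicator (cball a R) (x + a) \<partial>lborel)"
    by (intro nn_integral_cong) (auto simp: dist_norm add.commute split: split_indicator)
  also have "\<dots> = (\<integral>\<^sup>+x. norm (f x) * indicator (cball a R) x \<partial>lborel)"
    by (rule lborel_nn_integral_translate[where F="\<lambda>x. ennreal (norm (f x) * indicator (cball a R) x)"]) measurable
  also have "\<dots> = (\<integral>\<^sup>+x\<in>cball a R. norm (f x) \<partial>lborel)"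
    by (intro nn_integral_cong) (auto split: split_indicator)
  also have "\<dots> < \<infinity>" by (rule borel_loc_int_nn[OF f]) auto
  finally show "(\<integral>\<^sup>+x\<in>cball 0 R. norm (f (a + x)) \<partial>lborel) < \<infinity>" .
qed

lemma mean_oscillation_nonneg: "mean_oscillation f z \<ge> 0"
  by (cases z) (simp add: mean_oscillation_def ball_average_def set_lebesgue_integral_def)

text \<open>Compare f near a with the affine model f a + v . u: the linear part has mean 0 over the
  ball by reflection, and its mean absolute value is known exactly. The remainder
  \<open>\<rho>\<close> enters once directly and once through its mean m, hence the factor 2. The
  vector v is arbitrary.\<close>

lemma mean_oscillation_linear:
  fixes f :: "real^'n \<Rightarrow> real"
  assumes f: "borel_loc_int f" and r: "r > 0"
  defines "V \<equiv> measure lborel (ball (0::real^'n) r)"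
  shows "\<bar>mean_oscillation f (a, r) - r * (linear_osc CARD('n) * norm v)\<bar> * V
     \<le> 2 * (LINT u|lborel. indicator (ball 0 r) u * \<bar>f (a + u) - f a - v \<bullet> u\<bar>)"
    and "integrable lborel (\<lambda>u. indicator (ball 0 r) u * \<bar>f (a + u) - f a - v \<bullet> u\<bar>)"
proof -
  have [measurable]: "f \<in> borel_measurable borel" using f by (rule borel_loc_int_measurable)
  let ?I = "\<lambda>u. indicator (ball (0::real^'n) r) u :: real"
  define \<rho> where "\<rho> u = f (a + u) - f a - v \<bullet> u" for u
  have V: "V > 0" unfolding V_def by (rule measure_ball_pos[OF r])
  have fin: "emeasure lborel (ball (0::real^'n) r) < \<infinity>" by (rule emeasure_bounded_finite) simp
  have iI: "integrable lborel ?I" using fin by (simp add: integrable_indicator_iff)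
  have I: "(LINT u|lborel. ?I u) = V" by (simp add: V_def)
  have if': "integrable lborel (\<lambda>u. ?I u * f (a + u))"
    using borel_loc_int_bounded[OF borel_loc_int_translate[OF f, of a], of "ball 0 r"] by (simp add: set_integrable_def)
  have iv: "integrable lborel (\<lambda>u. ?I u * (v \<bullet> u))"
  proof (rule Bochner_Integration.integrable_bound[OF integrable_mult_right[OF iI, of "norm v * r"]])
    show "AE u in lborel. norm (?I u * (v \<bullet> u)) \<le> norm (norm v * r * ?I u)"
    proof (rule AE_I2)
      fix u
      have "\<bar>v \<bullet> u\<bar> \<le> norm v * r" if "norm u < r"
        using Cauchy_Schwarz_ineq2[of v u] that by (meson less_imp_le mult_left_mono norm_ge_zero order_trans)
      then show "norm (?I u * (v \<bullet> u)) \<le> norm (norm v * r * ?I u)" using r by (auto simp: indicator_def abs_mult)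
    qed
  qed measurable
  have v0: "(LINT u|lborel. ?I u * (v \<bullet> u)) = 0"
  proof -
    have "(LINT u|lborel. ?I u * (v \<bullet> u)) = (LINT u|lborel. ?I (- u) * (v \<bullet> (- u)))"
      by (rule integral_lborel_reflect[symmetric]) measurable
    also have "\<dots> = - (LINT u|lborel. ?I u * (v \<bullet> u))"
      by (simp add: indicator_def flip: integral_minus)
    finally show ?thesis by simp
  qed
  have i\<rho>: "integrable lborel (\<lambda>u. ?I u * \<rho> u)"
    unfolding \<rho>_def using if' iI iv by (simp add: right_diff_distrib)
  then show irho: "integrable lborel (\<lambda>u. ?I u * \<bar>f (a + u) - f a - v \<bullet> u\<bar>)"
    using integrable_abs[OF i\<rho>] by (simp add: abs_mult \<rho>_def)
  then have ia: "integrable lborel (\<lambda>u. ?I u * \<bar>\<rho> u\<bar>)" by (simp add: \<rho>_def)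
  define R where "R = (LINT u|lborel. ?I u * \<bar>\<rho> u\<bar>)"
  define m where "m = (LINT u|lborel. ?I u * \<rho> u) / V"
  have mV: "\<bar>m\<bar> * V \<le> R"
  proof -
    have "\<bar>m\<bar> * V = \<bar>LINT u|lborel. ?I u * \<rho> u\<bar>" using V by (simp add: m_def)
    also have "\<dots> \<le> (LINT u|lborel. \<bar>?I u * \<rho> u\<bar>)" by (rule integral_abs_bound)
    finally show ?thesis by (simp add: R_def abs_mult)
  qed
  have A: "ball_average f a r = f a + m"
  proof -
    have "(LINT u|lborel. ?I u * \<rho> u) = (LINT u|lborel. ?I u * f (a + u)) - (LINT u|lborel. ?I u * f a) - (LINT u|lborel. ?I u * (v \<bullet> u))"
      unfolding \<rho>_def using if' iI iv by (simp add: right_diff_distrib)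
    then have "(LINT u|lborel. ?I u * \<rho> u) = (LINT u|lborel. ?I u * f (a + u)) - f a * V"
      unfolding v0 by (simp add: V_def mult.commute)
    then show ?thesis unfolding ball_average_borel[OF \<open>f \<in> borel_measurable borel\<close>] m_def V_def[symmetric]
      using V by (simp add: field_simps)
  qed
  have split: "f (a + u) - ball_average f a r = v \<bullet> u + (\<rho> u - m)" for u by (simp add: A \<rho>_def)
  have osc: "mean_oscillation f (a, r) * V = (LINT u|lborel. ?I u * \<bar>v \<bullet> u + (\<rho> u - m)\<bar>)"
    unfolding mean_oscillation_borel[OF \<open>f \<in> borel_measurable borel\<close>] V_def[symmetric] split using V by simp
  have iabs: "integrable lborel (\<lambda>u. ?I u * \<bar>v \<bullet> u\<bar>)" using integrable_abs[OF iv] by (simp add: abs_mult)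
  have lin: "r * (linear_osc CARD('n) * norm v) * V = (LINT u|lborel. ?I u * \<bar>v \<bullet> u\<bar>)"
  proof -
    have pos: "0 \<le> r * (linear_osc CARD('n) * norm v)" using r linear_osc_pos[of "CARD('n)"] by simp
    have "ennreal (LINT u|lborel. ?I u * \<bar>v \<bullet> u\<bar>) = (\<integral>\<^sup>+u. ?I u * \<bar>v \<bullet> u\<bar> \<partial>lborel)"
      by (rule nn_integral_eq_integral[OF iabs, symmetric]) simp
    also have "\<dots> = (\<integral>\<^sup>+u. ennreal \<bar>v \<bullet> u\<bar> * indicator (ball 0 r) u \<partial>lborel)"
      by (intro nn_integral_cong) (auto split: split_indicator)
    also have "\<dots> = ennreal (r * (linear_osc CARD('n) * norm v)) * emeasure lborel (ball (0::real^'n) r)"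
      by (rule abs_inner_ball_integral[OF r])
    also have "emeasure lborel (ball (0::real^'n) r) = ennreal V" using fin by (simp add: V_def emeasure_eq_ennreal_measure)
    also have "ennreal (r * (linear_osc CARD('n) * norm v)) * ennreal V = ennreal (r * (linear_osc CARD('n) * norm v) * V)"
      using pos V by (simp add: ennreal_mult)
    finally show ?thesis using pos V by (subst (asm) ennreal_inj) auto
  qed
  have i1: "integrable lborel (\<lambda>u. ?I u * (\<rho> u - m))" using i\<rho> iI by (simp add: right_diff_distrib)
  have i1': "integrable lborel (\<lambda>u. ?I u * \<bar>\<rho> u - m\<bar>)" using integrable_abs[OF i1] by (simp add: abs_mult)
  have i2: "integrable lborel (\<lambda>u. ?I u * \<bar>v \<bullet> u + (\<rho> u - m)\<bar>)"
    using integrable_abs[OF Bochner_Integration.integrable_add[OF iv i1]] by (simp add: abs_mult flip: distrib_left)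
  have "\<bar>mean_oscillation f (a, r) - r * (linear_osc CARD('n) * norm v)\<bar> * V
      = \<bar>mean_oscillation f (a, r) * V - r * (linear_osc CARD('n) * norm v) * V\<bar>"
    using V by (simp add: abs_mult flip: left_diff_distrib)
  also have "\<dots> = \<bar>LINT u|lborel. ?I u * \<bar>v \<bullet> u + (\<rho> u - m)\<bar> - ?I u * \<bar>v \<bullet> u\<bar>\<bar>"
    unfolding osc lin using i2 iabs by simp
  also have "\<dots> \<le> (LINT u|lborel. \<bar>?I u * \<bar>v \<bullet> u + (\<rho> u - m)\<bar> - ?I u * \<bar>v \<bullet> u\<bar>\<bar>)" by (rule integral_abs_bound)
  also have "\<dots> \<le> (LINT u|lborel. ?I u * \<bar>\<rho> u\<bar> + \<bar>m\<bar> * ?I u)"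
    using i2 iabs ia iI by (intro integral_mono) (auto simp: indicator_def)
  also have "\<dots> = R + \<bar>m\<bar> * V" using ia iI by (simp add: R_def V_def)
  also have "\<dots> \<le> 2 * R" using mV by simp
  finally show "\<bar>mean_oscillation f (a, r) - r * (linear_osc CARD('n) * norm v)\<bar> * V
     \<le> 2 * (LINT u|lborel. indicator (ball 0 r) u * \<bar>f (a + u) - f a - v \<bullet> u\<bar>)" by (simp add: R_def \<rho>_def)
qed

text \<open>Inserts the segment representation into \<open>mean_oscillation_linear\<close>; the
  factor r comes from |u| < r. Leaving v free serves two purposes: v = 0 gives the weak-type bound,
  v = g a the limit.\<close>

lemma weak_gradient_oscillation_bound:
  fixes f :: "real^'n \<Rightarrow> real"
  assumes w: "borel_weak_gradient f g"
  shows "AE a in lborel. \<forall>r>0. \<forall>v. ennreal \<bar>mean_oscillation f (a, r) - r * (linear_osc CARD('n) * norm v)\<bar> * emeasure lborel (ball (0::real^'n) r)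
     \<le> ennreal (2 * r) * (\<integral>\<^sup>+u\<in>ball 0 r. (\<integral>\<^sup>+t\<in>{0..1}. norm (g (a + t *\<^sub>R u) - v) \<partial>lborel) \<partial>lborel)"
proof -
  have f: "borel_loc_int f" and g: "borel_loc_int g" using w by (auto simp: borel_weak_gradient_def)
  have [measurable]: "f \<in> borel_measurable borel" "g \<in> borel_measurable borel" using f g by (auto intro: borel_loc_int_measurable)
  let ?P = "\<lambda>a u. f (a + u) - f a = (LINT t|lborel. indicator {0..1} t * (g (a + t *\<^sub>R u) \<bullet> u))"
  have "AE u in lborel. AE a in lborel. ?P a u"
    by (rule AE_I2) (rule borel_weak_gradient_segment[OF w])
  \<comment> \<open>The null set of a provided for each u is turned by Tonelli's theorem into one
    null set of a, which depends neither on r nor on v.\<close>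
  then have "AE a in lborel. AE u in lborel. ?P a u"
    by (subst lborel_pair.AE_commute) measurable
  then show ?thesis
  proof eventually_elim
    case (elim a)
    show ?case
    proof (intro allI impI)
      fix r :: real and v :: "real^'n" assume r: "r > 0"
      let ?V = "emeasure lborel (ball (0::real^'n) r)"
      have "?V < \<infinity>" by (rule emeasure_bounded_finite) simp
      then have V: "?V = ennreal (measure lborel (ball (0::real^'n) r))" by (simp add: emeasure_eq_ennreal_measure)
      have "ennreal \<bar>mean_oscillation f (a, r) - r * (linear_osc CARD('n) * norm v)\<bar> * ?V =
        ennreal (\<bar>mean_oscillation f (a, r) - r * (linear_osc CARD('n) * norm v)\<bar> * measure lborel (ball (0::real^'n) r))"
        unfolding V by (simp add: ennreal_mult)
      also have "\<dots> \<le> ennreal (2 * (LINT u|lborel. indicator (ball 0 r) u * \<bar>f (a + u) - f a - v \<bullet> u\<bar>))"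
        by (rule ennreal_leI) (rule mean_oscillation_linear(1)[OF f r])
      also have "\<dots> = 2 * ennreal (LINT u|lborel. indicator (ball 0 r) u * \<bar>f (a + u) - f a - v \<bullet> u\<bar>)"
        by (simp add: ennreal_mult')
      also have "\<dots> = 2 * (\<integral>\<^sup>+u. indicator (ball 0 r) u * \<bar>f (a + u) - f a - v \<bullet> u\<bar> \<partial>lborel)"
        by (subst nn_integral_eq_integral[OF mean_oscillation_linear(2)[OF f r]]) auto
      also have "\<dots> \<le> 2 * (\<integral>\<^sup>+u. ennreal r * ((\<integral>\<^sup>+t\<in>{0..1}. norm (g (a + t *\<^sub>R u) - v) \<partial>lborel) * indicator (ball 0 r) u) \<partial>lborel)"
      proof (intro mult_left_mono nn_integral_mono_AE)
        show "AE u in lborel. ennreal (indicator (ball 0 r) u * \<bar>f (a + u) - f a - v \<bullet> u\<bar>) \<le>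
          ennreal r * ((\<integral>\<^sup>+t\<in>{0..1}. norm (g (a + t *\<^sub>R u) - v) \<partial>lborel) * indicator (ball 0 r) u)"
          using elim
        proof eventually_elim
          case (elim u)
          show ?case
          proof (cases "norm u < r")
            case True
            let ?J = "\<integral>\<^sup>+t\<in>{0..1}. norm (g (a + t *\<^sub>R u) - v) \<partial>lborel"
            have "ennreal \<bar>f (a + u) - f a - v \<bullet> u\<bar> \<le> ennreal r * ?J"
            \<comment> \<open>A finite integral makes g integrable along the segment, so that v can
              be split off; otherwise the right-hand side is infinite.\<close>
            proof (cases "?J < \<infinity>")
              case fin: True
              have J: "?J = (\<integral>\<^sup>+t. norm (indicator {0..1} t *\<^sub>R (g (a + t *\<^sub>R u) - v)) \<partial>lborel)"
                by (intro nn_integral_cong) (auto split: split_indicator)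
              have i: "integrable lborel (\<lambda>t. indicator {0..1} t *\<^sub>R (g (a + t *\<^sub>R u) - v))"
                using fin unfolding J by (intro integrableI_bounded) auto
              have i1: "integrable lborel (\<lambda>t. indicator {0..1::real} t *\<^sub>R v)"
                by (intro integrable_scaleR_left) (simp add: integrable_indicator_iff)
              have i2: "integrable lborel (\<lambda>t. indicator {0..1} t *\<^sub>R g (a + t *\<^sub>R u))"
                using Bochner_Integration.integrable_add[OF i i1] by (simp add: scaleR_diff_right)
              have "f (a + u) - f a = (LINT t|lborel. (indicator {0..1} t *\<^sub>R g (a + t *\<^sub>R u)) \<bullet> u)" using elim by simp
              also have "\<dots> = (LINT t|lborel. indicator {0..1} t *\<^sub>R g (a + t *\<^sub>R u)) \<bullet> u"
                using i2 by (rule integral_inner_left)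
              also have "(LINT t|lborel. indicator {0..1} t *\<^sub>R g (a + t *\<^sub>R u)) = (LINT t|lborel. indicator {0..1} t *\<^sub>R (g (a + t *\<^sub>R u) - v)) + v"
                using i1 i2 by (simp add: scaleR_diff_right)
              finally have eq: "f (a + u) - f a - v \<bullet> u = (LINT t|lborel. indicator {0..1} t *\<^sub>R (g (a + t *\<^sub>R u) - v)) \<bullet> u"
                by (simp add: inner_add_left)
              have "\<bar>f (a + u) - f a - v \<bullet> u\<bar> \<le> norm (LINT t|lborel. indicator {0..1} t *\<^sub>R (g (a + t *\<^sub>R u) - v)) * r"
                unfolding eq by (rule order_trans[OF Cauchy_Schwarz_ineq2]) (use True in \<open>auto intro: mult_left_mono\<close>)
              then have "ennreal \<bar>f (a + u) - f a - v \<bullet> u\<bar> \<le> ennreal r * ennreal (norm (LINT t|lborel. indicator {0..1} t *\<^sub>R (g (a + t *\<^sub>R u) - v)))"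
                using r by (simp add: mult.commute ennreal_leI flip: ennreal_mult)
              also have "\<dots> \<le> ennreal r * ?J"
                unfolding J by (intro mult_left_mono integral_norm_bound_ennreal i) simp
              finally show ?thesis .
            next
              case False
              then have "?J = top" by (simp add: less_top[symmetric])
              then show ?thesis using r by (simp add: ennreal_mult_top)
            qed
            then show ?thesis using True by simp
          qed simp
        qed
      qed simp
      also have "\<dots> = 2 * (ennreal r * (\<integral>\<^sup>+u\<in>ball 0 r. (\<integral>\<^sup>+t\<in>{0..1}. norm (g (a + t *\<^sub>R u) - v) \<partial>lborel) \<partial>lborel))"
        by (subst nn_integral_cmult) auto
      finally show "ennreal \<bar>mean_oscillation f (a, r) - r * (linear_osc CARD('n) * norm v)\<bar> * ?V \<le>
         ennreal (2 * r) * (\<integral>\<^sup>+u\<in>ball 0 r. (\<integral>\<^sup>+t\<in>{0..1}. norm (g (a + t *\<^sub>R u) - v) \<partial>lborel) \<partial>lborel)"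
        using r by (simp add: ennreal_mult mult.assoc)
    qed
  qed
qed

section \<open>Superlevel sets under the dilation-invariant weight\<close>

text \<open>Lets \<open>measurable\<close> treat the measure of a superlevel set as a function of a
  scale parameter.\<close>

lemma emeasure_slice_measurable [measurable (raw)]:
  assumes [measurable]: "Measurable.pred (N \<Otimes>\<^sub>M borel) (\<lambda>z. P (fst z) (snd z))"
  shows "(\<lambda>x. emeasure lborel {a::'a::euclidean_space. P x a}) \<in> borel_measurable N"
proof -
  have "(\<lambda>x. \<integral>\<^sup>+a. indicator {z \<in> space (N \<Otimes>\<^sub>M borel). P (fst z) (snd z)} (x, a) \<partial>lborel) \<in> borel_measurable N"
    by measurable
  also have "?this \<longleftrightarrow> ?thesis"
  proof (rule measurable_cong)
    fix x assume x: "x \<in> space N"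
    have "{a. P x a} = (\<lambda>a. (x, a)) -` {z \<in> space (N \<Otimes>\<^sub>M borel). P (fst z) (snd z)}"
      using x by (auto simp: space_pair_measure)
    also have "\<dots> \<in> sets lborel" using sets_Pair1[of "{z \<in> space (N \<Otimes>\<^sub>M borel). P (fst z) (snd z)}" N borel x] by simp
    finally have "{a. P x a} \<in> sets lborel" .
    then have "emeasure lborel {a. P x a} = (\<integral>\<^sup>+a. indicator {a. P x a} a \<partial>lborel)" by simp
    also have "\<dots> = (\<integral>\<^sup>+a. indicator {z \<in> space (N \<Otimes>\<^sub>M borel). P (fst z) (snd z)} (x, a) \<partial>lborel)"
      using x by (intro nn_integral_cong) (auto simp: indicator_def space_pair_measure)
    finally show "(\<integral>\<^sup>+a. indicator {z \<in> space (N \<Otimes>\<^sub>M borel). P (fst z) (snd z)} (x, a) \<partial>lborel) = emeasure lborel {a. P x a}" ..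
  qed
  finally show ?thesis .
qed

text \<open>Density of dr / r^(p+1), set to 0 for r <= 0 so that radii may range over all of
  \<open>lborel\<close>.\<close>

definition scale_weight :: "real \<Rightarrow> real \<Rightarrow> ennreal" where
  "scale_weight p s = ennreal (1 / s powr (p + 1)) * indicator {0<..} s"

lemma scale_weight_measurable [measurable]: "scale_weight p \<in> borel_measurable borel"
  unfolding scale_weight_def by measurable

text \<open>The measure dr / r^(p+1) is homogeneous of degree -p, which matches the power
  \<open>\<kappa>\<close>^p in the weak norm.\<close>

lemma nn_integral_scale_weight:
  assumes [measurable]: "H \<in> borel_measurable borel" and k: "k > 0"
  shows "ennreal (k powr p) * (\<integral>\<^sup>+r. scale_weight p r * H r \<partial>lborel) = (\<integral>\<^sup>+s. scale_weight p s * H (k * s) \<partial>lborel)"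
proof -
  have "(\<integral>\<^sup>+r. scale_weight p r * H r \<partial>lborel) = ennreal k * (\<integral>\<^sup>+s. scale_weight p (k * s) * H (k * s) \<partial>lborel)"
    using k by (subst nn_integral_real_affine[of _ k 0]) auto
  also have "(\<integral>\<^sup>+s. scale_weight p (k * s) * H (k * s) \<partial>lborel) = (\<integral>\<^sup>+s. ennreal (1 / k powr (p + 1)) * (scale_weight p s * H (k * s)) \<partial>lborel)"
  proof (rule nn_integral_cong)
    fix s
    show "scale_weight p (k * s) * H (k * s) = ennreal (1 / k powr (p + 1)) * (scale_weight p s * H (k * s))"
    proof (cases "s > 0")
      case True
      then have "1 / (k * s) powr (p + 1) = 1 / k powr (p + 1) * (1 / s powr (p + 1))" using k by (simp add: powr_mult)
      then have "ennreal (1 / (k * s) powr (p + 1)) = ennreal (1 / k powr (p + 1)) * ennreal (1 / s powr (p + 1))"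
        by (subst ennreal_mult[symmetric]) auto
      then show ?thesis using True k by (simp add: scale_weight_def mult.assoc)
    qed (use k in \<open>simp add: scale_weight_def zero_less_mult_iff\<close>)
  qed
  also have "\<dots> = ennreal (1 / k powr (p + 1)) * (\<integral>\<^sup>+s. scale_weight p s * H (k * s) \<partial>lborel)"
    by (rule nn_integral_cmult) measurable
  finally have "ennreal (k powr p) * (\<integral>\<^sup>+r. scale_weight p r * H r \<partial>lborel)
     = (ennreal (k powr p) * ennreal k * ennreal (1 / k powr (p + 1))) * (\<integral>\<^sup>+s. scale_weight p s * H (k * s) \<partial>lborel)"
    by (simp add: mult.assoc)
  also have "ennreal (k powr p) * ennreal k = ennreal (k powr p * k)" using k by (simp add: ennreal_mult)
  also have "ennreal (k powr p * k) * ennreal (1 / k powr (p + 1)) = ennreal (k powr p * k * (1 / k powr (p + 1)))"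
    using k by (intro ennreal_mult[symmetric]) auto
  also have "k powr p * k * (1 / k powr (p + 1)) = 1" using k by (simp add: powr_add)
  finally show ?thesis by simp
qed

lemma nn_integral_powr_tail:
  assumes q: "q > 1" and a: "a > 0"
  shows "(\<integral>\<^sup>+s. ennreal (s powr (- q)) * indicator {a..} s \<partial>lborel) = ennreal (a powr (1 - q) / (q - 1))"
proof -
  have "(\<integral>\<^sup>+s. ennreal (s powr (- q)) * indicator {a..} s \<partial>lborel) = ennreal (0 - (- (a powr (1 - q) / (q - 1))))"
  proof (rule nn_integral_FTC_atLeast)
    show "DERIV (\<lambda>s. - (s powr (1 - q) / (q - 1))) x :> x powr (- q)" if "a \<le> x" for x
    proof -
      have "DERIV (\<lambda>s. - (s powr (1 - q) / (q - 1))) x :> - ((1 - q) * x powr (1 - q - 1) / (q - 1))"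
        using that a q by (auto intro!: derivative_eq_intros)
      moreover have "- ((1 - q) * y / (q - 1)) = y" for y using q by (simp add: field_simps)
      ultimately show ?thesis by simp
    qed
    have "((\<lambda>s. - (s powr (1 - q) / (q - 1))) \<longlongrightarrow> - (0 / (q - 1))) at_top"
      using q by (intro tendsto_intros tendsto_neg_powr filterlim_ident) auto
    then show "((\<lambda>s. - (s powr (1 - q) / (q - 1))) \<longlongrightarrow> 0) at_top" by simp
  qed auto
  then show ?thesis by simp
qed

text \<open>Layer-cake formula in the variable s: a value c > 0 is seen by exactly the s > 1 / c.
  The factor 1 / p reappears in the limit constant.\<close>

lemma scale_weight_indicator_integral:
  assumes p: "p > 1" and c: "c \<ge> 0"
  shows "(\<integral>\<^sup>+s. scale_weight p s * indicator {s. s * c > 1} s \<partial>lborel) = ennreal (c powr p / p)"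
proof (cases "c = 0")
  case False
  with c have c: "c > 0" by simp
  have "(\<integral>\<^sup>+s. scale_weight p s * indicator {s. s * c > 1} s \<partial>lborel) = (\<integral>\<^sup>+s. scale_weight p s * indicator {1<..} (c * s) \<partial>lborel)"
    by (intro nn_integral_cong) (auto simp: indicator_def mult.commute)
  also have "\<dots> = ennreal (c powr p) * (\<integral>\<^sup>+s. scale_weight p s * indicator {1<..} s \<partial>lborel)"
    by (rule nn_integral_scale_weight[OF _ c, symmetric]) measurable
  also have "(\<integral>\<^sup>+s. scale_weight p s * indicator {1<..} s \<partial>lborel) = (\<integral>\<^sup>+s. ennreal (s powr (- (p + 1))) * indicator {1..} s \<partial>lborel)"
    by (intro nn_integral_cong_AE AE_I[of _ _ "{1}"]) (auto simp: indicator_def scale_weight_def powr_minus_divide[of _ "p + 1", simplified])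
  also have "\<dots> = ennreal (1 / p)" using nn_integral_powr_tail[of "p + 1" 1] p by simp
  finally show ?thesis using p by (simp flip: ennreal_mult)
qed simp

text \<open>\<open>ennreal\<close> truncates the excess at 0, so after scaling c to 1 only s >= 1/2
  contributes; there s^(-p-1) s has a convergent tail because p > 1.\<close>

lemma scale_weight_excess_integral:
  assumes p: "p > 1" and c: "c \<ge> 0"
  shows "(\<integral>\<^sup>+s. scale_weight p s * ennreal (s * c - 1/2) \<partial>lborel) \<le> ennreal (c powr p * ((1/2) powr (1 - p) / (p - 1)))"
proof (cases "c = 0")
  case False
  with c have c: "c > 0" by simp
  have "(\<integral>\<^sup>+s. scale_weight p s * ennreal (s * c - 1/2) \<partial>lborel) = ennreal (c powr p) * (\<integral>\<^sup>+s. scale_weight p s * ennreal (s - 1/2) \<partial>lborel)"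
    by (subst nn_integral_scale_weight[OF _ c]) (auto simp: mult.commute)
  also have "\<dots> \<le> ennreal (c powr p) * (\<integral>\<^sup>+s. ennreal (s powr (- p)) * indicator {1/2..} s \<partial>lborel)"
  proof (intro mult_left_mono nn_integral_mono)
    fix s :: real
    show "scale_weight p s * ennreal (s - 1/2) \<le> ennreal (s powr (- p)) * indicator {1/2..} s"
    proof (cases "s \<ge> 1/2")
      case True
      have "1 / s powr (p + 1) * (s - 1/2) \<le> 1 / s powr (p + 1) * s" using True by (intro mult_left_mono) auto
      also have "\<dots> = s powr (- p)" using True by (simp add: powr_add powr_minus_divide)
      finally show ?thesis using True by (simp add: scale_weight_def ennreal_leI flip: ennreal_mult)
    qed (simp add: ennreal_neg)
  qed simp
  also have "\<dots> = ennreal (c powr p * ((1/2) powr (1 - p) / (p - 1)))"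
    using p by (subst nn_integral_powr_tail) (auto simp flip: ennreal_mult)
  finally show ?thesis .
next
  case True then show ?thesis by (simp add: ennreal_neg)
qed

lemma emeasure_nu_superlevel:
  fixes F :: "(real^'n) \<times> real \<Rightarrow> real"
  assumes F: "F \<in> borel_measurable borel"
  shows "emeasure (nu p) {z \<in> space (nu p). F z > \<kappa>} = (\<integral>\<^sup>+r. scale_weight p r * emeasure lborel {a. F (a, r) > \<kappa>} \<partial>lborel)"
proof -
  have F'[measurable]: "F \<in> borel_measurable (borel \<Otimes>\<^sub>M borel)" using F by (simp add: borel_prod)
  let ?U = "UNIV \<times> {0<..} :: ((real^'n) \<times> real) set"
  have U: "?U \<in> sets (borel \<Otimes>\<^sub>M borel)" by (intro pair_measureI) auto
  then have "?U \<in> sets borel" unfolding borel_prod .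
  then have U': "?U \<inter> space lborel \<in> sets lborel" by simp
  have sp: "space (nu p) = ?U" by (simp add: nu_def space_restrict_space)
  let ?S = "{z \<in> space (nu p). F z > \<kappa>}"
  have m: "(\<lambda>(a, r). ennreal (1 / r powr (p + 1))) \<in> borel_measurable (borel :: ((real^'n) \<times> real) measure)"
    unfolding borel_prod[symmetric] by measurable
  have "?S \<in> sets (nu p)"
  proof -
    have "F \<in> borel_measurable (nu p)"
    proof -
      have "F \<in> borel_measurable lborel" using F by simp
      then have "F \<in> borel_measurable (restrict_space lborel ?U)" by (rule measurable_restrict_space1)
      then show ?thesis by (simp add: nu_def)
    qed
    then show ?thesis by measurable
  qed
  then have S: "?S \<in> sets (restrict_space lborel ?U)" by (simp add: nu_def)
  have "emeasure (nu p) ?S = (\<integral>\<^sup>+z. (case z of (a, r) \<Rightarrow> ennreal (1 / r powr (p + 1))) * indicator ?S z \<partial>restrict_space lborel ?U)"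
    unfolding nu_def using S unfolding nu_def
    by (intro emeasure_density) (auto intro!: measurable_restrict_space1 m)
  also have "\<dots> = (\<integral>\<^sup>+z. (case z of (a, r) \<Rightarrow> ennreal (1 / r powr (p + 1))) * indicator ?S z * indicator ?U z \<partial>lborel)"
    by (rule nn_integral_restrict_space[OF U'])
  also have "\<dots> = (\<integral>\<^sup>+z. scale_weight p (snd z) * indicator {z. F z > \<kappa>} z \<partial>(lborel \<Otimes>\<^sub>M lborel))"
    unfolding lborel_prod by (intro nn_integral_cong) (auto simp: sp scale_weight_def indicator_def)
  also have "\<dots> = (\<integral>\<^sup>+r. \<integral>\<^sup>+a. scale_weight p (snd (a, r)) * indicator {z. F z > \<kappa>} (a, r) \<partial>lborel \<partial>lborel)"
    by (rule lborel_pair.nn_integral_snd[symmetric]) measurable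
  also have "\<dots> = (\<integral>\<^sup>+r. scale_weight p r * emeasure lborel {a. F (a, r) > \<kappa>} \<partial>lborel)"
  proof (rule nn_integral_cong)
    fix r
    have [measurable]: "{a. F (a, r) > \<kappa>} \<in> sets borel" by measurable
    have "(\<integral>\<^sup>+a. scale_weight p (snd (a, r)) * indicator {z. F z > \<kappa>} (a, r) \<partial>lborel) = (\<integral>\<^sup>+a. scale_weight p r * indicator {a. F (a, r) > \<kappa>} a \<partial>lborel)"
      by (intro nn_integral_cong) (auto simp: indicator_def)
    then show "(\<integral>\<^sup>+a. scale_weight p (snd (a, r)) * indicator {z. F z > \<kappa>} (a, r) \<partial>lborel) = scale_weight p r * emeasure lborel {a. F (a, r) > \<kappa>}"
      by (simp add: nn_integral_cmult_indicator)
  qed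
  finally show ?thesis .
qed

lemma mean_oscillation_borel_measurable:
  fixes f :: "real^'n \<Rightarrow> real"
  assumes "f \<in> borel_measurable borel" shows "mean_oscillation f \<in> borel_measurable borel"
proof -
  have "(\<lambda>z::(real^'n) \<times> real. mean_oscillation f (fst z, snd z)) \<in> borel_measurable (borel \<Otimes>\<^sub>M borel)"
    by (rule mean_oscillation_measurable[OF assms]) measurable
  then show ?thesis by (simp add: borel_prod)
qed

lemma mean_oscillation_superlevel_scaled:
  fixes f :: "real^'n \<Rightarrow> real"
  assumes [measurable]: "f \<in> borel_measurable borel" and k: "\<kappa> > 0"
  shows "ennreal (\<kappa> powr p) * emeasure (nu p) {z \<in> space (nu p). mean_oscillation f z > \<kappa>} =
     (\<integral>\<^sup>+s. scale_weight p s * emeasure lborel {a. mean_oscillation f (a, \<kappa> * s) > \<kappa>} \<partial>lborel)"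
  unfolding emeasure_nu_superlevel[OF mean_oscillation_borel_measurable[OF assms(1)]]
  by (rule nn_integral_scale_weight[OF _ k]) measurable

text \<open>Integrating in a first removes every shift by translation invariance, so averaging along
  segments preserves the integral.\<close>

lemma segment_average_integral:
  fixes h :: "real^'n \<Rightarrow> ennreal"
  assumes [measurable]: "h \<in> borel_measurable borel"
  shows "(\<integral>\<^sup>+a. (\<integral>\<^sup>+u\<in>ball 0 r. (\<integral>\<^sup>+t\<in>{0..1}. h (a + t *\<^sub>R u) \<partial>lborel) \<partial>lborel) \<partial>lborel) = emeasure lborel (ball (0::real^'n) r) * (\<integral>\<^sup>+a. h a \<partial>lborel)"
proof -
  have "(\<integral>\<^sup>+a. (\<integral>\<^sup>+u\<in>ball 0 r. (\<integral>\<^sup>+t\<in>{0..1}. h (a + t *\<^sub>R u) \<partial>lborel) \<partial>lborel) \<partial>lborel)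
     = (\<integral>\<^sup>+u. (\<integral>\<^sup>+a. (\<integral>\<^sup>+t\<in>{0..1}. h (a + t *\<^sub>R u) \<partial>lborel) * indicator (ball 0 r) u \<partial>lborel) \<partial>lborel)"
    by (rule lborel_pair.Fubini') measurable
  also have "\<dots> = (\<integral>\<^sup>+u. (\<integral>\<^sup>+a. h a \<partial>lborel) * indicator (ball (0::real^'n) r) u \<partial>lborel)"
  proof (rule nn_integral_cong)
    fix u :: "real^'n"
    have "(\<integral>\<^sup>+a. (\<integral>\<^sup>+t\<in>{0..1}. h (a + t *\<^sub>R u) \<partial>lborel) \<partial>lborel) = (\<integral>\<^sup>+t. (\<integral>\<^sup>+a. h (a + t *\<^sub>R u) * indicator {0..1} t \<partial>lborel) \<partial>lborel)"
      by (rule lborel_pair.Fubini') measurable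
    also have "\<dots> = (\<integral>\<^sup>+t. (\<integral>\<^sup>+a. h a \<partial>lborel) * indicator {0..1::real} t \<partial>lborel)"
      by (intro nn_integral_cong) (simp add: nn_integral_multc lborel_nn_integral_translate[where F=h])
    also have "\<dots> = (\<integral>\<^sup>+a. h a \<partial>lborel)" by (simp add: nn_integral_cmult_indicator)
    finally show "(\<integral>\<^sup>+a. (\<integral>\<^sup>+t\<in>{0..1}. h (a + t *\<^sub>R u) \<partial>lborel) * indicator (ball 0 r) u \<partial>lborel) = (\<integral>\<^sup>+a. h a \<partial>lborel) * indicator (ball 0 r) u"
      by (simp add: nn_integral_multc)
  qed
  also have "\<dots> = emeasure lborel (ball (0::real^'n) r) * (\<integral>\<^sup>+a. h a \<partial>lborel)"
    by (simp add: nn_integral_cmult_indicator mult.commute)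
  finally show ?thesis .
qed

text \<open>The same exchange of integrals, with the modulus of continuity of translations in place
  of invariance; |t u| < r keeps every shift within its range.\<close>

lemma segment_translation_integral:
  fixes g :: "real^'n \<Rightarrow> real^'n"
  assumes [measurable]: "g \<in> borel_measurable borel"
    and w: "\<And>w. norm w < r \<Longrightarrow> (\<integral>\<^sup>+a. norm (g (a + w) - g a) \<partial>lborel) \<le> e"
  shows "(\<integral>\<^sup>+a. (\<integral>\<^sup>+u\<in>ball 0 r. (\<integral>\<^sup>+t\<in>{0..1}. norm (g (a + t *\<^sub>R u) - g a) \<partial>lborel) \<partial>lborel) \<partial>lborel) \<le> emeasure lborel (ball (0::real^'n) r) * e"
proof -
  have "(\<integral>\<^sup>+a. (\<integral>\<^sup>+u\<in>ball 0 r. (\<integral>\<^sup>+t\<in>{0..1}. norm (g (a + t *\<^sub>R u) - g a) \<partial>lborel) \<partial>lborel) \<partial>lborel)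
     = (\<integral>\<^sup>+u. (\<integral>\<^sup>+a. (\<integral>\<^sup>+t\<in>{0..1}. norm (g (a + t *\<^sub>R u) - g a) \<partial>lborel) * indicator (ball 0 r) u \<partial>lborel) \<partial>lborel)"
    by (rule lborel_pair.Fubini') measurable
  also have "\<dots> \<le> (\<integral>\<^sup>+u. e * indicator (ball (0::real^'n) r) u \<partial>lborel)"
  proof (rule nn_integral_mono)
    fix u :: "real^'n"
    show "(\<integral>\<^sup>+a. (\<integral>\<^sup>+t\<in>{0..1}. norm (g (a + t *\<^sub>R u) - g a) \<partial>lborel) * indicator (ball 0 r) u \<partial>lborel) \<le> e * indicator (ball 0 r) u"
    proof (cases "norm u < r")
      case True
      have "(\<integral>\<^sup>+a. (\<integral>\<^sup>+t\<in>{0..1}. norm (g (a + t *\<^sub>R u) - g a) \<partial>lborel) \<partial>lborel) = (\<integral>\<^sup>+t. (\<integral>\<^sup>+a. norm (g (a + t *\<^sub>R u) - g a) * indicator {0..1} t \<partial>lborel) \<partial>lborel)"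
        by (subst lborel_pair.Fubini') (auto simp: ennreal_mult ennreal_indicator)
      also have "\<dots> \<le> (\<integral>\<^sup>+t. e * indicator {0..1::real} t \<partial>lborel)"
      proof (rule nn_integral_mono)
        fix t :: real
        show "(\<integral>\<^sup>+a. norm (g (a + t *\<^sub>R u) - g a) * indicator {0..1} t \<partial>lborel) \<le> e * indicator {0..1} t"
        proof (cases "t \<in> {0..1}")
          case t: True
          then have "norm (t *\<^sub>R u) < r" using True by (simp add: mult_left_le_one_le order.strict_trans1[of _ "norm u"])
          from w[OF this] show ?thesis using t by simp
        qed simp
      qed
      also have "\<dots> = e" by (simp add: nn_integral_cmult_indicator)
      finally show ?thesis using True by simp
    qed simp
  qed
  also have "\<dots> = emeasure lborel (ball (0::real^'n) r) * e" by (simp add: nn_integral_cmult_indicator mult.commute)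
  finally show ?thesis .
qed

section \<open>The weak-type upper bound\<close>

text \<open>The case v = 0 of the oscillation estimate, integrated in a. The bound depends on r and
  \<open>\<kappa>\<close> only through r / \<open>\<kappa>\<close>.\<close>

lemma superlevel_measure_bound:
  fixes f :: "real^'n \<Rightarrow> real"
  assumes w: "borel_weak_gradient f g" and r: "r > 0" and k: "\<kappa> > 0"
  shows "emeasure lborel {a. mean_oscillation f (a, r) > \<kappa>} \<le> 2 * (\<integral>\<^sup>+a. ennreal (r / \<kappa> * (2 * norm (g a)) - 1/2) \<partial>lborel)"
proof -
  have [measurable]: "f \<in> borel_measurable borel" "g \<in> borel_measurable borel"
    using w by (auto simp: borel_weak_gradient_def intro: borel_loc_int_measurable)
  let ?V = "emeasure lborel (ball (0::real^'n) r)"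
  let ?z = "\<lambda>a. r / \<kappa> * (2 * norm (g a))"
  let ?Q = "\<lambda>h a. (\<integral>\<^sup>+u\<in>ball (0::real^'n) r. (\<integral>\<^sup>+t\<in>{0..1}. h (a + t *\<^sub>R u) \<partial>lborel) \<partial>lborel) :: ennreal"
  have V: "?V \<noteq> 0" "?V \<noteq> top" using measure_ball_pos[OF r, of "0::real^'n"] emeasure_bounded_finite[of "ball (0::real^'n) r"]
    by (auto simp: measure_def)
  have "AE a in lborel. indicator {a. mean_oscillation f (a, r) > \<kappa>} a * ?V \<le> 2 * ?Q (\<lambda>a. ennreal (?z a - 1/2)) a"
    using weak_gradient_oscillation_bound[OF w]
  proof eventually_elim
    case (elim a)
    \<comment> \<open>with \<open>z = 2 r |g| / \<kappa>\<close>, a mean of \<open>z\<close> above 1 forces a mean of the excess of \<open>z\<close> over 1/2 above 1/2\<close>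
    have b: "ennreal (mean_oscillation f (a, r)) * ?V \<le> ennreal (2 * r) * ?Q (\<lambda>x. norm (g x)) a"
      using elim[rule_format, OF r, of 0] mean_oscillation_nonneg[of f "(a, r)"] by simp
    show ?case
    proof (cases "mean_oscillation f (a, r) > \<kappa>")
      case True
      have "ennreal \<kappa> * ?V \<le> ennreal (mean_oscillation f (a, r)) * ?V" using True by (intro mult_right_mono ennreal_leI) auto
      also note b
      finally have "ennreal (1 / \<kappa>) * (ennreal \<kappa> * ?V) \<le> ennreal (1 / \<kappa>) * (ennreal (2 * r) * ?Q (\<lambda>x. norm (g x)) a)"
        by (rule mult_left_mono) simp
      moreover have "ennreal (1 / \<kappa>) * (ennreal \<kappa> * ?V) = ?V"
        using k by (simp add: mult.assoc[symmetric] ennreal_mult[symmetric])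
      moreover have "ennreal (1 / \<kappa>) * (ennreal (2 * r) * ?Q (\<lambda>x. norm (g x)) a) = ?Q (\<lambda>x. ennreal (?z x)) a"
      proof -
        have c: "ennreal (?z x) = ennreal (2 * r / \<kappa>) * ennreal (norm (g x))" for x
          using r k by (simp add: ennreal_mult[symmetric] mult_ac)
        have "?Q (\<lambda>x. ennreal (?z x)) a = ennreal (2 * r / \<kappa>) * ?Q (\<lambda>x. norm (g x)) a"
          unfolding c mult.assoc by (simp add: nn_integral_cmult mult.assoc)
        moreover have "ennreal (1 / \<kappa>) * ennreal (2 * r) = ennreal (2 * r / \<kappa>)" using r k by (simp add: ennreal_mult[symmetric])
        ultimately show ?thesis by (simp add: mult.assoc[symmetric])
      qed
      ultimately have "?V \<le> ?Q (\<lambda>x. ennreal (?z x)) a" by simp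
      also have "\<dots> \<le> (\<integral>\<^sup>+u\<in>ball (0::real^'n) r. (\<integral>\<^sup>+t\<in>{0..1}. ennreal (1/2) + ennreal (?z (a + t *\<^sub>R u) - 1/2) \<partial>lborel) \<partial>lborel)"
      proof (intro nn_integral_mono mult_right_mono)
        fix u t
        have "ennreal (?z (a + t *\<^sub>R u)) \<le> ennreal (1/2 + max 0 (?z (a + t *\<^sub>R u) - 1/2))" by (intro ennreal_leI) simp
        also have "\<dots> = ennreal (1/2) + ennreal (?z (a + t *\<^sub>R u) - 1/2)" by (subst ennreal_plus) (auto simp: ennreal_max_0)
        finally show "ennreal (?z (a + t *\<^sub>R u)) \<le> ennreal (1/2) + ennreal (?z (a + t *\<^sub>R u) - 1/2)" .
      qed auto
      also have "\<dots> = (\<integral>\<^sup>+u\<in>ball (0::real^'n) r. (ennreal (1/2) + (\<integral>\<^sup>+t\<in>{0..1}. ennreal (?z (a + t *\<^sub>R u) - 1/2) \<partial>lborel)) \<partial>lborel)"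
        by (subst distrib_right, subst nn_integral_add) (auto simp: nn_integral_cmult_indicator)
      also have "\<dots> = ennreal (1/2) * ?V + ?Q (\<lambda>a. ennreal (?z a - 1/2)) a"
        by (subst distrib_right, subst nn_integral_add) (auto simp: nn_integral_cmult_indicator)
      \<comment> \<open>Doubling turns the half of V into a full V, which cancels because V is
        finite.\<close>
      finally have "2 * ?V \<le> 2 * (ennreal (1/2) * ?V + ?Q (\<lambda>a. ennreal (?z a - 1/2)) a)" by (rule mult_left_mono) simp
      also have "\<dots> = ?V + 2 * ?Q (\<lambda>a. ennreal (?z a - 1/2)) a"
      proof -
        have "(2::ennreal) * ennreal (1/2) = ennreal (2 * (1/2))" by (metis ennreal_mult' ennreal_numeral zero_le_numeral)
        then have "2 * (ennreal (1/2) * ?V) = ?V" unfolding mult.assoc[symmetric] by simp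
        then show ?thesis by (simp only: distrib_left)
      qed
      finally have "?V + ?V \<le> ?V + 2 * ?Q (\<lambda>a. ennreal (?z a - 1/2)) a" by (simp only: mult_2[of ?V])
      then have "?V \<le> 2 * ?Q (\<lambda>a. ennreal (?z a - 1/2)) a" using V by (simp add: ennreal_add_left_cancel_le)
      then show ?thesis using True by simp
    qed simp
  qed
  then have "(\<integral>\<^sup>+a. indicator {a. mean_oscillation f (a, r) > \<kappa>} a * ?V \<partial>lborel) \<le> (\<integral>\<^sup>+a. 2 * ?Q (\<lambda>a. ennreal (?z a - 1/2)) a \<partial>lborel)"
    by (rule nn_integral_mono_AE)
  also have "\<dots> = 2 * (\<integral>\<^sup>+a. ?Q (\<lambda>a. ennreal (?z a - 1/2)) a \<partial>lborel)"
    by (rule nn_integral_cmult) measurable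
  also have "\<dots> = 2 * (?V * (\<integral>\<^sup>+a. ennreal (?z a - 1/2) \<partial>lborel))"
    by (subst segment_average_integral[where h="\<lambda>a. ennreal (?z a - 1/2)"]) auto
  also have "(\<integral>\<^sup>+a. indicator {a. mean_oscillation f (a, r) > \<kappa>} a * ?V \<partial>lborel) = ?V * emeasure lborel {a. mean_oscillation f (a, r) > \<kappa>}"
    by (subst nn_integral_multc) (auto simp: mult.commute)
  finally have "?V * emeasure lborel {a. mean_oscillation f (a, r) > \<kappa>} \<le> ?V * (2 * (\<integral>\<^sup>+a. ennreal (?z a - 1/2) \<partial>lborel))"
    by (simp only: mult.left_commute)
  then show ?thesis using V by (simp add: ennreal_mult_le_mult_iff)
qed

text \<open>The leading 2 is the factor in \<open>superlevel_measure_bound\<close>,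
  \<open>2 powr p\<close> comes from \<open>2 * norm (g a)\<close>, and the rest from
  \<open>scale_weight_excess_integral\<close>.\<close>

definition upper_constant :: "real \<Rightarrow> real" where
  "upper_constant p = 2 * 2 powr p * ((1/2) powr (1 - p) / (p - 1))"

lemma excess_integral_bound:
  fixes g :: "real^'n \<Rightarrow> real^'n"
  assumes [measurable]: "g \<in> borel_measurable borel" and p: "p > 1"
  shows "(\<integral>\<^sup>+s. scale_weight p s * (2 * (\<integral>\<^sup>+a. ennreal (s * (2 * norm (g a)) - 1/2) \<partial>lborel)) \<partial>lborel)
     \<le> ennreal (upper_constant p) * (\<integral>\<^sup>+a. norm (g a) powr p \<partial>lborel)"
proof -
  have "(\<integral>\<^sup>+s. scale_weight p s * (2 * (\<integral>\<^sup>+a. ennreal (s * (2 * norm (g a)) - 1/2) \<partial>lborel)) \<partial>lborel)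
     = (\<integral>\<^sup>+s. (\<integral>\<^sup>+a. 2 * (scale_weight p s * ennreal (s * (2 * norm (g a)) - 1/2)) \<partial>lborel) \<partial>lborel)"
    by (intro nn_integral_cong) (simp add: nn_integral_cmult mult.left_commute)
  also have "\<dots> = (\<integral>\<^sup>+a. (\<integral>\<^sup>+s. 2 * (scale_weight p s * ennreal (s * (2 * norm (g a)) - 1/2)) \<partial>lborel) \<partial>lborel)"
    by (rule lborel_pair.Fubini') measurable
  also have "\<dots> \<le> (\<integral>\<^sup>+a. ennreal (upper_constant p) * ennreal (norm (g a) powr p) \<partial>lborel)"
  proof (rule nn_integral_mono)
    fix a
    have "(\<integral>\<^sup>+s. 2 * (scale_weight p s * ennreal (s * (2 * norm (g a)) - 1/2)) \<partial>lborel) = 2 * (\<integral>\<^sup>+s. scale_weight p s * ennreal (s * (2 * norm (g a)) - 1/2) \<partial>lborel)"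
      by (rule nn_integral_cmult) measurable
    also have "\<dots> \<le> 2 * ennreal ((2 * norm (g a)) powr p * ((1/2) powr (1 - p) / (p - 1)))"
      by (intro mult_left_mono scale_weight_excess_integral p) auto
    also have "\<dots> = ennreal (2 * ((2 * norm (g a)) powr p * ((1/2) powr (1 - p) / (p - 1))))"
      by (metis ennreal_mult' ennreal_numeral zero_le_numeral)
    also have "2 * ((2 * norm (g a)) powr p * ((1/2) powr (1 - p) / (p - 1))) = upper_constant p * norm (g a) powr p"
      by (simp add: upper_constant_def powr_mult)
    also have "ennreal \<dots> = ennreal (upper_constant p) * ennreal (norm (g a) powr p)"
      using p by (intro ennreal_mult) (auto simp: upper_constant_def)
    finally show "(\<integral>\<^sup>+s. 2 * (scale_weight p s * ennreal (s * (2 * norm (g a)) - 1/2)) \<partial>lborel) \<le> ennreal (upper_constant p) * ennreal (norm (g a) powr p)" .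
  qed
  also have "\<dots> = ennreal (upper_constant p) * (\<integral>\<^sup>+a. norm (g a) powr p \<partial>lborel)"
    by (rule nn_integral_cmult) measurable
  finally show ?thesis .
qed

lemma superlevel_upper_bound:
  fixes f :: "real^'n \<Rightarrow> real"
  assumes w: "borel_weak_gradient f g" and p: "p > 1" and k: "\<kappa> > 0"
  shows "ennreal (\<kappa> powr p) * emeasure (nu p) {z \<in> space (nu p). mean_oscillation f z > \<kappa>}
    \<le> ennreal (upper_constant p) * (\<integral>\<^sup>+a. norm (g a) powr p \<partial>lborel)"
proof -
  have [measurable]: "f \<in> borel_measurable borel" "g \<in> borel_measurable borel"
    using w by (auto simp: borel_weak_gradient_def intro: borel_loc_int_measurable)
  have "ennreal (\<kappa> powr p) * emeasure (nu p) {z \<in> space (nu p). mean_oscillation f z > \<kappa>} =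
     (\<integral>\<^sup>+s. scale_weight p s * emeasure lborel {a. mean_oscillation f (a, \<kappa> * s) > \<kappa>} \<partial>lborel)"
    by (rule mean_oscillation_superlevel_scaled[OF _ k]) measurable
  also have "\<dots> \<le> (\<integral>\<^sup>+s. scale_weight p s * (2 * (\<integral>\<^sup>+a. ennreal (s * (2 * norm (g a)) - 1/2) \<partial>lborel)) \<partial>lborel)"
  proof (rule nn_integral_mono)
    fix s :: real
    show "scale_weight p s * emeasure lborel {a. mean_oscillation f (a, \<kappa> * s) > \<kappa>} \<le> scale_weight p s * (2 * (\<integral>\<^sup>+a. ennreal (s * (2 * norm (g a)) - 1/2) \<partial>lborel))"
    proof (cases "s > 0")
      case True
      with k superlevel_measure_bound[OF w, of "\<kappa> * s" \<kappa>] show ?thesis by (intro mult_left_mono) auto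
    qed (simp add: scale_weight_def)
  qed
  also have "\<dots> \<le> ennreal (upper_constant p) * (\<integral>\<^sup>+a. norm (g a) powr p \<partial>lborel)"
    by (rule excess_integral_bound[OF _ p]) measurable
  finally show ?thesis .
qed

section \<open>The limit of the rescaled superlevel sets\<close>

text \<open>Additive form of convergence, suited to measures of sets that differ by small
  exceptional sets.\<close>

lemma ennreal_tendstoI:
  fixes a :: "nat \<Rightarrow> ennreal"
  assumes b: "b < \<infinity>" and ab: "\<And>e::real. e > 0 \<Longrightarrow> eventually (\<lambda>n. a n \<le> b + ennreal e \<and> b \<le> a n + ennreal e) sequentially"
  shows "a \<longlonglongrightarrow> b"
proof (rule order_tendstoI)
  obtain B where B: "b = ennreal B" "B \<ge> 0" using b by (cases b) auto
  fix l assume "l < b"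
  then obtain v where v: "l < v" "v < b" using dense by blast
  then obtain v' where v': "v = ennreal v'" "v' \<ge> 0" using b by (cases v) auto
  have "v' < B" using v v' B by (simp add: ennreal_less_iff)
  then have "eventually (\<lambda>n. b \<le> a n + ennreal (B - v')) sequentially" using ab[of "B - v'"] by (auto elim: eventually_mono)
  then show "eventually (\<lambda>n. l < a n) sequentially"
  proof eventually_elim
    case (elim n)
    have "v + ennreal (B - v') = b" using v' B \<open>v' < B\<close> by (simp flip: ennreal_plus)
    with elim have "v + ennreal (B - v') \<le> a n + ennreal (B - v')" by simp
    then have "v \<le> a n" by (simp add: add.commute[of _ "ennreal (B - v')"] ennreal_add_left_cancel_le)
    with v show ?case by simp
  qed
next
  obtain B where B: "b = ennreal B" "B \<ge> 0" using b by (cases b) auto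
  fix u assume "b < u"
  then obtain v where v: "b < v" "v < u" using dense by blast
  then obtain v' where v': "v = ennreal v'" "v' \<ge> 0" by (cases v) auto
  have "B < v'" using v v' B by (simp add: ennreal_less_iff)
  then have "eventually (\<lambda>n. a n \<le> b + ennreal (v' - B)) sequentially" using ab[of "v' - B"] by (auto elim: eventually_mono)
  then show "eventually (\<lambda>n. a n < u) sequentially"
  proof eventually_elim
    case (elim n)
    have "b + ennreal (v' - B) = v" using v' B \<open>B < v'\<close> by (simp flip: ennreal_plus)
    with elim v show ?case by simp
  qed
qed

text \<open>Above the height \<open>\<tau>\<close>, |g| is at most \<open>\<tau>\<close>^(1-p)
  |g|^p.\<close>

lemma Lp_truncation_integrable:
  fixes g :: "real^'n \<Rightarrow> real^'n"
  assumes [measurable]: "g \<in> borel_measurable borel" and p: "p > 1" and I: "(\<integral>\<^sup>+a. norm (g a) powr p \<partial>lborel) < \<infinity>" and t: "\<tau> > 0"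
  shows "integrable lborel (\<lambda>a. if norm (g a) > \<tau> then g a else 0)"
proof (rule integrableI_bounded)
  have "(\<integral>\<^sup>+a. norm (if norm (g a) > \<tau> then g a else 0) \<partial>lborel) \<le> (\<integral>\<^sup>+a. ennreal (\<tau> powr (1 - p)) * ennreal (norm (g a) powr p) \<partial>lborel)"
  proof (rule nn_integral_mono)
    fix a
    show "ennreal (norm (if norm (g a) > \<tau> then g a else 0)) \<le> ennreal (\<tau> powr (1 - p)) * ennreal (norm (g a) powr p)"
    proof (cases "norm (g a) > \<tau>")
      case True
      have "norm (g a) = norm (g a) powr (1 - p) * norm (g a) powr p" using True t by (simp flip: powr_add)
      also have "\<dots> \<le> \<tau> powr (1 - p) * norm (g a) powr p" using True t p by (intro mult_right_mono powr_mono2') auto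
      finally show ?thesis using True by (simp add: ennreal_leI flip: ennreal_mult)
    qed simp
  qed
  also have "\<dots> < \<infinity>" using I by (simp add: nn_integral_cmult ennreal_mult_less_top)
  finally show "(\<integral>\<^sup>+a. norm (if norm (g a) > \<tau> then g a else 0) \<partial>lborel) < \<infinity>" .
qed measurable

text \<open>Below the height \<open>\<tau>\<close> the gradient contributes at most \<open>\<delta> / 2\<close>; above it, it is integrable, so that
  continuity of translations in \<open>L\<^sup>1\<close> applies.\<close>

lemma oscillation_in_measure:
  fixes f :: "real^'n \<Rightarrow> real"
  assumes w: "borel_weak_gradient f g" and p: "p > 1" and I: "(\<integral>\<^sup>+a. norm (g a) powr p \<partial>lborel) < \<infinity>"
    and s: "s > 0" and X: "X \<longlonglongrightarrow> 0" "\<And>n::nat. X n > 0" and d: "\<delta> > 0" and e: "e > 0"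
  shows "eventually (\<lambda>n. emeasure lborel {a. \<bar>mean_oscillation f (a, X n * s) - X n * (s * (linear_osc CARD('n) * norm (g a)))\<bar> > \<delta> * X n} \<le> ennreal e) sequentially"
proof -
  have [measurable]: "f \<in> borel_measurable borel" "g \<in> borel_measurable borel"
    using w by (auto simp: borel_weak_gradient_def intro: borel_loc_int_measurable)
  \<comment> \<open>With r = X n s, the part of g below this height contributes 2 r (2
    \<open>\<tau>\<close>) = \<open>\<delta>\<close> X n / 2, half of the threshold.\<close>
  define \<tau> where "\<tau> = \<delta> / (8 * s)"
  have t: "\<tau> > 0" using s d by (simp add: \<tau>_def)
  define g' where "g' = (\<lambda>a. if norm (g a) > \<tau> then g a else 0)"
  have [measurable]: "g' \<in> borel_measurable borel" unfolding g'_def by measurable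
  \<comment> \<open>Cancels the factor 4 s / \<open>\<delta>\<close> that Chebyshev's inequality
    produces below.\<close>
  define e' where "e' = e * \<delta> / (4 * s)"
  have e': "e' > 0" using e d s by (simp add: e'_def)
  obtain \<eta> where \<eta>: "\<eta> > 0" "\<And>w. norm w < \<eta> \<Longrightarrow> (\<integral>\<^sup>+a. norm (g' (a + w) - g' a) \<partial>lborel) < ennreal e'"
  proof -
    have "integrable lborel g'" unfolding g'_def by (rule Lp_truncation_integrable[OF _ p I t]) measurable
    then show thesis using e'
    proof (rule L1_translation)
      fix d assume "d > 0" "\<And>u. norm u < d \<Longrightarrow> (\<integral>\<^sup>+a. norm (g' (a + u) - g' a) \<partial>lborel) < ennreal e'"
      then show thesis by (rule that)
    qed
  qed
  have "(\<lambda>n. X n * s) \<longlonglongrightarrow> 0 * s" by (intro tendsto_mult X tendsto_const)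
  then have "eventually (\<lambda>n. X n * s < \<eta>) sequentially" using \<eta> by (intro order_tendstoD) auto
  then show ?thesis
  proof eventually_elim
    case (elim n)
    define r where "r = X n * s"
    have r: "r > 0" using X(2)[of n] s by (simp add: r_def)
    let ?B = "ball (0::real^'n) r"
    let ?V = "emeasure lborel ?B"
    define v where "v = measure lborel ?B"
    have v: "v > 0" unfolding v_def by (rule measure_ball_pos[OF r])
    have Vv: "?V = ennreal v" unfolding v_def using emeasure_bounded_finite[of ?B] by (simp add: emeasure_eq_ennreal_measure)
    let ?Q = "\<lambda>a. (\<integral>\<^sup>+u\<in>?B. (\<integral>\<^sup>+t\<in>{0..1}. norm (g' (a + t *\<^sub>R u) - g' a) \<partial>lborel) \<partial>lborel)"
    let ?D = "\<lambda>a. \<bar>mean_oscillation f (a, r) - r * (linear_osc CARD('n) * norm (g a))\<bar>"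
    let ?A = "{a. ?D a > \<delta> * X n}"
    \<comment> \<open>Chebyshev's inequality in pointwise form: on the exceptional set the
      increments of the truncated g' have to supply the other half of the threshold.\<close>
    have "AE a in lborel. ?V * indicator ?A a \<le> ennreal (4 * s / \<delta>) * ?Q a"
      using weak_gradient_oscillation_bound[OF w]
    proof eventually_elim
      case (elim a)
      have tri: "norm (g x - g a) \<le> norm (g' x - g' a) + 2 * \<tau>" for x
      proof -
        have small: "norm (g y - g' y) \<le> \<tau>" for y using t by (simp add: g'_def)
        have "g x - g a = (g' x - g' a) + ((g x - g' x) - (g a - g' a))" by simp
        then have "norm (g x - g a) \<le> norm (g' x - g' a) + norm ((g x - g' x) - (g a - g' a))" by (metis norm_triangle_ineq)
        also have "norm ((g x - g' x) - (g a - g' a)) \<le> \<tau> + \<tau>"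
          using norm_triangle_ineq4[of "g x - g' x" "g a - g' a"] small[of x] small[of a] by linarith
        finally show ?thesis by simp
      qed
      have "ennreal (?D a) * ?V \<le> ennreal (2 * r) * (\<integral>\<^sup>+u\<in>?B. (\<integral>\<^sup>+t\<in>{0..1}. norm (g (a + t *\<^sub>R u) - g a) \<partial>lborel) \<partial>lborel)"
        using elim r by blast
      also have "\<dots> \<le> ennreal (2 * r) * (\<integral>\<^sup>+u\<in>?B. (\<integral>\<^sup>+t\<in>{0..1}. ennreal (norm (g' (a + t *\<^sub>R u) - g' a)) + ennreal (2 * \<tau>) \<partial>lborel) \<partial>lborel)"
        using tri t by (intro mult_left_mono nn_integral_mono mult_right_mono) (auto simp: ennreal_leI simp flip: ennreal_plus)
      also have "(\<integral>\<^sup>+u\<in>?B. (\<integral>\<^sup>+t\<in>{0..1}. ennreal (norm (g' (a + t *\<^sub>R u) - g' a)) + ennreal (2 * \<tau>) \<partial>lborel) \<partial>lborel) =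
         (\<integral>\<^sup>+u\<in>?B. ((\<integral>\<^sup>+t\<in>{0..1}. norm (g' (a + t *\<^sub>R u) - g' a) \<partial>lborel) + ennreal (2 * \<tau>)) \<partial>lborel)"
        by (subst distrib_right, subst nn_integral_add) (auto simp: nn_integral_cmult_indicator)
      also have "\<dots> = ?Q a + ennreal (2 * \<tau>) * ?V"
        by (subst distrib_right, subst nn_integral_add) (auto simp: nn_integral_cmult_indicator)
      finally have main: "ennreal (?D a) * ennreal v \<le> ennreal (2 * r) * (?Q a + ennreal (2 * \<tau>) * ennreal v)" by (simp only: Vv)
      show ?case
      proof (cases "a \<in> ?A \<and> ?Q a < \<infinity>")
        case True
        then obtain q where q: "?Q a = ennreal q" "q \<ge> 0" by (cases "?Q a") auto
        have "ennreal (?D a * v) \<le> ennreal (2 * r * (q + 2 * \<tau> * v))"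
          using main q v t r by (simp add: ennreal_mult ennreal_plus)
        then have "?D a * v \<le> 2 * r * (q + 2 * \<tau> * v)" using q v t r by (subst (asm) ennreal_le_iff) auto
        moreover have "\<delta> * X n * v \<le> ?D a * v" using True v by (intro mult_right_mono) auto
        ultimately have "\<delta> * X n * v \<le> 2 * (X n * s) * (q + 2 * (\<delta> / (8 * s)) * v)" by (simp add: r_def \<tau>_def)
        also have "\<dots> = X n * (2 * s * q + \<delta> * v / 2)" using s by (simp add: field_simps)
        finally have "X n * (\<delta> * v) \<le> X n * (2 * s * q + \<delta> * v / 2)" by (simp add: mult_ac)
        then have "\<delta> * v \<le> 2 * s * q + \<delta> * v / 2" using X(2)[of n] by simp
        then have "v \<le> 4 * s / \<delta> * q" using d by (simp add: field_simps)
        then have "ennreal v \<le> ennreal (4 * s / \<delta> * q)" by (rule ennreal_leI)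
        also have "\<dots> = ennreal (4 * s / \<delta>) * ennreal q" using s d q by (intro ennreal_mult) auto
        finally show ?thesis using q(1) Vv True by simp
      next
        case False
        then consider "a \<notin> ?A" | "?Q a = top" by (auto simp: less_top[symmetric])
        then show ?thesis
        proof cases
          case 2
          have "ennreal (4 * s / \<delta>) * top = top" using s d by (simp add: ennreal_mult_top)
          then show ?thesis unfolding 2 by simp
        qed simp
      qed
    qed
    then have "(\<integral>\<^sup>+a. ?V * indicator ?A a \<partial>lborel) \<le> (\<integral>\<^sup>+a. ennreal (4 * s / \<delta>) * ?Q a \<partial>lborel)" by (rule nn_integral_mono_AE)
    also have "\<dots> = ennreal (4 * s / \<delta>) * (\<integral>\<^sup>+a. ?Q a \<partial>lborel)" by (rule nn_integral_cmult) measurable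
    also have "\<dots> \<le> ennreal (4 * s / \<delta>) * (?V * ennreal e')"
      using \<eta>(2) elim by (intro mult_left_mono segment_translation_integral) (auto simp: r_def intro: less_imp_le)
    also have "(\<integral>\<^sup>+a. ?V * indicator ?A a \<partial>lborel) = ?V * emeasure lborel ?A" by (rule nn_integral_cmult_indicator) measurable
    also have "ennreal (4 * s / \<delta>) * (?V * ennreal e') = ?V * (ennreal (4 * s / \<delta>) * ennreal e')" by (simp only: mult_ac)
    also have "ennreal (4 * s / \<delta>) * ennreal e' = ennreal e" using s d e by (simp add: e'_def flip: ennreal_mult)
    finally have "?V * emeasure lborel ?A \<le> ?V * ennreal e" .
    then have "emeasure lborel ?A \<le> ennreal e" using v by (simp add: Vv ennreal_mult_le_mult_iff)
    then show ?case by (simp add: r_def mult.assoc)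
  qed
qed

text \<open>Up to small measure, convergence in measure alters the superlevel set only within a
  shell {|Y - 1| <= \<open>\<delta>\<close>}. The shells have finite measure and decrease to {Y =
  1}, which is null by \<open>ne\<close>.\<close>

lemma superlevel_convergence:
  fixes f :: "real^'n \<Rightarrow> real"
  assumes w: "borel_weak_gradient f g" and p: "p > 1" and I: "(\<integral>\<^sup>+a. norm (g a) powr p \<partial>lborel) < \<infinity>"
    and s: "s > 0" and X: "X \<longlonglongrightarrow> 0" "\<And>n::nat. X n > 0"
    and ne: "AE a in lborel. s * (linear_osc CARD('n) * norm (g a)) \<noteq> 1"
  shows "(\<lambda>n. emeasure lborel {a. mean_oscillation f (a, X n * s) > X n}) \<longlonglongrightarrow> emeasure lborel {a. s * (linear_osc CARD('n) * norm (g a)) > 1}"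
proof -
  have [measurable]: "f \<in> borel_measurable borel" "g \<in> borel_measurable borel"
    using w by (auto simp: borel_weak_gradient_def intro: borel_loc_int_measurable)
  define c where "c = linear_osc CARD('n)"
  have c: "c > 0" by (simp add: c_def linear_osc_pos)
  define Y where "Y a = s * (c * norm (g a))" for a
  have [measurable]: "Y \<in> borel_measurable borel" unfolding Y_def by measurable
  have fin: "emeasure lborel {a. Y a \<ge> 1/2} < \<infinity>"
  proof -
    have "emeasure lborel {a. Y a \<ge> 1/2} = (\<integral>\<^sup>+a. indicator {a. Y a \<ge> 1/2} a \<partial>lborel)" by simp
    also have "\<dots> \<le> (\<integral>\<^sup>+a. ennreal ((2 * s * c) powr p) * ennreal (norm (g a) powr p) \<partial>lborel)"
    proof (rule nn_integral_mono)
      fix a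
      show "indicator {a. Y a \<ge> 1/2} a \<le> ennreal ((2 * s * c) powr p) * ennreal (norm (g a) powr p)"
      proof (cases "Y a \<ge> 1/2")
        case True
        then have "1 \<le> 2 * s * c * norm (g a)" by (simp add: Y_def)
        then have "1 powr p \<le> (2 * s * c * norm (g a)) powr p" using p by (intro powr_mono2) auto
        also have "\<dots> = (2 * s * c) powr p * norm (g a) powr p" using s c by (simp add: powr_mult)
        finally have "1 \<le> ennreal ((2 * s * c) powr p * norm (g a) powr p)" by (simp add: ennreal_ge_1)
        then show ?thesis using True by (simp add: ennreal_mult)
      qed simp
    qed
    also have "\<dots> < \<infinity>" using I by (simp add: nn_integral_cmult ennreal_mult_less_top)
    finally show ?thesis .
  qed
  \<comment> \<open>The offset 2 keeps the width at most 1/2, so each shell lies in {Y >= 1/2},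
    whose measure is finite by Chebyshev's inequality for Y^p.\<close>
  define A where "A k = {a. \<bar>Y a - 1\<bar> \<le> 1 / real (k + 2)}" for k :: nat
  have [measurable]: "A k \<in> sets borel" for k unfolding A_def by measurable
  have Afin: "emeasure lborel (A k) < \<infinity>" for k
  proof -
    have "1 / real (k + 2) \<le> 1/2" by simp
    then have "Y a \<ge> 1/2" if "\<bar>Y a - 1\<bar> \<le> 1 / real (k + 2)" for a using that by linarith
    then have "A k \<subseteq> {a. Y a \<ge> 1/2}" unfolding A_def by auto
    then have "emeasure lborel (A k) \<le> emeasure lborel {a. Y a \<ge> 1/2}" by (intro emeasure_mono) auto
    with fin show ?thesis by (rule order.strict_trans1[rotated])
  qed
  have "(\<lambda>k. emeasure lborel (A k)) \<longlonglongrightarrow> emeasure lborel (\<Inter>k. A k)"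
  proof (rule Lim_emeasure_decseq)
    have "1 / real (n + 2) \<le> 1 / real (m + 2)" if "m \<le> n" for m n
      using that by (intro divide_left_mono) auto
    then show "decseq A" unfolding decseq_def A_def by (blast intro: order_trans)
    show "emeasure lborel (A k) \<noteq> \<infinity>" for k using Afin[of k] by simp
  qed auto
  also have "(\<Inter>k. A k) = {a. Y a = 1}"
  proof (intro equalityI subsetI)
    fix a assume a: "a \<in> (\<Inter>k. A k)"
    have "\<bar>Y a - 1\<bar> \<le> 0"
    proof (rule LIMSEQ_le_const[where X="\<lambda>k. 1 / real (k + 2)"])
      show "(\<lambda>k. 1 / real (k + 2)) \<longlonglongrightarrow> 0"
        using LIMSEQ_ignore_initial_segment[OF lim_1_over_n, of 2] by simp
      show "\<exists>N. \<forall>n\<ge>N. \<bar>Y a - 1\<bar> \<le> 1 / real (n + 2)" using a by (auto simp: A_def)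
    qed
    then show "a \<in> {a. Y a = 1}" by simp
  qed (auto simp: A_def)
  also have "emeasure lborel {a. Y a = 1} = 0"
  proof -
    have "AE a in lborel. a \<notin> {a. Y a = 1}" using ne by (simp add: Y_def c_def)
    then show ?thesis by (subst (asm) AE_iff_measurable[of "{a. Y a = 1}"]) auto
  qed
  finally have A0: "(\<lambda>k. emeasure lborel (A k)) \<longlonglongrightarrow> 0" .
  have "(\<lambda>n. emeasure lborel {a. mean_oscillation f (a, X n * s) > X n}) \<longlonglongrightarrow> emeasure lborel {a. Y a > 1}"
  proof (rule ennreal_tendstoI)
    have "emeasure lborel {a. Y a > 1} \<le> emeasure lborel {a. Y a \<ge> 1/2}" by (intro emeasure_mono) auto
    with fin show "emeasure lborel {a. Y a > 1} < \<infinity>" by (rule order.strict_trans1[rotated])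
    fix e :: real assume e: "e > 0"
    then have "eventually (\<lambda>k. emeasure lborel (A k) < ennreal (e / 2)) sequentially" using A0 by (intro order_tendstoD) auto
    then obtain k where k: "emeasure lborel (A k) < ennreal (e / 2)" by (auto simp: eventually_sequentially)
    define \<delta> where "\<delta> = 1 / real (k + 2)"
    have d: "\<delta> > 0" by (simp add: \<delta>_def)
    have Ak: "A k = {a. \<bar>Y a - 1\<bar> \<le> \<delta>}" by (simp only: A_def \<delta>_def)
    have "eventually (\<lambda>n. emeasure lborel {a. \<bar>mean_oscillation f (a, X n * s) - X n * Y a\<bar> > \<delta> * X n} \<le> ennreal (e / 2)) sequentially"
      using oscillation_in_measure[OF w p I s X d, of "e / 2"] e by (simp add: Y_def c_def)
    then show "eventually (\<lambda>n. emeasure lborel {a. mean_oscillation f (a, X n * s) > X n} \<le> emeasure lborel {a. Y a > 1} + ennreal e \<and>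
        emeasure lborel {a. Y a > 1} \<le> emeasure lborel {a. mean_oscillation f (a, X n * s) > X n} + ennreal e) sequentially"
    proof eventually_elim
      case (elim n)
      let ?M = "{a. mean_oscillation f (a, X n * s) > X n}" and ?Y = "{a. Y a > 1}"
      let ?E = "{a. \<bar>mean_oscillation f (a, X n * s) - X n * Y a\<bar> > \<delta> * X n}"
      have [measurable]: "?M \<in> sets borel" "?Y \<in> sets borel" "?E \<in> sets borel" by measurable
      have ee: "emeasure lborel (A k) + emeasure lborel ?E \<le> ennreal e"
      proof -
        have "emeasure lborel (A k) + emeasure lborel ?E \<le> ennreal (e/2) + ennreal (e/2)" using k elim by (intro add_mono) auto
        also have "\<dots> = ennreal e" using e by (simp flip: ennreal_plus)
        finally show ?thesis .
      qed
      have sub: "emeasure lborel S \<le> emeasure lborel T + ennreal e" if "S \<subseteq> T \<union> (A k \<union> ?E)" and [measurable]: "T \<in> sets borel" for S T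
      proof -
        have "emeasure lborel S \<le> emeasure lborel (T \<union> (A k \<union> ?E))" using that by (intro emeasure_mono) auto
        also have "\<dots> \<le> emeasure lborel T + emeasure lborel (A k \<union> ?E)" by (rule emeasure_subadditive) auto
        also have "\<dots> \<le> emeasure lborel T + (emeasure lborel (A k) + emeasure lborel ?E)" by (intro add_left_mono emeasure_subadditive) auto
        also have "\<dots> \<le> emeasure lborel T + ennreal e" using ee by (rule add_left_mono)
        finally show ?thesis .
      qed
      \<comment> \<open>Off the shell, a point that lies in only one of the two superlevel sets has
        a deviation above \<open>\<delta>\<close> X n.\<close>
      have key: "a \<in> ?E" if "(mean_oscillation f (a, X n * s) > X n \<and> Y a < 1 - \<delta>) \<or> (mean_oscillation f (a, X n * s) \<le> X n \<and> Y a > 1 + \<delta>)" for a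
        using that
      proof
        assume h: "mean_oscillation f (a, X n * s) > X n \<and> Y a < 1 - \<delta>"
        have "X n * Y a \<le> X n * (1 - \<delta>)" using h X(2)[of n] by (intro mult_left_mono) auto
        also have "\<dots> = X n - \<delta> * X n" by (simp add: algebra_simps)
        finally have "\<delta> * X n < mean_oscillation f (a, X n * s) - X n * Y a" using h by linarith
        then show ?thesis by simp
      next
        assume h: "mean_oscillation f (a, X n * s) \<le> X n \<and> Y a > 1 + \<delta>"
        have "X n * (1 + \<delta>) < X n * Y a" using h X(2)[of n] by (intro mult_strict_left_mono) auto
        moreover have "X n * (1 + \<delta>) = X n + \<delta> * X n" by (simp add: algebra_simps)
        ultimately have "\<delta> * X n < X n * Y a - mean_oscillation f (a, X n * s)" using h by linarith
        then show ?thesis by simp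
      qed
      show ?case
      proof
        show "emeasure lborel ?M \<le> emeasure lborel ?Y + ennreal e"
        proof (rule sub)
          show "?M \<subseteq> ?Y \<union> (A k \<union> ?E)"
          proof
            fix a assume "a \<in> ?M"
            then show "a \<in> ?Y \<union> (A k \<union> ?E)"
              using key[of a] by (cases "Y a > 1"; cases "Y a < 1 - \<delta>") (auto simp: Ak)
          qed
        qed measurable
        show "emeasure lborel ?Y \<le> emeasure lborel ?M + ennreal e"
        proof (rule sub)
          show "?Y \<subseteq> ?M \<union> (A k \<union> ?E)"
          proof
            fix a assume "a \<in> ?Y"
            then show "a \<in> ?M \<union> (A k \<union> ?E)"
              using key[of a] by (cases "mean_oscillation f (a, X n * s) > X n"; cases "Y a > 1 + \<delta>") (auto simp: Ak)
          qed
        qed measurable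
      qed
    qed
  qed
  then show ?thesis by (simp add: Y_def c_def)
qed

lemma superlevel_limit:
  fixes f :: "real^'n \<Rightarrow> real"
  assumes w: "borel_weak_gradient f g" and p: "p > 1" and I: "(\<integral>\<^sup>+a. norm (g a) powr p \<partial>lborel) < \<infinity>"
  shows "((\<lambda>\<kappa>. ennreal (\<kappa> powr p) * emeasure (nu p) {z \<in> space (nu p). mean_oscillation f z > \<kappa>})
     \<longlongrightarrow> ennreal (linear_osc CARD('n) powr p / p) * (\<integral>\<^sup>+a. norm (g a) powr p \<partial>lborel)) (at_right 0)"
  unfolding tendsto_at_iff_sequentially
proof (intro allI impI)
  have [measurable]: "f \<in> borel_measurable borel" "g \<in> borel_measurable borel"
    using w by (auto simp: borel_weak_gradient_def intro: borel_loc_int_measurable)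
  define c where "c = linear_osc CARD('n)"
  have c: "c > 0" by (simp add: c_def linear_osc_pos)
  fix X :: "nat \<Rightarrow> real" assume X: "\<forall>i. X i \<in> {0<..} - {0}" "X \<longlonglongrightarrow> 0"
  then have Xp: "X n > 0" for n by auto
  let ?\<Psi> = "\<lambda>s. 2 * (\<integral>\<^sup>+a. ennreal (s * (2 * norm (g a)) - 1/2) \<partial>lborel)"
  \<comment> \<open>For each a at most one s solves s c |g(a)| = 1, so by Tonelli's theorem the
    critical level set is null for almost every s.\<close>
  have "AE a in lborel. AE s in lborel. s * (c * norm (g a)) \<noteq> 1"
  proof (rule AE_I2)
    fix a
    have "AE s in lborel. s \<notin> {1 / (c * norm (g a))}" by (intro AE_not_in countable_imp_null_set_lborel) auto
    then show "AE s in lborel. s * (c * norm (g a)) \<noteq> 1"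
      by eventually_elim (metis nonzero_eq_divide_eq mult_zero_right zero_neq_one insertCI)
  qed
  then have ne: "AE s in lborel. AE a in lborel. s * (c * norm (g a)) \<noteq> 1"
    by (subst lborel_pair.AE_commute) measurable
  have "(\<lambda>n. \<integral>\<^sup>+s. scale_weight p s * emeasure lborel {a. mean_oscillation f (a, X n * s) > X n} \<partial>lborel) \<longlonglongrightarrow>
     (\<integral>\<^sup>+s. scale_weight p s * emeasure lborel {a. s * (c * norm (g a)) > 1} \<partial>lborel)"
  \<comment> \<open>The majorant is free of n because \<open>superlevel_measure_bound\<close> only
    sees the ratio of radius to level, here s.\<close>
  proof (rule nn_integral_dominated_convergence[where w="\<lambda>s. scale_weight p s * ?\<Psi> s"])
    show "AE s in lborel. scale_weight p s * emeasure lborel {a. mean_oscillation f (a, X n * s) > X n} \<le> scale_weight p s * ?\<Psi> s" for n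
    proof (rule AE_I2)
      fix s :: real
      show "scale_weight p s * emeasure lborel {a. mean_oscillation f (a, X n * s) > X n} \<le> scale_weight p s * ?\<Psi> s"
      proof (cases "s > 0")
        case True
        with Xp[of n] superlevel_measure_bound[OF w, of "X n * s" "X n"] show ?thesis by (intro mult_left_mono) auto
      qed (simp add: scale_weight_def)
    qed
    have "(\<integral>\<^sup>+s. scale_weight p s * ?\<Psi> s \<partial>lborel) \<le> ennreal (upper_constant p) * (\<integral>\<^sup>+a. norm (g a) powr p \<partial>lborel)"
      by (rule excess_integral_bound[OF _ p]) measurable
    also have "\<dots> < \<infinity>" using I by (simp add: ennreal_mult_less_top)
    finally show "(\<integral>\<^sup>+s. scale_weight p s * ?\<Psi> s \<partial>lborel) < \<infinity>" .
    show "AE s in lborel. (\<lambda>n. scale_weight p s * emeasure lborel {a. mean_oscillation f (a, X n * s) > X n}) \<longlonglongrightarrow>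
        scale_weight p s * emeasure lborel {a. s * (c * norm (g a)) > 1}"
      using ne
    proof eventually_elim
      case (elim s)
      show ?case
      proof (cases "s > 0")
        case True
        have "scale_weight p s < top" by (simp add: scale_weight_def indicator_def)
        then show ?thesis
          by (intro ennreal_tendsto_cmult) (use superlevel_convergence[OF w p I True X(2) Xp] elim in \<open>simp_all add: c_def\<close>)
      qed (simp add: scale_weight_def)
    qed
  qed measurable
  also have "(\<integral>\<^sup>+s. scale_weight p s * emeasure lborel {a. s * (c * norm (g a)) > 1} \<partial>lborel)
     = (\<integral>\<^sup>+s. (\<integral>\<^sup>+a. scale_weight p s * indicator {s. s * (c * norm (g a)) > 1} s \<partial>lborel) \<partial>lborel)"
  proof (rule nn_integral_cong)
    fix s :: real
    have [measurable]: "{a. s * (c * norm (g a)) > 1} \<in> sets borel" by measurable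
    have "(\<integral>\<^sup>+a. scale_weight p s * indicator {s. s * (c * norm (g a)) > 1} s \<partial>lborel) = (\<integral>\<^sup>+a. scale_weight p s * indicator {a. s * (c * norm (g a)) > 1} a \<partial>lborel)"
      by (intro nn_integral_cong) (simp add: indicator_def)
    then show "scale_weight p s * emeasure lborel {a. s * (c * norm (g a)) > 1} = (\<integral>\<^sup>+a. scale_weight p s * indicator {s. s * (c * norm (g a)) > 1} s \<partial>lborel)"
      by (simp add: nn_integral_cmult_indicator)
  qed
  also have "\<dots> = (\<integral>\<^sup>+a. (\<integral>\<^sup>+s. scale_weight p s * indicator {s. s * (c * norm (g a)) > 1} s \<partial>lborel) \<partial>lborel)"
    by (rule lborel_pair.Fubini') measurable
  also have "\<dots> = (\<integral>\<^sup>+a. ennreal (c powr p / p) * ennreal (norm (g a) powr p) \<partial>lborel)"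
  proof (rule nn_integral_cong)
    fix a
    have "(\<integral>\<^sup>+s. scale_weight p s * indicator {s. s * (c * norm (g a)) > 1} s \<partial>lborel) = ennreal ((c * norm (g a)) powr p / p)"
      using c by (intro scale_weight_indicator_integral p) auto
    also have "(c * norm (g a)) powr p / p = c powr p / p * norm (g a) powr p" using c by (simp add: powr_mult)
    also have "ennreal \<dots> = ennreal (c powr p / p) * ennreal (norm (g a) powr p)" using p by (intro ennreal_mult) auto
    finally show "(\<integral>\<^sup>+s. scale_weight p s * indicator {s. s * (c * norm (g a)) > 1} s \<partial>lborel) = ennreal (c powr p / p) * ennreal (norm (g a) powr p)" .
  qed
  also have "\<dots> = ennreal (c powr p / p) * (\<integral>\<^sup>+a. norm (g a) powr p \<partial>lborel)" by (rule nn_integral_cmult) measurable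
  finally show "((\<lambda>\<kappa>. ennreal (\<kappa> powr p) * emeasure (nu p) {z \<in> space (nu p). mean_oscillation f z > \<kappa>}) \<circ> X)
     \<longlonglongrightarrow> ennreal (linear_osc CARD('n) powr p / p) * (\<integral>\<^sup>+a. norm (g a) powr p \<partial>lborel)"
    by (simp add: o_def mean_oscillation_superlevel_scaled Xp c_def)
qed

section \<open>From mean oscillation to weak gradients\<close>

lemma ball_average_lborel:
  fixes f :: "real^'n \<Rightarrow> real"
  assumes [measurable]: "f \<in> borel_measurable borel"
  shows "ball_average f a r = (LINT x|lborel. indicator (ball a r) x * f x) / measure lborel (ball (0::real^'n) r)"
  unfolding ball_average_borel[OF assms]
  by (subst lborel_integral_translate[where c=a, symmetric]) (auto simp: indicator_def dist_norm add.commute)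

text \<open>The ball of radius r about a' lies inside the ball of radius 2 r about a, whose volume
  is \<open>2 ^ CARD('n)\<close> times as large.\<close>

lemma ball_average_subball:
  fixes f :: "real^'n \<Rightarrow> real"
  assumes f: "borel_loc_int f" and r: "r > 0" and a': "dist a a' \<le> r"
  shows "\<bar>ball_average f a' r - ball_average f a (2 * r)\<bar> \<le> 2 ^ CARD('n) * mean_oscillation f (a, 2 * r)"
proof -
  have [measurable]: "f \<in> borel_measurable borel" using f by (rule borel_loc_int_measurable)
  define c where "c = ball_average f a (2 * r)"
  define V where "V = measure lborel (ball (0::real^'n) r)"
  have V: "V > 0" unfolding V_def by (rule measure_ball_pos[OF r])
  have V2: "measure lborel (ball (0::real^'n) (2 * r)) = 2 ^ CARD('n) * V"
    using r by (simp add: V_def content_ball power_mult_distrib)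
  have fin: "emeasure lborel (ball b s) < \<infinity>" for b :: "real^'n" and s by (rule emeasure_bounded_finite) simp
  have i1: "integrable lborel (\<lambda>x. indicator (ball b s) x * f x)" for b s
    using borel_loc_int_bounded[OF f, of "ball b s"] by (simp add: set_integrable_def)
  have i2: "integrable lborel (\<lambda>x. indicator (ball b s) x * (f x - c))" for b s
    using i1 fin by (simp add: right_diff_distrib integrable_indicator_iff)
  have i3: "integrable lborel (\<lambda>x. indicator (ball b s) x * \<bar>f x - c\<bar>)" for b s
    using integrable_abs[OF i2] by (simp add: abs_mult)
  have "ball_average f a' r - c = (LINT x|lborel. indicator (ball a' r) x * (f x - c)) / V"
    using i1 fin V by (simp add: ball_average_lborel right_diff_distrib integrable_indicator_iff V_def[symmetric] diff_divide_distrib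
        measure_ball_translate[of a'])
  then have "\<bar>ball_average f a' r - c\<bar> = \<bar>LINT x|lborel. indicator (ball a' r) x * (f x - c)\<bar> / V" using V by simp
  also have "\<dots> \<le> (LINT x|lborel. indicator (ball a (2 * r)) x * \<bar>f x - c\<bar>) / V"
  proof (rule divide_right_mono)
    have "\<bar>LINT x|lborel. indicator (ball a' r) x * (f x - c)\<bar> \<le> (LINT x|lborel. \<bar>indicator (ball a' r) x * (f x - c)\<bar>)"
      by (rule integral_abs_bound)
    also have "\<dots> \<le> (LINT x|lborel. indicator (ball a (2 * r)) x * \<bar>f x - c\<bar>)"
    proof (rule integral_mono)
      fix x
      have "ball a' r \<subseteq> ball a (2 * r)"
      proof
        fix y assume "y \<in> ball a' r"
        then show "y \<in> ball a (2 * r)" using dist_triangle[of a y a'] a' by simp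
      qed
      then show "\<bar>indicator (ball a' r) x * (f x - c)\<bar> \<le> indicator (ball a (2 * r)) x * \<bar>f x - c\<bar>"
        by (auto simp: indicator_def)
    qed (use i2 i3 in auto)
    finally show "\<bar>LINT x|lborel. indicator (ball a' r) x * (f x - c)\<bar> \<le> (LINT x|lborel. indicator (ball a (2 * r)) x * \<bar>f x - c\<bar>)" .
  qed (use V in simp)
  also have "\<dots> = 2 ^ CARD('n) * mean_oscillation f (a, 2 * r)"
    using V by (simp add: mean_oscillation_def ball_average_lborel[of "\<lambda>x. \<bar>f x - k\<bar>" for k] V2 c_def)
  finally show ?thesis by (simp add: c_def)
qed

section \<open>Difference quotients of ball averages and a good choice of their scale\<close>

definition diff_quot :: "(real^'n \<Rightarrow> real) \<Rightarrow> 'n \<Rightarrow> real \<Rightarrow> real^'n \<Rightarrow> real" where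
  "diff_quot f i r a = (ball_average f (a + r *\<^sub>R axis i 1) r - ball_average f a r) / r"

lemma diff_quot_measurable [measurable (raw)]:
  fixes f :: "real^'n \<Rightarrow> real"
  assumes [measurable]: "f \<in> borel_measurable borel" "r \<in> borel_measurable M" "a \<in> borel_measurable M"
  shows "(\<lambda>z. diff_quot f i (r z) (a z)) \<in> borel_measurable M"
  unfolding diff_quot_def by measurable

text \<open>Both averages are compared with the one over the ball of radius 2 r about a, which
  contains both balls.\<close>

lemma diff_quot_le_oscillation:
  fixes f :: "real^'n \<Rightarrow> real"
  assumes f: "borel_loc_int f" and r: "r > 0"
  shows "r * \<bar>diff_quot f i r a\<bar> \<le> 2 * 2 ^ CARD('n) * mean_oscillation f (a, 2 * r)"
proof -
  have "\<bar>ball_average f (a + r *\<^sub>R axis i 1) r - ball_average f a (2 * r)\<bar> \<le> 2 ^ CARD('n) * mean_oscillation f (a, 2 * r)"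
    using r by (intro ball_average_subball[OF f r]) (simp add: dist_norm)
  moreover have "\<bar>ball_average f a r - ball_average f a (2 * r)\<bar> \<le> 2 ^ CARD('n) * mean_oscillation f (a, 2 * r)"
    using r by (intro ball_average_subball[OF f r]) simp
  ultimately have "\<bar>ball_average f (a + r *\<^sub>R axis i 1) r - ball_average f a r\<bar> \<le> 2 * (2 ^ CARD('n) * mean_oscillation f (a, 2 * r))"
    by linarith
  then show ?thesis using r by (simp add: diff_quot_def)
qed

lemma nn_integral_inverse_Icc:
  assumes "0 < x" "x \<le> y"
  shows "(\<integral>\<^sup>+k. ennreal (1 / k) * indicator {x..y} k \<partial>lborel) = ennreal (ln y - ln x)"
  using assms by (intro nn_integral_FTC_Icc) (auto intro!: derivative_eq_intros)

text \<open>Pigeonhole over scales: integrate \<open>H (r, s)\<close> against \<open>dr / r\<close> over \<open>r \<in> [exp (- 2 N), exp (- N)]\<close> and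
  substitute \<open>r = \<kappa> s\<close>. Then \<open>\<kappa>\<close> ranges over a logarithmic interval of length \<open>4 N (m + 1)\<close>, against \<open>N\<close> for \<open>r\<close>.\<close>

lemma good_scale_exists:
  fixes H :: "real \<times> real \<Rightarrow> ennreal"
  assumes [measurable]: "H \<in> borel_measurable (borel \<Otimes>\<^sub>M borel)"
    and A: "A \<ge> 0" "\<And>\<kappa>. \<kappa> > 0 \<Longrightarrow> (\<integral>\<^sup>+s. H (\<kappa> * s, s) \<partial>lborel) \<le> ennreal A"
    and N: "N > 0" and m: "m \<ge> 0"
  shows "\<exists>r. exp (- 2 * N) \<le> r \<and> r \<le> exp (- N) \<and>
    (\<integral>\<^sup>+s. H (r, s) * indicator {exp (- 2 * N * m)..exp (2 * N * m)} s \<partial>lborel) \<le> ennreal (4 * (m + 1) * (A + 1))"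
proof (rule ccontr)
  define J where "J = {exp (- 2 * N * m)..exp (2 * N * m)}"
  assume no: "\<not> (\<exists>r. exp (- 2 * N) \<le> r \<and> r \<le> exp (- N) \<and>
    (\<integral>\<^sup>+s. H (r, s) * indicator {exp (- 2 * N * m)..exp (2 * N * m)} s \<partial>lborel) \<le> ennreal (4 * (m + 1) * (A + 1)))"
  have large: "ennreal (4 * (m + 1) * (A + 1)) \<le> (\<integral>\<^sup>+s. H (r, s) * indicator J s \<partial>lborel)" if "r \<in> {exp (- 2 * N)..exp (- N)}" for r
  proof (rule ccontr)
    assume "\<not> ?thesis"
    then have "(\<integral>\<^sup>+s. H (r, s) * indicator {exp (- 2 * N * m)..exp (2 * N * m)} s \<partial>lborel) \<le> ennreal (4 * (m + 1) * (A + 1))"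
      unfolding J_def by (rule less_imp_le[OF not_le[THEN iffD1]])
    moreover have "exp (- 2 * N) \<le> r" "r \<le> exp (- N)" using that by auto
    ultimately show False using no by blast
  qed
  \<comment> \<open>If r lies in \<open>?R\<close> and s in J, then k = r / s lies in
    \<open>?L\<close>.\<close>
  let ?R = "{exp (- 2 * N)..exp (- N)}" and ?L = "{exp (- 2 * N * (m + 1))..exp (2 * N * (m + 1))}"
  have "ennreal (4 * (m + 1) * (A + 1)) * ennreal N = (\<integral>\<^sup>+r. ennreal (4 * (m + 1) * (A + 1)) * (ennreal (1 / r) * indicator ?R r) \<partial>lborel)"
    using nn_integral_inverse_Icc[of "exp (- 2 * N)" "exp (- N)"] N by (simp add: nn_integral_cmult)
  also have "\<dots> \<le> (\<integral>\<^sup>+r. (\<integral>\<^sup>+s. ennreal (1 / r) * indicator ?R r * (H (r, s) * indicator J s) \<partial>lborel) \<partial>lborel)"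
  proof (rule nn_integral_mono)
    fix r :: real
    have "(\<integral>\<^sup>+s. ennreal (1 / r) * indicator ?R r * (H (r, s) * indicator J s) \<partial>lborel) = ennreal (1 / r) * indicator ?R r * (\<integral>\<^sup>+s. H (r, s) * indicator J s \<partial>lborel)"
      unfolding J_def by (rule nn_integral_cmult) measurable
    also have "\<dots> \<ge> ennreal (1 / r) * indicator ?R r * ennreal (4 * (m + 1) * (A + 1))"
      using large[of r] by (cases "r \<in> ?R") (auto intro: mult_left_mono)
    finally show "ennreal (4 * (m + 1) * (A + 1)) * (ennreal (1 / r) * indicator ?R r) \<le> (\<integral>\<^sup>+s. ennreal (1 / r) * indicator ?R r * (H (r, s) * indicator J s) \<partial>lborel)"
      by (simp only: mult.commute)
  qed
  also have "\<dots> = (\<integral>\<^sup>+s. (\<integral>\<^sup>+r. ennreal (1 / r) * indicator ?R r * (H (r, s) * indicator J s) \<partial>lborel) \<partial>lborel)"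
    unfolding J_def by (rule lborel_pair.Fubini') measurable
  also have "\<dots> \<le> (\<integral>\<^sup>+s. (\<integral>\<^sup>+k. ennreal (1 / k) * indicator ?L k * H (k * s, s) \<partial>lborel) \<partial>lborel)"
  proof (rule nn_integral_mono)
    fix s :: real
    show "(\<integral>\<^sup>+r. ennreal (1 / r) * indicator ?R r * (H (r, s) * indicator J s) \<partial>lborel) \<le> (\<integral>\<^sup>+k. ennreal (1 / k) * indicator ?L k * H (k * s, s) \<partial>lborel)"
    proof (cases "s \<in> J")
      case True
      then have s: "s > 0" unfolding J_def by (auto intro: order.strict_trans2[OF exp_gt_zero])
      \<comment> \<open>Substitution r = s k at fixed s, which leaves dr / r invariant.\<close>
      have "(\<integral>\<^sup>+r. ennreal (1 / r) * indicator ?R r * (H (r, s) * indicator J s) \<partial>lborel) =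
         ennreal s * (\<integral>\<^sup>+k. ennreal (1 / (s * k)) * indicator ?R (s * k) * (H (s * k, s) * indicator J s) \<partial>lborel)"
        using s unfolding J_def by (subst nn_integral_real_affine[of _ s 0]) auto
      also have "\<dots> = (\<integral>\<^sup>+k. ennreal s * (ennreal (1 / (s * k)) * indicator ?R (s * k) * (H (s * k, s) * indicator J s)) \<partial>lborel)"
        unfolding J_def by (rule nn_integral_cmult[symmetric]) measurable
      also have "\<dots> \<le> (\<integral>\<^sup>+k. ennreal (1 / k) * indicator ?L k * H (k * s, s) \<partial>lborel)"
      proof (rule nn_integral_mono)
        fix k :: real
        show "ennreal s * (ennreal (1 / (s * k)) * indicator ?R (s * k) * (H (s * k, s) * indicator J s)) \<le> ennreal (1 / k) * indicator ?L k * H (k * s, s)"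
        proof (cases "s * k \<in> ?R")
          case sk: True
          have "0 < s * k" using sk by (auto intro: order.strict_trans2[OF exp_gt_zero])
          then have k: "k > 0" using s by (simp add: zero_less_mult_iff)
          have "exp (- 2 * N * (m + 1)) = exp (- 2 * N) * exp (- (2 * N * m))" by (simp add: algebra_simps flip: exp_add)
          also have "\<dots> \<le> (s * k) * (1 / s)"
          proof (rule mult_mono)
            have "1 / exp (2 * N * m) \<le> 1 / s" using True s by (intro divide_left_mono) (auto simp: J_def)
            then show "exp (- (2 * N * m)) \<le> 1 / s" by (simp add: exp_minus inverse_eq_divide)
          qed (use sk \<open>0 < s * k\<close> in auto)
          finally have lo: "exp (- 2 * N * (m + 1)) \<le> k" using s by simp
          have "k = (s * k) * (1 / s)" using s by simp
          also have "\<dots> \<le> exp (- N) * exp (2 * N * m)"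
          proof (rule mult_mono)
            have "1 / s \<le> 1 / exp (- 2 * N * m)" using True s by (intro divide_left_mono) (auto simp: J_def)
            then show "1 / s \<le> exp (2 * N * m)" by (simp add: exp_minus inverse_eq_divide)
          qed (use sk s in auto)
          also have "\<dots> \<le> exp (2 * N * (m + 1))" using N by (simp add: algebra_simps flip: exp_add)
          finally have "k \<in> ?L" using lo by simp
          moreover have "ennreal s * ennreal (1 / (s * k)) = ennreal (1 / k)" using s k by (simp flip: ennreal_mult)
          ultimately show ?thesis using sk True by (simp add: mult.assoc[symmetric] mult.commute[of k s])
        qed simp
      qed
      finally show ?thesis .
    qed simp
  qed
  also have "\<dots> = (\<integral>\<^sup>+k. (\<integral>\<^sup>+s. ennreal (1 / k) * indicator ?L k * H (k * s, s) \<partial>lborel) \<partial>lborel)"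
    by (rule lborel_pair.Fubini') measurable
  also have "\<dots> \<le> (\<integral>\<^sup>+k. ennreal A * (ennreal (1 / k) * indicator ?L k) \<partial>lborel)"
  proof (rule nn_integral_mono)
    fix k :: real
    have "(\<integral>\<^sup>+s. ennreal (1 / k) * indicator ?L k * H (k * s, s) \<partial>lborel) = ennreal (1 / k) * indicator ?L k * (\<integral>\<^sup>+s. H (k * s, s) \<partial>lborel)"
      by (rule nn_integral_cmult) measurable
    also have "\<dots> \<le> ennreal (1 / k) * indicator ?L k * ennreal A"
    proof (cases "k \<in> ?L")
      case True
      then have "k > 0" by (auto intro: order.strict_trans2[OF exp_gt_zero])
      then show ?thesis by (intro mult_left_mono A(2)) auto
    qed simp
    finally show "(\<integral>\<^sup>+s. ennreal (1 / k) * indicator ?L k * H (k * s, s) \<partial>lborel) \<le> ennreal A * (ennreal (1 / k) * indicator ?L k)"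
      by (simp only: mult.commute)
  qed
  also have "\<dots> = ennreal A * ennreal (4 * N * (m + 1))"
  proof -
    have "exp (- 2 * N * (m + 1)) \<le> exp (2 * N * (m + 1))" using N m by simp
    from nn_integral_inverse_Icc[OF exp_gt_zero this] show ?thesis by (simp add: nn_integral_cmult mult.assoc)
  qed
  finally have "ennreal (4 * (m + 1) * (A + 1) * N) \<le> ennreal (A * (4 * N * (m + 1)))"
    using A m N by (simp add: ennreal_mult)
  \<comment> \<open>The summand 1 in A + 1 is what makes this absurd: both sides carry the same
    factor 4 (m + 1) N.\<close>
  then have "4 * (m + 1) * (A + 1) * N \<le> A * (4 * N * (m + 1))" using A m N by (subst (asm) ennreal_le_iff) auto
  then have "4 * (m + 1) * N \<le> 0" by (simp add: algebra_simps)
  then show False using m N by (simp add: mult_le_0_iff)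
qed

text \<open>What counts is the polynomial growth in 1 / r: for r >= exp(-2 N) it bounds the quotient
  by the exponential of a multiple of N, up to a factor free of r, and this fits the window of s in
  \<open>good_scale_exists\<close>.\<close>

lemma diff_quot_crude_bound:
  fixes f :: "real^'n \<Rightarrow> real"
  assumes f: "borel_loc_int f" and r: "0 < r" "r \<le> 1" and a: "norm a < R"
  shows "\<bar>diff_quot f i r a\<bar> \<le> 2 * (LINT x|lborel. indicator (cball 0 (R + 2)) x * \<bar>f x\<bar>) / unit_ball_vol CARD('n) / r ^ (CARD('n) + 1)"
proof -
  have [measurable]: "f \<in> borel_measurable borel" using f by (rule borel_loc_int_measurable)
  define F where "F = (LINT x|lborel. indicator (cball 0 (R + 2)) x * \<bar>f x\<bar>)"
  define V where "V = measure lborel (ball (0::real^'n) r)"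
  have V: "V > 0" unfolding V_def by (rule measure_ball_pos[OF r(1)])
  have Vr: "V = unit_ball_vol CARD('n) * r ^ CARD('n)" using r by (simp add: V_def content_ball)
  have i: "integrable lborel (\<lambda>x. indicator S x * \<bar>f x\<bar>)" if "bounded S" "S \<in> sets borel" for S
    using integrable_abs[OF borel_loc_int_bounded[OF f that, unfolded set_integrable_def]] by (simp add: abs_mult)
  have *: "\<bar>ball_average f b r\<bar> \<le> F / V" if b: "norm b < R + 1" for b
  proof -
    have "\<bar>ball_average f b r\<bar> = \<bar>LINT x|lborel. indicator (ball b r) x * f x\<bar> / V"
      using V by (simp add: ball_average_lborel V_def)
    also have "\<dots> \<le> F / V"
    proof (rule divide_right_mono)
      have "\<bar>LINT x|lborel. indicator (ball b r) x * f x\<bar> \<le> (LINT x|lborel. \<bar>indicator (ball b r) x * f x\<bar>)" by (rule integral_abs_bound)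
      also have "\<dots> = (LINT x|lborel. indicator (ball b r) x * \<bar>f x\<bar>)" by (simp add: abs_mult)
      also have "\<dots> \<le> F" unfolding F_def
      proof (intro integral_mono i)
        fix x
        have "norm x \<le> R + 2" if "dist b x < r"
          using norm_triangle_ineq4[of b "b - x"] that b r by (simp add: dist_norm)
        then show "indicator (ball b r) x * \<bar>f x\<bar> \<le> indicator (cball 0 (R + 2)) x * \<bar>f x\<bar>" by (auto simp: indicator_def)
      qed auto
      finally show "\<bar>LINT x|lborel. indicator (ball b r) x * f x\<bar> \<le> F" .
    qed (use V in simp)
    finally show ?thesis .
  qed
  have "norm (a + r *\<^sub>R axis i 1) < R + 1"
    using norm_triangle_ineq[of a "r *\<^sub>R axis i 1"] a r by simp
  from *[OF this] *[of a] a have diff: "\<bar>ball_average f (a + r *\<^sub>R axis i 1) r - ball_average f a r\<bar> \<le> 2 * (F / V)" by linarith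
  have "\<bar>diff_quot f i r a\<bar> \<le> 2 * (F / V) / r" using r divide_right_mono[OF diff, of r] by (simp add: diff_quot_def)
  also have "\<dots> = 2 * F / unit_ball_vol CARD('n) / r ^ (CARD('n) + 1)" using r by (simp add: Vr field_simps)
  finally show ?thesis by (simp add: F_def)
qed

lemma diff_quot_superlevel_bound:
  fixes f :: "real^'n \<Rightarrow> real"
  assumes f: "borel_loc_int f" and k: "\<kappa> > 0"
    and A: "A \<ge> 0" "\<And>\<kappa>. \<kappa> > 0 \<Longrightarrow> ennreal (\<kappa> powr p) * emeasure (nu p) {z \<in> space (nu p). mean_oscillation f z > \<kappa>} \<le> ennreal A"
    and S: "S \<in> sets borel"
  shows "(\<integral>\<^sup>+s. scale_weight p s * emeasure lborel {a. a \<in> S \<and> s * \<bar>diff_quot f i (\<kappa> * s) a\<bar> > 1} \<partial>lborel)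
     \<le> ennreal ((4 * 2 ^ CARD('n)) powr p * A)"
proof -
  have [measurable]: "f \<in> borel_measurable borel" using f by (rule borel_loc_int_measurable)
  \<comment> \<open>A quotient above 1 / s forces an oscillation above \<open>\<kappa>\<close> / b
    at the radius 2 \<open>\<kappa>\<close> s = (\<open>\<kappa>\<close> / b) (2 b s); rescaling s
    by 2 b then gives the factor (2 b)^p.\<close>
  define b :: real where "b = 2 * 2 ^ CARD('n)"
  have b: "b > 0" by (simp add: b_def)
  let ?L = "\<lambda>s. emeasure lborel {a. mean_oscillation f (a, \<kappa> / b * s) > \<kappa> / b}"
  have "(\<integral>\<^sup>+s. scale_weight p s * emeasure lborel {a. a \<in> S \<and> s * \<bar>diff_quot f i (\<kappa> * s) a\<bar> > 1} \<partial>lborel)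
     \<le> (\<integral>\<^sup>+s. scale_weight p s * ?L (2 * b * s) \<partial>lborel)"
  proof (rule nn_integral_mono)
    fix s :: real
    show "scale_weight p s * emeasure lborel {a. a \<in> S \<and> s * \<bar>diff_quot f i (\<kappa> * s) a\<bar> > 1} \<le> scale_weight p s * ?L (2 * b * s)"
    proof (cases "s > 0")
      case True
      have "{a. a \<in> S \<and> s * \<bar>diff_quot f i (\<kappa> * s) a\<bar> > 1} \<subseteq> {a. mean_oscillation f (a, \<kappa> / b * (2 * b * s)) > \<kappa> / b}"
      proof safe
        fix a assume h: "s * \<bar>diff_quot f i (\<kappa> * s) a\<bar> > 1"
        have "\<kappa> < \<kappa> * (s * \<bar>diff_quot f i (\<kappa> * s) a\<bar>)" using h k by simp
        also have "\<dots> \<le> b * mean_oscillation f (a, 2 * (\<kappa> * s))"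
          using diff_quot_le_oscillation[OF f, of "\<kappa> * s" i a] True k by (simp add: b_def mult.assoc)
        finally have "\<kappa> / b < mean_oscillation f (a, 2 * (\<kappa> * s))" using b by (simp add: divide_less_eq mult.commute)
        moreover have "\<kappa> / b * (2 * b * s) = 2 * (\<kappa> * s)" using b by simp
        ultimately show "\<kappa> / b < mean_oscillation f (a, \<kappa> / b * (2 * b * s))" by (simp only:)
      qed
      then show ?thesis by (intro mult_left_mono emeasure_mono) auto
    qed (simp add: scale_weight_def)
  qed
  also have "\<dots> = ennreal ((2 * b) powr p) * (\<integral>\<^sup>+s. scale_weight p s * ?L s \<partial>lborel)"
    using b by (intro nn_integral_scale_weight[symmetric]) auto
  also have "(\<integral>\<^sup>+s. scale_weight p s * ?L s \<partial>lborel) = ennreal ((\<kappa> / b) powr p) * emeasure (nu p) {z \<in> space (nu p). mean_oscillation f z > \<kappa> / b}"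
    using k b by (intro mean_oscillation_superlevel_scaled[symmetric]) auto
  also have "ennreal ((2 * b) powr p) * \<dots> \<le> ennreal ((2 * b) powr p) * ennreal A"
    using k b by (intro mult_left_mono A(2)) auto
  finally show ?thesis using A(1) by (simp add: b_def ennreal_mult)
qed

text \<open>Layer-cake formula in s, split at 1 / T and T: below 1 / T the crude bound empties the
  superlevel sets, in between \<open>good_scale_exists\<close> applies, and above T the volume of
  the ball times the tail T^(-p) / p is at most 1 / p. The resulting bound does not involve
  R.\<close>

lemma diff_quot_Lp_bound:
  fixes f :: "real^'n \<Rightarrow> real"
  assumes f: "borel_loc_int f" and p: "p > 1"
    and A: "A \<ge> 0" "\<And>\<kappa>. \<kappa> > 0 \<Longrightarrow> ennreal (\<kappa> powr p) * emeasure (nu p) {z \<in> space (nu p). mean_oscillation f z > \<kappa>} \<le> ennreal A"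
    and R: "R > 0"
  shows "\<exists>r. 0 < r \<and> r \<le> 1 / R \<and> r \<le> 1 \<and> (\<integral>\<^sup>+a\<in>ball 0 R. \<bar>diff_quot f i r a\<bar> powr p \<partial>lborel)
     \<le> ennreal (p * (4 * (real CARD('n) + 3) * ((4 * 2 ^ CARD('n)) powr p * A + 1)) + 1)"
proof -
  have [measurable]: "f \<in> borel_measurable borel" using f by (rule borel_loc_int_measurable)
  define d where "d = CARD('n)"
  \<comment> \<open>The crude bound has d + 1 powers of 1 / r, each at most exp(2 N); one more
    factor exp(2 N) absorbs F.\<close>
  define m where "m = real d + 2"
  define A' where "A' = (4 * 2 ^ d) powr p * A"
  have A': "A' \<ge> 0" using A by (simp add: A'_def)
  define F where "F = 2 * (LINT x|lborel. indicator (cball (0::real^'n) (R + 2)) x * \<bar>f x\<bar>) / unit_ball_vol d"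
  define K where "K = measure lborel (ball (0::real^'n) R)"
  have KE: "emeasure lborel (ball (0::real^'n) R) = ennreal K"
    unfolding K_def using emeasure_bounded_finite[of "ball (0::real^'n) R"] by (simp add: emeasure_eq_ennreal_measure)
  \<comment> \<open>Large enough to absorb the local mass F, the volume K and the requirement r <= 1
    / R, so that none of them enters the final bound.\<close>
  define N where "N = max 1 (max R (max F K))"
  have N: "N \<ge> 1" "N \<ge> R" "N \<ge> F" "N \<ge> K" by (auto simp: N_def)
  have eN: "N \<le> exp (2 * N)" "N \<le> exp N" using exp_ge_add_one_self[of "2 * N"] exp_ge_add_one_self[of N] N(1) by linarith+
  define H :: "real \<times> real \<Rightarrow> ennreal" where "H = (\<lambda>(r, s). scale_weight p s * emeasure lborel {a. a \<in> ball (0::real^'n) R \<and> s * \<bar>diff_quot f i r a\<bar> > 1})"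
  have H[measurable]: "H \<in> borel_measurable (borel \<Otimes>\<^sub>M borel)" unfolding H_def by measurable
  have "\<exists>r. exp (- 2 * N) \<le> r \<and> r \<le> exp (- N) \<and>
    (\<integral>\<^sup>+s. H (r, s) * indicator {exp (- 2 * N * m)..exp (2 * N * m)} s \<partial>lborel) \<le> ennreal (4 * (m + 1) * (A' + 1))"
  proof (rule good_scale_exists[OF H A'])
    show "(\<integral>\<^sup>+s. H (\<kappa> * s, s) \<partial>lborel) \<le> ennreal A'" if "\<kappa> > 0" for \<kappa>
      using diff_quot_superlevel_bound[OF f that A, of "ball 0 R" i] by (simp add: H_def A'_def d_def)
  qed (use N in \<open>auto simp: m_def\<close>)
  then obtain r where r: "exp (- 2 * N) \<le> r" "r \<le> exp (- N)" and
    I: "(\<integral>\<^sup>+s. H (r, s) * indicator {exp (- 2 * N * m)..exp (2 * N * m)} s \<partial>lborel) \<le> ennreal (4 * (m + 1) * (A' + 1))" by blast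
  have r0: "r > 0" using r(1) by (rule order.strict_trans2[OF exp_gt_zero])
  have "r \<le> 1 / exp N" using r(2) by (simp add: exp_minus inverse_eq_divide)
  also have "\<dots> \<le> 1 / R" using eN N R by (intro divide_left_mono) auto
  finally have rR: "r \<le> 1 / R" .
  have r1: "r \<le> 1" using r(2) N(1) by (smt (verit) exp_le_one_iff)
  define T where "T = exp (2 * N * m)"
  have T: "T > 0" by (simp add: T_def)
  have GT: "\<bar>diff_quot f i r a\<bar> \<le> T" if "norm a < R" for a
  proof -
    have F0: "F \<ge> 0" unfolding F_def by (intro divide_nonneg_nonneg mult_nonneg_nonneg Bochner_Integration.integral_nonneg) auto
    have "1 / r \<le> exp (2 * N)"
    proof -
      have "1 / r \<le> 1 / exp (- 2 * N)" using r r0 by (intro divide_left_mono) auto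
      then show ?thesis by (simp add: exp_minus inverse_eq_divide)
    qed
    then have "(1 / r) ^ (d + 1) \<le> exp (2 * N) ^ (d + 1)" using r0 by (intro power_mono) auto
    then have rp: "1 / r ^ (d + 1) \<le> exp (2 * N) ^ (d + 1)" by (simp add: power_one_over)
    have "\<bar>diff_quot f i r a\<bar> \<le> F * (1 / r ^ (d + 1))"
      using diff_quot_crude_bound[OF f r0 r1 that, of i] by (simp add: F_def d_def)
    also have "\<dots> \<le> exp (2 * N) * exp (2 * N) ^ (d + 1)"
      using N eN F0 r0 rp by (intro mult_mono) auto
    also have "\<dots> = exp (2 * N) ^ (d + 2)" by simp
    also have "\<dots> = exp (real (d + 2) * (2 * N))" by (simp only: exp_of_nat_mult)
    also have "\<dots> = T" by (simp add: T_def m_def algebra_simps)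
    finally show ?thesis .
  qed
  let ?J = "{exp (- 2 * N * m)..exp (2 * N * m)}"
  have sl[measurable]: "{a. a \<in> ball (0::real^'n) R \<and> s * \<bar>diff_quot f i r a\<bar> > 1} \<in> sets borel" for s by measurable
  have layers: "(\<integral>\<^sup>+a\<in>ball 0 R. ennreal (\<bar>diff_quot f i r a\<bar> powr p) \<partial>lborel) = ennreal p * (\<integral>\<^sup>+a\<in>ball 0 R. ennreal (\<bar>diff_quot f i r a\<bar> powr p / p) \<partial>lborel)"
    using p by (subst nn_integral_cmult[symmetric]) (auto intro!: nn_integral_cong simp: mult.assoc[symmetric] simp flip: ennreal_mult)
  have slices: "(\<integral>\<^sup>+a\<in>ball 0 R. ennreal (\<bar>diff_quot f i r a\<bar> powr p / p) \<partial>lborel) =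
      (\<integral>\<^sup>+a. (\<integral>\<^sup>+s. scale_weight p s * indicator {s. s * \<bar>diff_quot f i r a\<bar> > 1} s * indicator (ball 0 R) a \<partial>lborel) \<partial>lborel)"
    using p by (intro nn_integral_cong) (simp add: nn_integral_multc scale_weight_indicator_integral)
  note slices
  also have "(\<integral>\<^sup>+a. (\<integral>\<^sup>+s. scale_weight p s * indicator {s. s * \<bar>diff_quot f i r a\<bar> > 1} s * indicator (ball 0 R) a \<partial>lborel) \<partial>lborel)
      = (\<integral>\<^sup>+s. (\<integral>\<^sup>+a. scale_weight p s * indicator {s. s * \<bar>diff_quot f i r a\<bar> > 1} s * indicator (ball 0 R) a \<partial>lborel) \<partial>lborel)"
    by (rule lborel_pair.Fubini') measurable
  also have "\<dots> = (\<integral>\<^sup>+s. H (r, s) \<partial>lborel)"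
  proof (rule nn_integral_cong)
    fix s
    have "(\<integral>\<^sup>+a. scale_weight p s * indicator {s. s * \<bar>diff_quot f i r a\<bar> > 1} s * indicator (ball 0 R) a \<partial>lborel)
      = (\<integral>\<^sup>+a. scale_weight p s * indicator {a. a \<in> ball (0::real^'n) R \<and> s * \<bar>diff_quot f i r a\<bar> > 1} a \<partial>lborel)"
      by (intro nn_integral_cong) (auto simp: indicator_def)
    then show "(\<integral>\<^sup>+a. scale_weight p s * indicator {s. s * \<bar>diff_quot f i r a\<bar> > 1} s * indicator (ball 0 R) a \<partial>lborel) = H (r, s)"
      by (simp add: nn_integral_cmult_indicator H_def)
  qed
  finally have layered: "(\<integral>\<^sup>+a\<in>ball 0 R. ennreal (\<bar>diff_quot f i r a\<bar> powr p / p) \<partial>lborel) = (\<integral>\<^sup>+s. H (r, s) \<partial>lborel)" .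
  have tail: "(\<integral>\<^sup>+s. scale_weight p s * indicator {s. s * (1 / T) > 1} s \<partial>lborel) = ennreal ((1 / T) powr p / p)"
    by (rule scale_weight_indicator_integral[OF p]) (use T in simp)
  have "(\<integral>\<^sup>+s. H (r, s) \<partial>lborel) \<le> (\<integral>\<^sup>+s. H (r, s) * indicator ?J s + ennreal K * (scale_weight p s * indicator {s. s * (1 / T) > 1} s) \<partial>lborel)"
  proof (rule nn_integral_mono)
    fix s :: real
    show "H (r, s) \<le> H (r, s) * indicator ?J s + ennreal K * (scale_weight p s * indicator {s. s * (1 / T) > 1} s)"
    proof (cases "s > 0")
      case s: True
      consider "s < 1 / T" | "s \<in> ?J" | "s > T"
      proof (cases "s < 1 / T \<or> s > T")
        case False
        then have "s \<in> ?J" by (auto simp: T_def exp_minus inverse_eq_divide not_less)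
        then show ?thesis by (rule that)
      qed (use that in blast)
      then show ?thesis
      proof cases
        case 1
        have "s * \<bar>diff_quot f i r a\<bar> \<le> 1" if "a \<in> ball 0 R" for a
        proof -
          have "s * \<bar>diff_quot f i r a\<bar> \<le> (1 / T) * T" using 1 s GT[of a] that by (intro mult_mono) auto
          then show ?thesis using T by simp
        qed
        then have e: "{a. a \<in> ball (0::real^'n) R \<and> s * \<bar>diff_quot f i r a\<bar> > 1} = {}" by force
        show ?thesis unfolding H_def split_conv e by simp
      next
        case 2 then show ?thesis by simp
      next
        case 3
        have "H (r, s) \<le> scale_weight p s * ennreal K"
          unfolding H_def split_conv KE[symmetric] by (intro mult_left_mono emeasure_mono) auto
        then show ?thesis using 3 T by (simp add: mult.commute add_increasing)
      qed
    qed (simp add: H_def scale_weight_def)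
  qed
  also have "\<dots> = (\<integral>\<^sup>+s. H (r, s) * indicator ?J s \<partial>lborel) + ennreal K * (\<integral>\<^sup>+s. scale_weight p s * indicator {s. s * (1 / T) > 1} s \<partial>lborel)"
    by (subst nn_integral_add) (auto simp: nn_integral_cmult)
  also have "\<dots> \<le> ennreal (4 * (m + 1) * (A' + 1)) + ennreal K * ennreal ((1 / T) powr p / p)"
    unfolding tail by (rule add_right_mono[OF I])
  also have "ennreal K * ennreal ((1 / T) powr p / p) \<le> ennreal (1 / p)"
  proof -
    \<comment> \<open>Hence T^p = exp(2 N m p) outweighs K, which is at most exp(2 N).\<close>
    have mp: "1 \<le> m * p" using p mult_mono[of 1 m 1 p] by (simp add: m_def)
    have "K \<le> exp (2 * N)" using N eN by linarith
    also have "\<dots> \<le> exp (2 * N * (m * p))" using mp N(1) by (simp add: mult_le_cancel_left1)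
    also have "\<dots> = T powr p" by (simp add: T_def powr_def algebra_simps)
    finally have "K * (1 / T) powr p \<le> 1" using T by (simp add: powr_divide divide_le_eq)
    then have "K * ((1 / T) powr p / p) \<le> 1 / p" using p by (simp add: divide_right_mono)
    then show ?thesis using p by (simp add: K_def ennreal_leI flip: ennreal_mult)
  qed
  finally have "(\<integral>\<^sup>+s. H (r, s) \<partial>lborel) \<le> ennreal (4 * (m + 1) * (A' + 1)) + ennreal (1 / p)"
    by (simp add: add_left_mono)
  then have "(\<integral>\<^sup>+a\<in>ball 0 R. ennreal (\<bar>diff_quot f i r a\<bar> powr p) \<partial>lborel) \<le> ennreal p * (ennreal (4 * (m + 1) * (A' + 1)) + ennreal (1 / p))"
    unfolding layers layered by (rule mult_left_mono) simp
  also have "\<dots> = ennreal (p * (4 * (m + 1) * (A' + 1)) + 1)"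
  proof -
    have "0 \<le> 4 * (m + 1) * (A' + 1)" using A' by (simp add: m_def)
    then have "ennreal p * (ennreal (4 * (m + 1) * (A' + 1)) + ennreal (1 / p)) = ennreal (p * (4 * (m + 1) * (A' + 1) + 1 / p))"
      using p by (subst ennreal_plus[symmetric]) (auto simp: ennreal_mult)
    also have "p * (4 * (m + 1) * (A' + 1) + 1 / p) = p * (4 * (m + 1) * (A' + 1)) + 1" using p by (simp add: algebra_simps)
    finally show ?thesis .
  qed
  finally show ?thesis using r0 rR r1 by (intro exI[of _ r]) (simp add: m_def A'_def d_def add.commute)
qed

section \<open>Difference quotients tested against smooth functions, and their weak limit\<close>

lemma ball_mean_abs_le:
  fixes h :: "'a::euclidean_space \<Rightarrow> real"
  assumes [measurable]: "h \<in> borel_measurable borel" and r: "r > 0" and e: "\<And>u. norm u < r \<Longrightarrow> \<bar>h u\<bar> \<le> e"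
  shows "integrable lborel (\<lambda>u. indicator (ball 0 r) u * h u)"
    and "\<bar>(LINT u|lborel. indicator (ball 0 r) u * h u) / measure lborel (ball (0::'a) r)\<bar> \<le> e"
proof -
  let ?I = "\<lambda>u. indicator (ball (0::'a) r) u :: real"
  have V: "measure lborel (ball (0::'a) r) > 0" by (rule measure_ball_pos[OF r])
  have e0: "0 \<le> e" using e[of 0] r by (metis abs_ge_zero norm_zero order_trans)
  have iI: "integrable lborel (\<lambda>u. e * ?I u)"
    using emeasure_bounded_finite[of "ball (0::'a) r"] by (simp add: integrable_indicator_iff)
  have le: "\<bar>?I u * h u\<bar> \<le> e * ?I u" for u using e[of u] by (auto simp: indicator_def)
  show i: "integrable lborel (\<lambda>u. ?I u * h u)"
    by (rule Bochner_Integration.integrable_bound[OF iI]) (use le e0 in \<open>auto simp: abs_mult\<close>)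
  have "\<bar>LINT u|lborel. ?I u * h u\<bar> \<le> (LINT u|lborel. \<bar>?I u * h u\<bar>)" by (rule integral_abs_bound)
  also have "\<dots> \<le> (LINT u|lborel. e * ?I u)" using i iI le by (intro integral_mono) auto
  also have "\<dots> = e * measure lborel (ball (0::'a) r)" by simp
  finally show "\<bar>(LINT u|lborel. ?I u * h u) / measure lborel (ball (0::'a) r)\<bar> \<le> e"
    using V by (simp add: divide_le_eq)
qed

text \<open>Averaging over balls is a convolution; Fubini's theorem and a translation move it from f
  to the bounded function \<open>\<psi>\<close> of bounded support.\<close>

lemma ball_average_duality:
  fixes f \<psi> :: "real^'n \<Rightarrow> real"
  assumes f: "borel_loc_int f" and r: "r > 0" and [measurable]: "\<psi> \<in> borel_measurable borel"
    and B: "\<And>x. \<bar>\<psi> x\<bar> \<le> B" and R: "\<And>x. norm x > R \<Longrightarrow> \<psi> x = 0"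
  shows "integrable lborel (\<lambda>a. ball_average f a r * \<psi> a)"
    and "(LINT a|lborel. ball_average f a r * \<psi> a) =
      (LINT x|lborel. f x * ((LINT u|lborel. indicator (ball 0 r) u * \<psi> (x - u)) / measure lborel (ball (0::real^'n) r)))"
proof -
  have [measurable]: "f \<in> borel_measurable borel" using f by (rule borel_loc_int_measurable)
  let ?I = "\<lambda>u. indicator (ball (0::real^'n) r) u :: real"
  let ?V = "measure lborel (ball (0::real^'n) r)"
  have B0: "0 \<le> B" using B[of undefined] by linarith
  have fin: "emeasure lborel (ball (0::real^'n) r) < \<infinity>" by (rule emeasure_bounded_finite) simp
  have i1: "integrable (lborel \<Otimes>\<^sub>M lborel) (\<lambda>(a, u). f (a + u) * (\<psi> a * ?I u))"
    by (rule integrable_shift_pair[OF f, where S="ball 0 r" and \<rho>=r and B=B and R=R])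
      (use B B0 R fin in \<open>auto simp: indicator_def\<close>)
  have i2: "integrable (lborel \<Otimes>\<^sub>M lborel) (\<lambda>(x, u). f (x + 0) * (\<psi> (x - u) * ?I u))"
  proof (rule integrable_shift_pair[OF f, where S="ball 0 r" and \<rho>=0 and B=B and R="R + r"])
    show "\<psi> (x - u) * ?I u = 0" if "R + r < norm x \<or> u \<notin> ball 0 r" for x u
    proof (cases "norm u < r")
      case True
      then have "norm (x - u) > R" using that norm_triangle_ineq2[of x u] by auto
      then show ?thesis by (simp add: R)
    qed simp
  qed (use B B0 fin in \<open>auto simp: indicator_def\<close>)
  have eq: "(LINT u|lborel. f (a + u) * (\<psi> a * ?I u)) = (ball_average f a r * \<psi> a) * ?V" for a
  proof -
    have "(LINT u|lborel. f (a + u) * (\<psi> a * ?I u)) = (LINT u|lborel. \<psi> a * (?I u * f (a + u)))" by (simp only: mult_ac)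
    also have "\<dots> = \<psi> a * (LINT u|lborel. ?I u * f (a + u))" by simp
    finally show ?thesis using measure_ball_pos[OF r, of "0::real^'n"] by (simp add: ball_average_borel)
  qed
  have V: "?V > 0" by (rule measure_ball_pos[OF r])
  have "integrable lborel (\<lambda>a. (ball_average f a r * \<psi> a) * ?V)" using lborel_pair.integrable_fst[OF i1] by (simp only: eq)
  then show "integrable lborel (\<lambda>a. ball_average f a r * \<psi> a)" using V by simp
  have "(LINT a|lborel. ball_average f a r * \<psi> a) * ?V = (LINT a|lborel. LINT u|lborel. f (a + u) * (\<psi> a * ?I u))"
    by (simp add: eq)
  also have "\<dots> = (LINT u|lborel. LINT a|lborel. f (a + u) * (\<psi> a * ?I u))" by (rule lborel_pair.Fubini_integral[OF i1, symmetric])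
  also have "\<dots> = (LINT u|lborel. LINT x|lborel. f (x + 0) * (\<psi> (x - u) * ?I u))"
  proof (rule Bochner_Integration.integral_cong[OF refl])
    fix u
    show "(LINT a|lborel. f (a + u) * (\<psi> a * ?I u)) = (LINT x|lborel. f (x + 0) * (\<psi> (x - u) * ?I u))"
      using lborel_integral_translate[of "\<lambda>x. f x * (\<psi> (x - u) * ?I u)" u] by simp
  qed
  also have "\<dots> = (LINT x|lborel. LINT u|lborel. f (x + 0) * (\<psi> (x - u) * ?I u))" by (rule lborel_pair.Fubini_integral[OF i2])
  also have "\<dots> = (LINT x|lborel. f x * (LINT u|lborel. ?I u * \<psi> (x - u)))" by (simp add: mult.commute)
  finally have "(LINT a|lborel. ball_average f a r * \<psi> a) = (LINT x|lborel. f x * (LINT u|lborel. ?I u * \<psi> (x - u))) / ?V"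
    using V by (simp add: field_simps)
  also have "\<dots> = (LINT x|lborel. f x * ((LINT u|lborel. ?I u * \<psi> (x - u)) / ?V))" by simp
  finally show "(LINT a|lborel. ball_average f a r * \<psi> a) =
      (LINT x|lborel. f x * ((LINT u|lborel. indicator (ball 0 r) u * \<psi> (x - u)) / measure lborel (ball (0::real^'n) r)))" .
qed

text \<open>Summation by parts: the difference and the ball average are both transferred to
  \<open>\<phi>\<close>, where they converge pointwise with a common bound and a common bounded
  support, so that f only acts as a locally integrable weight.\<close>

lemma diff_quot_test_limit:
  fixes f :: "real^'n \<Rightarrow> real"
  assumes f: "borel_loc_int f" and \<phi>: "test_function \<phi>" and X: "X \<longlonglongrightarrow> 0" "\<And>n::nat. 0 < X n" "\<And>n. X n \<le> 1"
  shows "(\<lambda>n. LINT a|lborel. diff_quot f i (X n) a * \<phi> a) \<longlonglongrightarrow> - (LINT x|lborel. f x * partial_deriv i \<phi> x)"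
proof -
  have [measurable]: "f \<in> borel_measurable borel" using f by (rule borel_loc_int_measurable)
  have [measurable]: "\<phi> \<in> borel_measurable borel" by (rule test_functionD(4)[OF \<phi>])
  let ?e = "axis i 1 :: real^'n"
  let ?D = "partial_deriv i \<phi>"
  have D: "test_function ?D" by (rule test_function_partial[OF \<phi>])
  obtain B where B: "B > 0" "\<And>x. \<bar>\<phi> x\<bar> \<le> B" using test_function_bounded[OF \<phi>] by metis
  obtain B' where B': "B' > 0" "\<And>x. \<bar>?D x\<bar> \<le> B'" using test_function_bounded[OF D] by metis
  obtain R where R: "R > 0" "\<And>x. norm x \<ge> R \<Longrightarrow> \<phi> x = 0" using test_function_support[OF \<phi>] by metis
  define \<psi> where "\<psi> r y = (\<phi> (y - r *\<^sub>R ?e) - \<phi> y) / r" for r y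
  have [measurable]: "\<psi> r \<in> borel_measurable borel" for r unfolding \<psi>_def by measurable
  \<comment> \<open>The mean value theorem makes \<open>\<psi> r y\<close> a value of -
    \<open>?D\<close> at distance less than r from y. This yields both the uniform bound B' and the
    convergence.\<close>
  have mvt: "\<exists>z. dist y z < r \<and> \<psi> r y = - ?D z" if r: "r > 0" for r y
  proof -
    have "\<exists>t>0. t < r \<and> \<phi> (y - r *\<^sub>R ?e) - \<phi> (y - 0 *\<^sub>R ?e) = (r - 0) * - ?D (y - t *\<^sub>R ?e)"
    proof (rule MVT2[OF r])
      fix t :: real
      have l: "linear (frechet_derivative \<phi> (at (y - t *\<^sub>R ?e)))" using test_functionD(5)[OF \<phi>] by (rule has_derivative_linear)
      have "((\<lambda>t. \<phi> (y - t *\<^sub>R ?e)) has_derivative (\<lambda>h. frechet_derivative \<phi> (at (y - t *\<^sub>R ?e)) (- h *\<^sub>R ?e))) (at t)"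
        by (rule has_derivative_compose[where f="\<lambda>t. y - t *\<^sub>R ?e" and f'="\<lambda>h. - h *\<^sub>R ?e"])
          (auto intro!: derivative_eq_intros test_functionD(5)[OF \<phi>])
      moreover have "(\<lambda>h. frechet_derivative \<phi> (at (y - t *\<^sub>R ?e)) (- h *\<^sub>R ?e)) = (*) (- ?D (y - t *\<^sub>R ?e))"
        by (rule ext) (simp add: linear_cmul[OF l] linear_neg[OF l] partial_deriv_def)
      ultimately show "((\<lambda>t. \<phi> (y - t *\<^sub>R ?e)) has_real_derivative - ?D (y - t *\<^sub>R ?e)) (at t)"
        by (simp add: has_field_derivative_def)
    qed
    then obtain t where t: "0 < t" "t < r" "\<phi> (y - r *\<^sub>R ?e) - \<phi> y = r * - ?D (y - t *\<^sub>R ?e)" by auto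
    then show ?thesis using r by (intro exI[of _ "y - t *\<^sub>R ?e"]) (simp add: \<psi>_def dist_norm)
  qed
  have \<psi>B: "\<bar>\<psi> r y\<bar> \<le> B'" if "r > 0" for r y using mvt[OF that, of y] B' by auto
  have \<psi>R: "\<psi> r y = 0" if "0 < r" "r \<le> 1" "norm y > R + 1" for r y
  proof -
    have "norm (y - r *\<^sub>R ?e) \<ge> R" using norm_triangle_ineq2[of y "r *\<^sub>R ?e"] that by simp
    then show ?thesis using that by (simp add: \<psi>_def R)
  qed
  define M where "M r x = (LINT u|lborel. indicator (ball 0 r) u * \<psi> r (x - u)) / measure lborel (ball (0::real^'n) r)" for r x
  have [measurable]: "M r \<in> borel_measurable borel" for r unfolding M_def by measurable
  have eq: "(LINT a|lborel. diff_quot f i r a * \<phi> a) = (LINT x|lborel. f x * M r x)" if r: "0 < r" "r \<le> 1" for r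
  proof -
    have \<phi>R: "\<phi> (x - v) = 0" if "norm x > R + norm v" for x v
      using that norm_triangle_ineq2[of x v] by (intro R(2)) linarith
    have j1: "integrable lborel (\<lambda>a. ball_average f a r * \<phi> (a - r *\<^sub>R ?e))"
      by (rule ball_average_duality(1)[OF f r(1), where B=B and R="R + norm (r *\<^sub>R ?e)"]) (use B \<phi>R in auto)
    have j2: "integrable lborel (\<lambda>a. ball_average f a r * \<phi> a)"
      by (rule ball_average_duality(1)[OF f r(1), where B=B and R=R]) (use B R in auto)
    have j3: "integrable lborel (\<lambda>a. ball_average f (a + r *\<^sub>R ?e) r * \<phi> a)"
    proof -
      have "integrable (distr lborel borel ((+) (r *\<^sub>R ?e))) (\<lambda>a. ball_average f a r * \<phi> (a - r *\<^sub>R ?e))"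
        using j1 by (simp add: lborel_distr_plus)
      then show ?thesis by (subst (asm) integrable_distr_eq) (auto simp: add.commute)
    qed
    have "(LINT a|lborel. diff_quot f i r a * \<phi> a) = (LINT a|lborel. (ball_average f (a + r *\<^sub>R ?e) r * \<phi> a - ball_average f a r * \<phi> a) / r)"
      by (simp add: diff_quot_def left_diff_distrib)
    also have "\<dots> = ((LINT a|lborel. ball_average f (a + r *\<^sub>R ?e) r * \<phi> a) - (LINT a|lborel. ball_average f a r * \<phi> a)) / r"
      using j2 j3 by simp
    also have "(LINT a|lborel. ball_average f (a + r *\<^sub>R ?e) r * \<phi> a) = (LINT a|lborel. ball_average f a r * \<phi> (a - r *\<^sub>R ?e))"
      using lborel_integral_translate[of "\<lambda>a. ball_average f a r * \<phi> (a - r *\<^sub>R ?e)" "r *\<^sub>R ?e"] by simp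
    also have "((LINT a|lborel. ball_average f a r * \<phi> (a - r *\<^sub>R ?e)) - (LINT a|lborel. ball_average f a r * \<phi> a)) / r
       = (LINT a|lborel. ball_average f a r * \<psi> r a)"
      using j1 j2 by (simp add: \<psi>_def right_diff_distrib diff_divide_distrib)
    also have "\<dots> = (LINT x|lborel. f x * M r x)"
      unfolding M_def by (rule ball_average_duality(2)[OF f r(1), where B=B' and R="R + 1"]) (use \<psi>B \<psi>R r in auto)
    finally show ?thesis .
  qed
  have lim: "(\<lambda>n. M (X n) x) \<longlonglongrightarrow> - ?D x" for x
  proof (rule LIMSEQ_I)
    fix e :: real assume e: "e > 0"
    obtain \<delta> where \<delta>: "\<delta> > 0" "\<And>z. dist z x < \<delta> \<Longrightarrow> dist (?D z) (?D x) < e / 2"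
      using test_functionD(6)[OF D, of x] e unfolding continuous_at_eps_delta by (metis half_gt_zero)
    have "eventually (\<lambda>n. X n < \<delta> / 2) sequentially" using X(1) \<delta>(1) by (intro order_tendstoD) auto
    then obtain n0 where n0: "\<And>n. n \<ge> n0 \<Longrightarrow> X n < \<delta> / 2" by (auto simp: eventually_sequentially)
    show "\<exists>n0. \<forall>n\<ge>n0. norm (M (X n) x - - ?D x) < e"
    proof (intro exI allI impI)
      fix n assume "n \<ge> n0"
      define r where "r = X n"
      have r: "r > 0" "r < \<delta> / 2" using X(2)[of n] n0[OF \<open>n \<ge> n0\<close>] by (auto simp: r_def)
      let ?I = "\<lambda>u. indicator (ball (0::real^'n) r) u :: real"
      have V: "measure lborel (ball (0::real^'n) r) > 0" by (rule measure_ball_pos[OF r(1)])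
      \<comment> \<open>Two moves of length below r, from x to x - u and from there to the mean
        value point, stay within \<open>\<delta>\<close> of x; this is why r is below
        \<open>\<delta>\<close> / 2.\<close>
      have le: "\<bar>\<psi> r (x - u) + ?D x\<bar> \<le> e / 2" if u: "norm u < r" for u
      proof -
        obtain z where z: "dist (x - u) z < r" "\<psi> r (x - u) = - ?D z" using mvt[OF r(1)] by blast
        have "dist z x \<le> dist z (x - u) + dist (x - u) x" by (rule dist_triangle)
        also have "\<dots> < \<delta>" using z(1) u r by (simp add: dist_commute dist_norm)
        finally show ?thesis using \<delta>(2)[of z] z(2) by (simp add: dist_real_def abs_minus_commute)
      qed
      have int: "integrable lborel (\<lambda>u. ?I u * \<psi> r (x - u))" by (rule ball_mean_abs_le(1)[OF _ r(1), where e=B']) (use \<psi>B r in auto)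
      have iI: "integrable lborel (\<lambda>u. ?I u * ?D x)"
        using emeasure_bounded_finite[of "ball (0::real^'n) r"] by (simp add: integrable_indicator_iff)
      have "(LINT u|lborel. ?I u * (\<psi> r (x - u) + ?D x)) = (LINT u|lborel. ?I u * \<psi> r (x - u)) + measure lborel (ball (0::real^'n) r) * ?D x"
        using int iI by (simp add: distrib_left)
      then have "M r x - - ?D x = (LINT u|lborel. ?I u * (\<psi> r (x - u) + ?D x)) / measure lborel (ball (0::real^'n) r)"
        using V by (simp add: M_def add_divide_distrib)
      moreover have "\<bar>\<dots>\<bar> \<le> e / 2"
        by (rule ball_mean_abs_le(2)[OF _ r(1)]) (use le in auto)
      ultimately have "\<bar>M r x - - ?D x\<bar> \<le> e / 2" by (simp only:)
      then show "norm (M (X n) x - - ?D x) < e" using e unfolding r_def real_norm_def by linarith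
    qed
  qed
  have "(\<lambda>n. LINT x|lborel. f x * M (X n) x) \<longlonglongrightarrow> (LINT x|lborel. f x * (- ?D x))"
  \<comment> \<open>Radius R + 2: one unit for the shift in \<open>\<psi>\<close> and one for the
    ball average, since X n <= 1.\<close>
  proof (rule integral_dominated_convergence[where w="\<lambda>x. B' * \<bar>indicator (cball 0 (R + 2)) x * f x\<bar>"])
    have [measurable]: "?D \<in> borel_measurable borel" by (rule test_functionD(4)[OF D])
    show "(\<lambda>x. f x * - ?D x) \<in> borel_measurable lborel" by measurable
    show "integrable lborel (\<lambda>x. B' * \<bar>indicator (cball 0 (R + 2)) x * f x\<bar>)"
      using borel_loc_int_bounded[OF f, of "cball 0 (R + 2)"] by (intro integrable_mult_right integrable_abs) (simp add: set_integrable_def)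
    show "AE x in lborel. (\<lambda>n. f x * M (X n) x) \<longlonglongrightarrow> f x * - ?D x" by (intro AE_I2 tendsto_mult tendsto_const lim)
    show "AE x in lborel. norm (f x * M (X n) x) \<le> B' * \<bar>indicator (cball 0 (R + 2)) x * f x\<bar>" for n
    proof (rule AE_I2)
      fix x
      show "norm (f x * M (X n) x) \<le> B' * \<bar>indicator (cball 0 (R + 2)) x * f x\<bar>"
      proof (cases "norm x \<le> R + 2")
        case True
        have "\<bar>M (X n) x\<bar> \<le> B'" unfolding M_def by (rule ball_mean_abs_le(2)) (use X(2) \<psi>B in auto)
        then have "\<bar>f x\<bar> * \<bar>M (X n) x\<bar> \<le> \<bar>f x\<bar> * B'" by (intro mult_left_mono) auto
        then show ?thesis using True by (simp add: abs_mult mult.commute)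
      next
        case False
        have z: "indicator (ball 0 (X n)) u * \<psi> (X n) (x - u) = 0" for u
        proof (cases "norm u < X n")
          case True
          then have "norm (x - u) > R + 1" using False X(3)[of n] norm_triangle_ineq2[of x u] by linarith
          then show ?thesis using \<psi>R X by simp
        qed simp
        have "M (X n) x = 0" unfolding M_def by (simp only: z Bochner_Integration.integral_zero div_0)
        then show ?thesis using B' by simp
      qed
    qed
  qed measurable
  then show ?thesis using X by (simp add: eq)
qed

text \<open>The bounds hold on growing balls along shrinking scales; cutting off at radius n + 1
  gives a sequence bounded in L^p on the whole space, and the support of a fixed test function
  eventually lies inside the cut-off.\<close>

lemma oscillation_imp_weak_partial:
  fixes f :: "real^'n \<Rightarrow> real"
  assumes f: "borel_loc_int f" and p: "p > 1"
    and bound: "\<And>R. R > 0 \<Longrightarrow> \<exists>r. 0 < r \<and> r \<le> 1 / R \<and> r \<le> 1 \<and> (\<integral>\<^sup>+a\<in>ball 0 R. \<bar>diff_quot f i r a\<bar> powr p \<partial>lborel) \<le> ennreal C"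
    and C: "C \<ge> 0"
  obtains g where "g \<in> borel_measurable borel" "(\<integral>\<^sup>+x. \<bar>g x\<bar> powr p \<partial>lborel) \<le> ennreal C"
    "\<And>\<phi>. test_function \<phi> \<Longrightarrow> (LINT x|lborel. f x * partial_deriv i \<phi> x) = - (LINT x|lborel. g x * \<phi> x)"
proof -
  have [measurable]: "f \<in> borel_measurable borel" using f by (rule borel_loc_int_measurable)
  have "\<forall>n::nat. \<exists>r. 0 < r \<and> r \<le> 1 / real (Suc n) \<and> r \<le> 1 \<and> (\<integral>\<^sup>+a\<in>ball 0 (real (Suc n)). \<bar>diff_quot f i r a\<bar> powr p \<partial>lborel) \<le> ennreal C"
    using bound by simp
  then obtain X where "\<forall>n. 0 < X n \<and> X n \<le> 1 / real (Suc n) \<and> X n \<le> 1 \<and> (\<integral>\<^sup>+a\<in>ball 0 (real (Suc n)). \<bar>diff_quot f i (X n) a\<bar> powr p \<partial>lborel) \<le> ennreal C"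
    by (rule choice[THEN exE])
  then have X: "\<And>n. 0 < X n" "\<And>n. X n \<le> 1 / real (Suc n)" "\<And>n. X n \<le> 1"
    "\<And>n. (\<integral>\<^sup>+a\<in>ball 0 (real (Suc n)). \<bar>diff_quot f i (X n) a\<bar> powr p \<partial>lborel) \<le> ennreal C" by blast+
  have X0: "X \<longlonglongrightarrow> 0"
  proof (rule tendsto_sandwich[OF _ _ tendsto_const])
    show "(\<lambda>n. 1 / real (Suc n)) \<longlonglongrightarrow> 0" by (rule LIMSEQ_Suc[OF lim_1_over_n])
    show "eventually (\<lambda>n. 0 \<le> X n) sequentially" by (intro always_eventually allI less_imp_le X)
    show "eventually (\<lambda>n. X n \<le> 1 / real (Suc n)) sequentially" by (intro always_eventually allI X)
  qed
  define G where "G n a = indicator (ball (0::real^'n) (real (Suc n))) a * diff_quot f i (X n) a" for n a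
  have G: "G n \<in> borel_measurable lborel" for n unfolding G_def by measurable
  have GC: "(\<integral>\<^sup>+a. \<bar>G n a\<bar> powr p \<partial>lborel) \<le> ennreal C" for n
  proof -
    have "(\<integral>\<^sup>+a. \<bar>G n a\<bar> powr p \<partial>lborel) = (\<integral>\<^sup>+a\<in>ball 0 (real (Suc n)). \<bar>diff_quot f i (X n) a\<bar> powr p \<partial>lborel)"
      using p by (intro nn_integral_cong) (auto simp: G_def indicator_def)
    then show ?thesis using X(4) by simp
  qed
  show thesis
  proof (rule Lp_weak_limit[where G=G, OF sigma_finite_lborel p C G GC])
    fix g
    assume g: "g \<in> borel_measurable lborel" "(\<integral>\<^sup>+x. \<bar>g x\<bar> powr p \<partial>lborel) \<le> ennreal C"
      "\<And>\<phi> l B. \<phi> \<in> borel_measurable lborel \<Longrightarrow> (\<And>x. \<bar>\<phi> x\<bar> \<le> B) \<Longrightarrow> emeasure lborel {x\<in>space lborel. \<phi> x \<noteq> 0} < \<infinity> \<Longrightarrow>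
       (\<lambda>n. LINT x|lborel. G n x * \<phi> x) \<longlonglongrightarrow> l \<Longrightarrow> (LINT x|lborel. g x * \<phi> x) = l"
    show thesis
    proof (rule that)
    show "g \<in> borel_measurable borel" using g(1) by simp
    show "(\<integral>\<^sup>+x. \<bar>g x\<bar> powr p \<partial>lborel) \<le> ennreal C" by (rule g(2))
    fix \<phi> :: "real^'n \<Rightarrow> real" assume \<phi>: "test_function \<phi>"
    have m: "\<phi> \<in> borel_measurable lborel" using test_functionD(4)[OF \<phi>] by simp
    obtain B where B: "\<And>x. \<bar>\<phi> x\<bar> \<le> B" using test_function_bounded[OF \<phi>] by metis
    obtain R where R: "\<And>x. norm x \<ge> R \<Longrightarrow> \<phi> x = 0" using test_function_support[OF \<phi>] by metis
    have "bounded {x\<in>space lborel. \<phi> x \<noteq> 0}"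
      unfolding bounded_iff using R by (intro exI[of _ R]) (auto simp: not_le intro: less_imp_le, meson linear)
    then have S: "emeasure lborel {x\<in>space lborel. \<phi> x \<noteq> 0} < \<infinity>" by (rule emeasure_bounded_finite)
    obtain n0 :: nat where n0: "R \<le> real n0" using real_arch_simple by blast
    have "eventually (\<lambda>n. (LINT x|lborel. diff_quot f i (X n) x * \<phi> x) = (LINT x|lborel. G n x * \<phi> x)) sequentially"
    proof (rule eventually_sequentiallyI)
      fix n assume "n \<ge> n0"
      show "(LINT x|lborel. diff_quot f i (X n) x * \<phi> x) = (LINT x|lborel. G n x * \<phi> x)"
      proof (rule Bochner_Integration.integral_cong[OF refl])
        fix x
        show "diff_quot f i (X n) x * \<phi> x = G n x * \<phi> x"
        proof (cases "norm x < real (Suc n)")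
          case False
          then have "R \<le> norm x" using n0 \<open>n \<ge> n0\<close> by (simp add: not_less)
          then show ?thesis by (simp add: R)
        qed (simp add: G_def)
      qed
    qed
    then have "(\<lambda>n. LINT x|lborel. G n x * \<phi> x) \<longlonglongrightarrow> - (LINT x|lborel. f x * partial_deriv i \<phi> x)"
      by (rule Lim_transform_eventually[OF diff_quot_test_limit[OF f \<phi> X0 X(1,3)]])
    from g(3)[OF m B S this] show "(LINT x|lborel. f x * partial_deriv i \<phi> x) = - (LINT x|lborel. g x * \<phi> x)" by simp
    qed
  qed
qed

section \<open>Borel representatives and the theorem\<close>

text \<open>The gradient is built coordinate by coordinate. Its Euclidean norm is at most the
  dimension times the largest coordinate, which is enough for a finite p-th moment.\<close>

lemma oscillation_imp_weak_gradient:
  fixes f :: "real^'n \<Rightarrow> real"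
  assumes f: "borel_loc_int f" and p: "p > 1"
    and A: "A \<ge> 0" "\<And>\<kappa>. \<kappa> > 0 \<Longrightarrow> ennreal (\<kappa> powr p) * emeasure (nu p) {z \<in> space (nu p). mean_oscillation f z > \<kappa>} \<le> ennreal A"
  obtains g where "borel_weak_gradient f g" "(\<integral>\<^sup>+x. norm (g x) powr p \<partial>lborel) < \<infinity>"
proof -
  define C where "C = p * (4 * (real CARD('n) + 3) * ((4 * 2 ^ CARD('n)) powr p * A + 1)) + 1"
  have C: "C \<ge> 0" using p A by (simp add: C_def)
  have "\<exists>g. g \<in> borel_measurable borel \<and> (\<integral>\<^sup>+x. \<bar>g x\<bar> powr p \<partial>lborel) \<le> ennreal C \<and>
    (\<forall>\<phi>. test_function \<phi> \<longrightarrow> (LINT x|lborel. f x * partial_deriv i \<phi> x) = - (LINT x|lborel. g x * \<phi> x))" for i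
  proof -
    have "\<exists>r. 0 < r \<and> r \<le> 1 / R \<and> r \<le> 1 \<and> (\<integral>\<^sup>+a\<in>ball 0 R. \<bar>diff_quot f i r a\<bar> powr p \<partial>lborel) \<le> ennreal C" if "R > 0" for R
      unfolding C_def by (rule diff_quot_Lp_bound[OF f p A that])
    from oscillation_imp_weak_partial[OF f p this C] show ?thesis by blast
  qed
  then have "\<forall>i. \<exists>g. g \<in> borel_measurable borel \<and> (\<integral>\<^sup>+x. \<bar>g x\<bar> powr p \<partial>lborel) \<le> ennreal C \<and>
    (\<forall>\<phi>. test_function \<phi> \<longrightarrow> (LINT x|lborel. f x * partial_deriv i \<phi> x) = - (LINT x|lborel. g x * \<phi> x))" by blast
  then obtain h where h: "\<forall>i. h i \<in> borel_measurable borel \<and> (\<integral>\<^sup>+x. \<bar>h i x\<bar> powr p \<partial>lborel) \<le> ennreal C \<and>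
    (\<forall>\<phi>. test_function \<phi> \<longrightarrow> (LINT x|lborel. f x * partial_deriv i \<phi> x) = - (LINT x|lborel. h i x * \<phi> x))"
    by (rule choice[THEN exE])
  then have hm[measurable]: "h i \<in> borel_measurable borel" and hC: "(\<integral>\<^sup>+x. \<bar>h i x\<bar> powr p \<partial>lborel) \<le> ennreal C" for i by blast+
  define g where "g x = (\<chi> i. h i x)" for x
  have gi: "g x $ i = h i x" for x i by (simp add: g_def)
  have g[measurable]: "g \<in> borel_measurable borel"
  proof -
    have "g = (\<lambda>x. \<Sum>i\<in>UNIV. h i x *\<^sub>R axis i 1)"
      by (rule ext) (simp add: vec_eq_iff gi axis_def if_distrib cong: if_cong)
    moreover have "(\<lambda>x. \<Sum>i\<in>UNIV. h i x *\<^sub>R (axis i 1 :: real^'n)) \<in> borel_measurable borel" by measurable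
    ultimately show ?thesis by simp
  qed
  have powr_le: "norm (g x) powr p \<le> real CARD('n) powr p * (\<Sum>i\<in>UNIV. \<bar>h i x\<bar> powr p)" for x
  proof -
    define M where "M = Max (range (\<lambda>i. \<bar>h i x\<bar>))"
    have M: "\<bar>h i x\<bar> \<le> M" for i unfolding M_def by (intro Max_ge) auto
    have "M \<in> range (\<lambda>i. \<bar>h i x\<bar>)" unfolding M_def by (intro Max_in) auto
    then obtain j where j: "M = \<bar>h j x\<bar>" by auto
    have "norm (g x) \<le> (\<Sum>i\<in>UNIV. \<bar>g x $ i\<bar>)" by (rule norm_le_l1_cart)
    also have "\<dots> \<le> (\<Sum>i\<in>(UNIV::'n set). M)" by (intro sum_mono) (simp add: gi M)
    finally have "norm (g x) powr p \<le> (real CARD('n) * M) powr p" using p by (intro powr_mono2) auto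
    also have "\<dots> = real CARD('n) powr p * M powr p" using j by (simp add: powr_mult)
    also have "M powr p \<le> (\<Sum>i\<in>UNIV. \<bar>h i x\<bar> powr p)"
      unfolding j by (rule member_le_sum[of j UNIV "\<lambda>i. \<bar>h i x\<bar> powr p"]) auto
    finally show ?thesis by (simp add: mult_left_mono)
  qed
  have fin: "(\<integral>\<^sup>+x. norm (g x) powr p \<partial>lborel) < \<infinity>"
  proof -
    have "(\<integral>\<^sup>+x. norm (g x) powr p \<partial>lborel) \<le> (\<integral>\<^sup>+x. ennreal (real CARD('n) powr p) * (\<Sum>i\<in>UNIV. ennreal (\<bar>h i x\<bar> powr p)) \<partial>lborel)"
    proof (rule nn_integral_mono)
      fix x
      have "ennreal (norm (g x) powr p) \<le> ennreal (real CARD('n) powr p * (\<Sum>i\<in>UNIV. \<bar>h i x\<bar> powr p))" by (rule ennreal_leI[OF powr_le])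
      also have "\<dots> = ennreal (real CARD('n) powr p) * (\<Sum>i\<in>UNIV. ennreal (\<bar>h i x\<bar> powr p))"
        by (simp add: ennreal_mult sum_nonneg sum_ennreal)
      finally show "ennreal (norm (g x) powr p) \<le> ennreal (real CARD('n) powr p) * (\<Sum>i\<in>UNIV. ennreal (\<bar>h i x\<bar> powr p))" .
    qed
    also have "\<dots> = ennreal (real CARD('n) powr p) * (\<Sum>i\<in>UNIV. (\<integral>\<^sup>+x. ennreal (\<bar>h i x\<bar> powr p) \<partial>lborel))"
      by (simp add: nn_integral_cmult nn_integral_sum del: sum_ennreal)
    also have "\<dots> \<le> ennreal (real CARD('n) powr p) * (\<Sum>i\<in>(UNIV::'n set). ennreal C)"
      by (intro mult_left_mono sum_mono hC) simp
    also have "\<dots> < \<infinity>" by (simp add: ennreal_mult_less_top of_nat_less_top)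
    finally show ?thesis .
  qed
  \<comment> \<open>Local integrability follows from t <= 1 + t^p on balls, which have finite
    measure.\<close>
  have "borel_loc_int g"
  proof (rule borel_loc_intI[OF g])
    fix R
    have "(\<integral>\<^sup>+x\<in>cball 0 R. norm (g x) \<partial>lborel) \<le> (\<integral>\<^sup>+x. indicator (cball 0 R) x + ennreal (norm (g x) powr p) \<partial>lborel)"
    proof (rule nn_integral_mono)
      fix x
      have "ennreal (norm (g x)) \<le> ennreal (1 + norm (g x) powr p)"
        using abs_le_1_plus_powr[of p "norm (g x)"] p by (intro ennreal_leI) simp
      then show "ennreal (norm (g x)) * indicator (cball 0 R) x \<le> indicator (cball 0 R) x + ennreal (norm (g x) powr p)"
        by (cases "x \<in> cball 0 R") (simp_all add: ennreal_plus)
    qed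
    also have "\<dots> = emeasure lborel (cball (0::real^'n) R) + (\<integral>\<^sup>+x. norm (g x) powr p \<partial>lborel)"
      by (subst nn_integral_add) auto
    also have "\<dots> < \<infinity>" using fin emeasure_bounded_finite[of "cball (0::real^'n) R"] by simp
    finally show "(\<integral>\<^sup>+x\<in>cball 0 R. norm (g x) \<partial>lborel) < \<infinity>" .
  qed
  then have "borel_weak_gradient f g" using h f by (simp add: borel_weak_gradient_def gi)
  then show thesis using fin by (rule that)
qed

text \<open>Applies \<open>fundamental_lemma\<close> to the difference in each coordinate; it later
  lets any weak gradient stand in for the one that \<open>weak_gradient\<close> selects.\<close>

lemma borel_weak_gradient_unique:
  assumes "borel_weak_gradient f g" "borel_weak_gradient f g'"
  shows "AE x in lborel. g x = g' x"
proof -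
  have g: "borel_loc_int g" and g': "borel_loc_int g'" using assms by (auto simp: borel_weak_gradient_def)
  have "AE x in lborel. g x $ i - g' x $ i = 0" for i
  proof (rule fundamental_lemma)
    have i: "borel_loc_int (\<lambda>x. g x $ i)" "borel_loc_int (\<lambda>x. g' x $ i)"
      by (rule borel_loc_int_bounded_linear[OF g bounded_linear_vec_nth], rule borel_loc_int_bounded_linear[OF g' bounded_linear_vec_nth])
    then show "borel_loc_int (\<lambda>x. g x $ i - g' x $ i)"
      by (auto simp: borel_loc_int_def set_integrable_def right_diff_distrib)
    show "(LINT x|lborel. (g x $ i - g' x $ i) * \<phi> x) = 0" if "test_function \<phi>" for \<phi>
      using assms that borel_loc_int_test_function[OF i(1) that] borel_loc_int_test_function[OF i(2) that]
      by (simp add: borel_weak_gradient_def left_diff_distrib)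
  qed
  then have "AE x in lborel. \<forall>i\<in>UNIV. g x $ i - g' x $ i = 0" by (subst AE_finite_all) auto
  then show ?thesis by eventually_elim (simp add: vec_eq_iff)
qed

section \<open>Passage from Lebesgue measurable functions to Borel representatives\<close>

lemma locally_integrable_measurable:
  fixes f :: "real^'n \<Rightarrow> 'b::euclidean_space"
  assumes "locally_integrable f" shows "f \<in> borel_measurable lebesgue"
proof (rule borel_measurable_LIMSEQ_metric)
  show "(\<lambda>x. indicator (cball 0 (real n)) x *\<^sub>R f x) \<in> borel_measurable lebesgue" for n
    using assms unfolding locally_integrable_def set_integrable_def by (auto intro: borel_measurable_integrable)
  fix x :: "real^'n"
  obtain n0 :: nat where n0: "norm x \<le> real n0" using real_arch_simple by blast
  show "(\<lambda>n. indicator (cball 0 (real n)) x *\<^sub>R f x) \<longlonglongrightarrow> f x"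
  proof (rule tendsto_eventually, rule eventually_sequentiallyI)
    fix n assume "n \<ge> n0"
    then have "norm x \<le> real n" using n0 by linarith
    then show "indicator (cball 0 (real n)) x *\<^sub>R f x = f x" by simp
  qed
qed

lemma borel_loc_int_if_AE_eq:
  assumes f: "locally_integrable f" and [measurable]: "f' \<in> borel_measurable borel" and ae: "AE x in lborel. f x = f' x"
  shows "borel_loc_int f'"
  unfolding borel_loc_int_def set_integrable_def
proof (intro conjI allI)
  fix R
  have i: "integrable lebesgue (\<lambda>x. indicator (cball 0 R) x *\<^sub>R f x)" using f by (simp add: locally_integrable_def set_integrable_def)
  have "(\<lambda>x. indicator (cball 0 R) x *\<^sub>R f' x) \<in> borel_measurable lborel" by measurable
  then have m: "(\<lambda>x. indicator (cball 0 R) x *\<^sub>R f' x) \<in> borel_measurable lebesgue" by (rule measurable_completion)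
  have "AE x in lebesgue. indicator (cball 0 R) x *\<^sub>R f x = indicator (cball 0 R) x *\<^sub>R f' x"
    using ae unfolding AE_completion_iff by eventually_elim simp
  from integrable_cong_AE[OF borel_measurable_integrable[OF i] m this] i
  have "integrable lebesgue (\<lambda>x. indicator (cball 0 R) x *\<^sub>R f' x)" by (rule iffD1)
  then show "integrable lborel (\<lambda>x. indicator (cball 0 R) x *\<^sub>R f' x)" by (subst (asm) integrable_completion) measurable
qed (rule assms)

lemma borel_loc_int_imp_locally_integrable:
  assumes "borel_loc_int g" shows "locally_integrable g"
  unfolding locally_integrable_def
proof (intro allI impI)
  have [measurable]: "g \<in> borel_measurable borel" using assms by (rule borel_loc_int_measurable)
  fix K :: "(real^'a) set" assume K: "compact K"
  then have [measurable]: "K \<in> sets borel" by (simp add: borel_compact)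
  have "integrable lborel (\<lambda>x. indicator K x *\<^sub>R g x)"
    using borel_loc_int_bounded[OF assms compact_imp_bounded[OF K]] by (simp add: set_integrable_def)
  then show "set_integrable lebesgue K g" unfolding set_integrable_def by (subst integrable_completion) measurable
qed

lemma borel_representative_real:
  fixes f :: "real^'n \<Rightarrow> real"
  assumes "locally_integrable f"
  obtains f' where "borel_loc_int f'" "AE x in lborel. f x = f' x"
proof -
  obtain f' where "f' \<in> borel_measurable lborel" "AE x in lborel. f x = f' x"
    using completion_ex_borel_measurable_real[OF locally_integrable_measurable[OF assms]] by blast
  then have "f' \<in> borel_measurable borel" "AE x in lborel. f x = f' x" by auto
  then show thesis by (intro that[of f'] borel_loc_int_if_AE_eq[OF assms])
qed

lemma borel_representative_vector:
  fixes g :: "real^'n \<Rightarrow> real^'m"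
  assumes g: "locally_integrable g"
  obtains g' where "borel_loc_int g'" "AE x in lborel. g x = g' x"
proof -
  have [measurable]: "g \<in> borel_measurable lebesgue" by (rule locally_integrable_measurable[OF g])
  have "\<forall>i. \<exists>h. h \<in> borel_measurable lborel \<and> (AE x in lborel. g x $ i = h x)"
  proof
    fix i
    have "(\<lambda>v::real^'m. v $ i) \<in> borel_measurable borel" by measurable
    then have "(\<lambda>x. g x $ i) \<in> borel_measurable lebesgue" by (rule measurable_compose[OF \<open>g \<in> borel_measurable lebesgue\<close>])
    from completion_ex_borel_measurable_real[OF this] show "\<exists>h. h \<in> borel_measurable lborel \<and> (AE x in lborel. g x $ i = h x)" by blast
  qed
  then obtain h where "\<forall>i. h i \<in> borel_measurable lborel \<and> (AE x in lborel. g x $ i = h i x)" by (rule choice[THEN exE])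
  then have h[measurable]: "h i \<in> borel_measurable borel" and ae: "AE x in lborel. g x $ i = h i x" for i by auto
  define g' where "g' x = (\<Sum>i\<in>UNIV. h i x *\<^sub>R (axis i 1 :: real^'m))" for x
  have gi: "g' x $ i = h i x" for x i by (simp add: g'_def axis_def if_distrib cong: if_cong)
  have "g' \<in> borel_measurable borel" unfolding g'_def by measurable
  moreover have "AE x in lborel. \<forall>i\<in>UNIV. g x $ i = h i x" using ae by (subst AE_finite_all) auto
  then have "AE x in lborel. g x = g' x" by eventually_elim (simp add: vec_eq_iff gi)
  ultimately show thesis using borel_loc_int_if_AE_eq[OF g] that by blast
qed

lemma integral_lebesgue_borel_cong:
  fixes F F' :: "'a::euclidean_space \<Rightarrow> real"
  assumes "F \<in> borel_measurable lebesgue" and [measurable]: "F' \<in> borel_measurable borel" and ae: "AE x in lborel. F x = F' x"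
  shows "(LINT x|lebesgue. F x) = (LINT x|lborel. F' x)"
proof -
  have "(LINT x|lebesgue. F x) = (LINT x|lebesgue. F' x)"
    using assms by (intro integral_cong_AE) (auto simp: AE_completion_iff intro: measurable_completion)
  then show ?thesis by (simp add: integral_completion)
qed

lemma weak_gradient_borel_iff:
  assumes f: "locally_integrable f" and f': "borel_loc_int f'" "AE x in lborel. f x = f' x"
    and g: "locally_integrable g" and g': "borel_loc_int g'" "AE x in lborel. g x = g' x"
  shows "has_weak_gradient f g \<longleftrightarrow> borel_weak_gradient f' g'"
proof -
  have fm: "f \<in> borel_measurable lebesgue" and gm: "g \<in> borel_measurable lebesgue"
    and [measurable]: "f' \<in> borel_measurable borel" "g' \<in> borel_measurable borel"
    using locally_integrable_measurable[OF f] locally_integrable_measurable[OF g] borel_loc_int_measurable f' g' by auto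
  have "(LINT x|lebesgue. f x * partial_deriv i \<phi> x) = (LINT x|lborel. f' x * partial_deriv i \<phi> x)"
    "(LINT x|lebesgue. g x $ i * \<phi> x) = (LINT x|lborel. g' x $ i * \<phi> x)" if \<phi>: "test_function \<phi>" for \<phi> i
  proof -
    have [measurable]: "\<phi> \<in> borel_measurable borel" "partial_deriv i \<phi> \<in> borel_measurable borel"
      using test_functionD(4)[OF \<phi>] test_functionD(4)[OF test_function_partial[OF \<phi>]] by auto
    have l: "\<phi> \<in> borel_measurable lebesgue" "partial_deriv i \<phi> \<in> borel_measurable lebesgue"
      by (auto intro: measurable_completion)
    show "(LINT x|lebesgue. f x * partial_deriv i \<phi> x) = (LINT x|lborel. f' x * partial_deriv i \<phi> x)"
    proof (rule integral_lebesgue_borel_cong)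
      show "(\<lambda>x. f x * partial_deriv i \<phi> x) \<in> borel_measurable lebesgue" using l by (intro borel_measurable_times fm)
      show "AE x in lborel. f x * partial_deriv i \<phi> x = f' x * partial_deriv i \<phi> x" using f'(2) by eventually_elim simp
    qed measurable
    have "(\<lambda>v::real^'a. v $ i) \<in> borel_measurable borel" by measurable
    then have gm_i: "(\<lambda>x. g x $ i) \<in> borel_measurable lebesgue" and [measurable]: "(\<lambda>x. g' x $ i) \<in> borel_measurable borel"
      by (rule measurable_compose[OF gm], rule measurable_compose[OF \<open>g' \<in> borel_measurable borel\<close>])
    show "(LINT x|lebesgue. g x $ i * \<phi> x) = (LINT x|lborel. g' x $ i * \<phi> x)"
    proof (rule integral_lebesgue_borel_cong)
      show "(\<lambda>x. g x $ i * \<phi> x) \<in> borel_measurable lebesgue" using l by (intro borel_measurable_times gm_i)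
      show "AE x in lborel. g x $ i * \<phi> x = g' x $ i * \<phi> x" using g'(2) by eventually_elim simp
    qed measurable
  qed
  then show ?thesis unfolding has_weak_gradient_def borel_weak_gradient_def using f'(1) g g'(1) by auto
qed

lemma ball_average_AE_cong:
  assumes f: "f \<in> borel_measurable lebesgue" and [measurable]: "f' \<in> borel_measurable borel" and ae: "AE x in lborel. f x = f' x"
  shows "ball_average f a r = ball_average f' a r"
proof -
  have f'l: "f' \<in> borel_measurable lebesgue" by (intro measurable_completion) simp
  have "(LINT x:ball a r|lebesgue. f x) = (LINT x:ball a r|lebesgue. f' x)"
    unfolding set_lebesgue_integral_def
  proof (rule integral_cong_AE)
    show "AE x in lebesgue. indicator (ball a r) x *\<^sub>R f x = indicator (ball a r) x *\<^sub>R f' x"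
      unfolding AE_completion_iff using ae by eventually_elim simp
    have "indicator (ball a r) \<in> borel_measurable lebesgue" by (intro borel_measurable_indicator) auto
    then show "(\<lambda>x. indicator (ball a r) x *\<^sub>R f x) \<in> borel_measurable lebesgue" "(\<lambda>x. indicator (ball a r) x *\<^sub>R f' x) \<in> borel_measurable lebesgue"
      by (intro borel_measurable_scaleR f f'l; assumption)+
  qed
  then show ?thesis by (simp add: ball_average_def)
qed

text \<open>The equality holds at every (a, r): changing f on a null set affects neither the inner
  nor the outer average. So superlevel sets agree exactly, not just up to null sets.\<close>

lemma mean_oscillation_AE_cong:
  assumes f: "f \<in> borel_measurable lebesgue" and [measurable]: "f' \<in> borel_measurable borel" and ae: "AE x in lborel. f x = f' x"
  shows "mean_oscillation f = mean_oscillation f'"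
proof (rule ext, clarify)
  fix a r
  note f[measurable]
  have "ball_average (\<lambda>x. \<bar>f x - c\<bar>) a r = ball_average (\<lambda>x. \<bar>f' x - c\<bar>) a r" for c
    by (rule ball_average_AE_cong) (measurable, use ae in eventually_elim, simp)
  then show "mean_oscillation f (a, r) = mean_oscillation f' (a, r)"
    by (simp add: mean_oscillation_def ball_average_AE_cong[OF assms])
qed

text \<open>\<open>weak_gradient\<close> is an arbitrary choice; a Borel representative G of it
  agrees with g almost everywhere by \<open>borel_weak_gradient_unique\<close>.\<close>

lemma gradient_Lp_pow_borel:
  fixes f :: "real^'n \<Rightarrow> real"
  assumes f: "locally_integrable f" and f': "borel_loc_int f'" "AE x in lborel. f x = f' x"
    and w: "borel_weak_gradient f' g" and I: "(\<integral>\<^sup>+x. norm (g x) powr p \<partial>lborel) < \<infinity>"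
  shows "ennreal (gradient_Lp_pow p f) = (\<integral>\<^sup>+x. norm (g x) powr p \<partial>lborel)"
proof -
  have g: "borel_loc_int g" using w by (simp add: borel_weak_gradient_def)
  have [measurable]: "g \<in> borel_measurable borel" using g by (rule borel_loc_int_measurable)
  have "has_weak_gradient f g"
    using weak_gradient_borel_iff[OF f f' borel_loc_int_imp_locally_integrable[OF g] g] w by simp
  then have W: "has_weak_gradient f (weak_gradient f)" unfolding weak_gradient_def by (rule someI[where P="has_weak_gradient f"])
  then have Wl: "locally_integrable (weak_gradient f)" by (simp add: has_weak_gradient_def)
  obtain G where G: "borel_loc_int G" "AE x in lborel. weak_gradient f x = G x" using borel_representative_vector[OF Wl] .
  have "borel_weak_gradient f' G" using weak_gradient_borel_iff[OF f f' Wl G] W by simp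
  then have "AE x in lborel. G x = g x" using w by (rule borel_weak_gradient_unique)
  with G(2) have ae: "AE x in lborel. norm (weak_gradient f x) powr p = norm (g x) powr p" by eventually_elim simp
  have [measurable]: "weak_gradient f \<in> borel_measurable lebesgue" by (rule locally_integrable_measurable[OF Wl])
  have "gradient_Lp_pow p f = (LINT x|lborel. norm (g x) powr p)"
    unfolding gradient_Lp_pow_def by (rule integral_lebesgue_borel_cong[OF _ _ ae]) measurable
  moreover have "integrable lborel (\<lambda>x. norm (g x) powr p)" using I by (intro integrableI_bounded) auto
  ultimately show ?thesis by (simp add: nn_integral_eq_integral)
qed

lemma homogeneous_sobolev_borel:
  fixes f :: "real^'n \<Rightarrow> real"
  assumes f: "locally_integrable f" and f': "borel_loc_int f'" "AE x in lborel. f x = f' x"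
  shows "f \<in> homogeneous_sobolev p \<longleftrightarrow> (\<exists>g. borel_weak_gradient f' g \<and> (\<integral>\<^sup>+x. norm (g x) powr p \<partial>lborel) < \<infinity>)"
proof
  assume "f \<in> homogeneous_sobolev p"
  then obtain g where w: "has_weak_gradient f g" and i: "integrable lebesgue (\<lambda>x. norm (g x) powr p)"
    by (auto simp: homogeneous_sobolev_def)
  have gl: "locally_integrable g" using w by (simp add: has_weak_gradient_def)
  obtain G where G: "borel_loc_int G" "AE x in lborel. g x = G x" using borel_representative_vector[OF gl] .
  have [measurable]: "G \<in> borel_measurable borel" using G(1) by (rule borel_loc_int_measurable)
  have "borel_weak_gradient f' G" using weak_gradient_borel_iff[OF f f' gl G] w by simp
  moreover have "(\<integral>\<^sup>+x. norm (G x) powr p \<partial>lborel) < \<infinity>"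
  proof -
    have "(\<integral>\<^sup>+x. norm (G x) powr p \<partial>lborel) = (\<integral>\<^sup>+x. norm (g x) powr p \<partial>lborel)"
      by (rule nn_integral_cong_AE) (use G(2) in eventually_elim, simp)
    also have "\<dots> = (\<integral>\<^sup>+x. norm (norm (g x) powr p) \<partial>lebesgue)" by (simp add: nn_integral_completion)
    also have "\<dots> < \<infinity>" using i by (simp add: integrable_iff_bounded)
    finally show ?thesis .
  qed
  ultimately show "\<exists>g. borel_weak_gradient f' g \<and> (\<integral>\<^sup>+x. norm (g x) powr p \<partial>lborel) < \<infinity>" by blast
next
  assume "\<exists>g. borel_weak_gradient f' g \<and> (\<integral>\<^sup>+x. norm (g x) powr p \<partial>lborel) < \<infinity>"
  then obtain g where w: "borel_weak_gradient f' g" and I: "(\<integral>\<^sup>+x. norm (g x) powr p \<partial>lborel) < \<infinity>" by blast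
  have g: "borel_loc_int g" using w by (simp add: borel_weak_gradient_def)
  have [measurable]: "g \<in> borel_measurable borel" using g by (rule borel_loc_int_measurable)
  have "has_weak_gradient f g"
    using weak_gradient_borel_iff[OF f f' borel_loc_int_imp_locally_integrable[OF g] g] w by simp
  moreover have "integrable lborel (\<lambda>x. norm (g x) powr p)" using I by (intro integrableI_bounded) auto
  then have "integrable lebesgue (\<lambda>x. norm (g x) powr p)" by (subst integrable_completion) measurable
  ultimately show "f \<in> homogeneous_sobolev p" using f by (auto simp: homogeneous_sobolev_def)
qed

theorem theorem1:
  fixes p :: real
  assumes "1 < p"
  shows "\<exists>C::real. 0 < C \<and> (\<forall>f :: real^'n \<Rightarrow> real. locally_integrable f \<longrightarrow>
    (f \<in> homogeneous_sobolev p \<longleftrightarrow> mean_oscillation f \<in> weak_Lp (nu p) p) \<and>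
    (f \<in> homogeneous_sobolev p \<longrightarrow>
       ennreal (1 / C * gradient_Lp_pow p f) \<le> weak_Lp_sup (nu p) p (mean_oscillation f) \<and>
       weak_Lp_sup (nu p) p (mean_oscillation f) \<le> ennreal (C * gradient_Lp_pow p f) \<and>
       ((\<lambda>\<kappa>. ennreal (\<kappa> powr p) *
              emeasure (nu p) {z \<in> space (nu p). mean_oscillation f z > \<kappa>})
          \<longlongrightarrow> ennreal (limit_constant CARD('n) p * gradient_Lp_pow p f)) (at_right 0)))"
proof -
  define c where "c = limit_constant CARD('n) p"
  have c_eq: "c = linear_osc CARD('n) powr p / p" by (simp add: c_def limit_constant_def linear_osc_def)
  have c: "c > 0" using assms linear_osc_pos[of "CARD('n)"] by (simp add: c_eq)
  \<comment> \<open>The upper bound asks for C >= \<open>upper_constant p\<close>; the lower bound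
    will be read off from the limit and asks for 1 / C <= c.\<close>
  define C where "C = max (upper_constant p) (1 / c)"
  have C: "C > 0" "upper_constant p \<le> C" using c by (auto simp: C_def less_max_iff_disj)
  have "1 / c \<le> C" by (simp add: C_def)
  then have Cc: "1 / C \<le> c" using c C by (simp add: field_simps)
  let ?val = "\<lambda>f \<kappa>. ennreal (\<kappa> powr p) * emeasure (nu p) {z \<in> space (nu p). mean_oscillation f z > \<kappa>}"
  have sup_eq: "weak_Lp_sup (nu p) p (mean_oscillation f) = (SUP \<kappa>\<in>{0<..}. ?val f \<kappa>)" for f :: "real^'n \<Rightarrow> real"
    unfolding weak_Lp_sup_def by (simp add: mean_oscillation_nonneg)
  show ?thesis
  proof (intro exI[of _ C] conjI C(1) allI impI)
    fix f :: "real^'n \<Rightarrow> real" assume f: "locally_integrable f"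
    obtain f' where f': "borel_loc_int f'" "AE x in lborel. f x = f' x" using borel_representative_real[OF f] .
    have f'm: "f' \<in> borel_measurable borel" using f'(1) by (rule borel_loc_int_measurable)
    have mo: "mean_oscillation f = mean_oscillation f'"
      by (rule mean_oscillation_AE_cong[OF locally_integrable_measurable[OF f] f'm f'(2)])
    have mo_meas: "mean_oscillation f \<in> borel_measurable (nu p)"
    proof -
      have "mean_oscillation f \<in> borel_measurable lborel" using mean_oscillation_borel_measurable[OF f'm] by (simp add: mo)
      then have "mean_oscillation f \<in> borel_measurable (restrict_space lborel (UNIV \<times> {0<..}))" by (rule measurable_restrict_space1)
      then show ?thesis by (simp add: nu_def)
    qed
    have direct: "weak_Lp_sup (nu p) p (mean_oscillation f) \<le> ennreal (C * gradient_Lp_pow p f) \<and>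
      (?val f \<longlongrightarrow> ennreal (c * gradient_Lp_pow p f)) (at_right 0)" if fs: "f \<in> homogeneous_sobolev p"
    proof -
      obtain g where w: "borel_weak_gradient f' g" and I: "(\<integral>\<^sup>+x. norm (g x) powr p \<partial>lborel) < \<infinity>"
        using homogeneous_sobolev_borel[OF f f'] fs by blast
      have G: "ennreal (gradient_Lp_pow p f) = (\<integral>\<^sup>+x. norm (g x) powr p \<partial>lborel)" by (rule gradient_Lp_pow_borel[OF f f' w I])
      have "?val f \<kappa> \<le> ennreal (C * gradient_Lp_pow p f)" if "\<kappa> > 0" for \<kappa>
      proof -
        have "?val f \<kappa> \<le> ennreal (upper_constant p) * ennreal (gradient_Lp_pow p f)"
          unfolding mo G by (rule superlevel_upper_bound[OF w assms that])
        also have "\<dots> \<le> ennreal C * ennreal (gradient_Lp_pow p f)" using C by (intro mult_right_mono ennreal_leI) auto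
        finally show ?thesis using C by (simp add: ennreal_mult')
      qed
      then have "weak_Lp_sup (nu p) p (mean_oscillation f) \<le> ennreal (C * gradient_Lp_pow p f)"
        unfolding sup_eq by (intro SUP_least) auto
      moreover have "(?val f \<longlongrightarrow> ennreal (c * gradient_Lp_pow p f)) (at_right 0)"
        using superlevel_limit[OF w assms I] c by (simp add: mo G[symmetric] c_eq[symmetric] ennreal_mult')
      ultimately show ?thesis by blast
    qed
    show "f \<in> homogeneous_sobolev p \<longleftrightarrow> mean_oscillation f \<in> weak_Lp (nu p) p"
    proof
      assume "f \<in> homogeneous_sobolev p"
      with direct mo_meas show "mean_oscillation f \<in> weak_Lp (nu p) p"
        unfolding weak_Lp_def by (auto intro: order.strict_trans1)
    next
      assume "mean_oscillation f \<in> weak_Lp (nu p) p"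
      then have fin: "weak_Lp_sup (nu p) p (mean_oscillation f) < \<infinity>" by (simp add: weak_Lp_def)
      define A where "A = enn2real (weak_Lp_sup (nu p) p (mean_oscillation f))"
      have A: "ennreal A = (SUP \<kappa>\<in>{0<..}. ?val f' \<kappa>)" using fin by (simp add: A_def sup_eq mo less_top[symmetric])
      have "?val f' \<kappa> \<le> ennreal A" if "\<kappa> > 0" for \<kappa> unfolding A using that by (intro SUP_upper) simp
      then obtain g where "borel_weak_gradient f' g" "(\<integral>\<^sup>+x. norm (g x) powr p \<partial>lborel) < \<infinity>"
        using oscillation_imp_weak_gradient[OF f'(1) assms, of A] by (auto simp: A_def)
      then show "f \<in> homogeneous_sobolev p" using homogeneous_sobolev_borel[OF f f'] by blast
    qed
    assume fs: "f \<in> homogeneous_sobolev p"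
    show "weak_Lp_sup (nu p) p (mean_oscillation f) \<le> ennreal (C * gradient_Lp_pow p f)" using direct[OF fs] by blast
    show lim: "(?val f \<longlongrightarrow> ennreal (limit_constant CARD('n) p * gradient_Lp_pow p f)) (at_right 0)"
      using direct[OF fs] by (simp add: c_def)
    have "gradient_Lp_pow p f \<ge> 0" by (simp add: gradient_Lp_pow_def)
    then have "ennreal (1 / C * gradient_Lp_pow p f) \<le> ennreal (c * gradient_Lp_pow p f)"
      using Cc by (intro ennreal_leI mult_right_mono)
    \<comment> \<open>Each value at \<open>\<kappa>\<close> > 0 lies below the supremum, hence so
      does the limit.\<close>
    also have "\<dots> \<le> weak_Lp_sup (nu p) p (mean_oscillation f)"
      using lim unfolding c_def[symmetric]
    proof (rule tendsto_upperbound)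
      show "eventually (\<lambda>\<kappa>. ?val f \<kappa> \<le> weak_Lp_sup (nu p) p (mean_oscillation f)) (at_right 0)"
        unfolding sup_eq eventually_at_filter by (intro always_eventually) (auto intro: SUP_upper)
    qed simp
    finally show "ennreal (1 / C * gradient_Lp_pow p f) \<le> weak_Lp_sup (nu p) p (mean_oscillation f)" .
  qed
qed

end
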